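(* Let $\mathbb{K}$ be either $\mathbb{R}$ or $\mathbb{Q}_p$ for a prime $p$, and let $f_1,\dots,f_m\in\mathbb{K}[x]$ be $m\geq 2$ polynomials such that $1,f_1,\dots,f_m$ are linearly independent over $\mathbb{K}$. Then there exist constants $C>0$ and $a_0\geq 0$, depending only on $f_1,\dots,f_m$, such that for all $T>a>a_0$ (with $a,T\in\mathbb{Z}$ when $\mathbb{K}=\mathbb{Q}_p$) we have $$0<\bar{\alpha}\big(\mathrm{Cay}(\mathbb{K}^m,S_{a,T})\big)\leq \frac{C}{T-a},$$ where $$S_{a,T}=\left\{\pm\big(f_1(s),\dots,f_m(s)\big)\in\mathbb{K}^m\setminus\{0\} : s\in\mathbb{K},\ \mathbf{e}^a\leq\|s\|\leq\mathbf{e}^T\right\},$$ with $\mathbf{e}=e=2.718\ldots$ if $\mathbb{K}=\mathbb{R}$ and $\mathbf{e}=p$ if $\mathbb{K}=\mathbb{Q}_p$.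
   Context: On $\mathbb{R}$ (and $\mathbb{R}^m$), $\|\cdot\|$ is the absolute value (Euclidean norm); on $\mathbb{Q}_p$ it is the $p$-adic absolute value and on $\mathbb{Q}_p^m$ the supremum of the $p$-adic absolute values of the coordinates. $B_r$ denotes the ball of radius $r$ centered at $0$ in $\mathbb{K}^m$, and $|A|$ is the Haar measure of a Borel set $A\subseteq\mathbb{K}^m$ (normalized so that $\mathbb{Z}_p$ has measure $1$ in the $p$-adic case). For a symmetric set $S\subseteq\mathbb{K}^m$ not containing $0$, the Cayley graph $\mathrm{Cay}(\mathbb{K}^m,S)$ has vertex set $\mathbb{K}^m$, with $x,y$ adjacent iff $x-y\in S$. An independent set of this graph is a Borel set $I\subseteq\mathbb{K}^m$ containing no two adjacent vertices. The upper density of a Borel set $I$ is $\overline{d}(I)=\limsup_{r\to\infty}|I\cap B_r|/|B_r|$, and the independence ratio $\bar{\alpha}(\mathcal{G})$ of the graph is the supremum of $\overline{d}(I)$ over all independent sets $I$. *)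

theory Defs
  imports
    "HOL-Analysis.Analysis"
    "Berlekamp_Zassenhaus.Finite_Field"
begin

section \<open>The field of \<open>p\<close>-adic numbers\<close>

subsection \<open>The \<open>p\<close>-adic absolute value on the rationals\<close>

definition rat_padic_abs :: "nat \<Rightarrow> rat \<Rightarrow> real" where
  "rat_padic_abs p q =
     (if q = 0 then 0
      else let (a, b) = quotient_of q
           in real p ^ multiplicity (int p) b / real p ^ multiplicity (int p) a)"

lemma rat_padic_abs_0 [simp]: "rat_padic_abs p 0 = 0"
  by (simp add: rat_padic_abs_def)

lemma rat_padic_abs_Fract:
  assumes p: "prime p" and a: "a \<noteq> 0" and b: "b \<noteq> 0"
  shows "rat_padic_abs p (Rat.Fract a b) =
           real p ^ multiplicity (int p) b / real p ^ multiplicity (int p) a"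
proof -
  obtain a' b' where q: "quotient_of (Rat.Fract a b) = (a', b')" by (cases "quotient_of (Rat.Fract a b)")
  have b': "b' > 0" using q by (rule quotient_of_denom_pos)
  have eq: "Rat.Fract a b = Rat.Fract a' b'"
    using q by (metis Fract_of_int_quotient quotient_of_div)
  have nz: "Rat.Fract a b \<noteq> 0" using a b by (simp add: Zero_rat_def eq_rat)
  have a': "a' \<noteq> 0" using eq nz b' by (auto simp: Zero_rat_def eq_rat)
  have cross: "a * b' = a' * b" using eq b b' by (simp add: eq_rat)
  have pe: "prime_elem (int p)" using p by simp
  have "multiplicity (int p) a + multiplicity (int p) b' =
        multiplicity (int p) a' + multiplicity (int p) b"
    using cross prime_elem_multiplicity_mult_distrib[OF pe a, of b']
      prime_elem_multiplicity_mult_distrib[OF pe a' b] b' by simp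
  then have "real p ^ multiplicity (int p) a * real p ^ multiplicity (int p) b' =
             real p ^ multiplicity (int p) a' * real p ^ multiplicity (int p) b"
    by (simp flip: power_add)
  moreover have "real p \<noteq> 0" using p by (auto dest: prime_gt_0_nat)
  ultimately show ?thesis
    using nz q by (simp add: rat_padic_abs_def field_simps)
qed

context
  fixes p :: nat
  assumes p: "prime p"
begin

lemma rat_padic_abs_pos: "q \<noteq> 0 \<Longrightarrow> rat_padic_abs p q > 0"
proof -
  assume "q \<noteq> 0"
  moreover have "real p > 0" using p prime_gt_0_nat by simp
  ultimately show ?thesis by (auto simp: rat_padic_abs_def split: prod.split)
qed

lemma rat_padic_abs_nonneg: "rat_padic_abs p q \<ge> 0"
  using rat_padic_abs_pos[of q] by (cases "q = 0") auto

lemma rat_padic_abs_eq_0_iff: "rat_padic_abs p q = 0 \<longleftrightarrow> q = 0"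
  using rat_padic_abs_pos[of q] by (cases "q = 0") auto

lemma rat_padic_abs_1: "rat_padic_abs p 1 = 1"
  using rat_padic_abs_Fract[OF p, of 1 1] by (simp flip: One_rat_def)

lemma rat_padic_abs_mult: "rat_padic_abs p (x * y) = rat_padic_abs p x * rat_padic_abs p y"
proof (cases "x = 0 \<or> y = 0")
  case False
  obtain a b where x: "x = Rat.Fract a b" "b > 0" by (cases x)
  obtain c d where y: "y = Rat.Fract c d" "d > 0" by (cases y)
  have nz: "a \<noteq> 0" "c \<noteq> 0" using False x y by (auto simp: Zero_rat_def eq_rat)
  have pe: "prime_elem (int p)" using p by simp
  show ?thesis using x y nz
    by (simp add: rat_padic_abs_Fract[OF p] prime_elem_multiplicity_mult_distrib[OF pe] power_add)
qed auto

lemma rat_padic_abs_minus: "rat_padic_abs p (- x) = rat_padic_abs p x"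
proof -
  have "(rat_padic_abs p (- 1))\<^sup>2 = 1"
    using rat_padic_abs_mult[of "-1" "-1"] rat_padic_abs_1 by (simp add: power2_eq_square)
  then have "rat_padic_abs p (- 1) = 1"
    using rat_padic_abs_nonneg[of "-1"] by (simp add: power2_eq_1_iff)
  then show ?thesis using rat_padic_abs_mult[of "-1" x] by simp
qed

lemma rat_padic_abs_minus_commute: "rat_padic_abs p (x - y) = rat_padic_abs p (y - x)"
  using rat_padic_abs_minus[of "x - y"] by simp

lemma rat_padic_abs_ultrametric:
  "rat_padic_abs p (x + y) \<le> max (rat_padic_abs p x) (rat_padic_abs p y)"
proof (cases "x = 0 \<or> y = 0 \<or> x + y = 0")
  case True
  then show ?thesis using rat_padic_abs_nonneg[of x] by (auto simp: max_def)
next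
  case False
  obtain a b where x: "x = Rat.Fract a b" "b > 0" by (cases x)
  obtain c d where y: "y = Rat.Fract c d" "d > 0" by (cases y)
  define e f g where "e = a * d" and "f = c * b" and "g = b * d"
  have xg: "x = Rat.Fract e g" and yg: "y = Rat.Fract f g" and xyg: "x + y = Rat.Fract (e + f) g"
    and g: "g \<noteq> 0"
    using x y by (auto simp: e_def f_def g_def eq_rat algebra_simps)
  have nz: "e \<noteq> 0" "f \<noteq> 0" "e + f \<noteq> 0"
    using False g xyg by (auto simp: xg yg rat_number_collapse)
  let ?m = "multiplicity (int p)"
  have p1: "real p > 1" using p prime_gt_1_nat by simp
  have "int p ^ min (?m e) (?m f) dvd e + f"
    by (intro dvd_add multiplicity_dvd') auto
  then have "min (?m e) (?m f) \<le> ?m (e + f)"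
    using nz p by (intro multiplicity_geI) (auto simp: not_prime_unit)
  then have "?m e \<le> ?m (e + f) \<or> ?m f \<le> ?m (e + f)" by linarith
  then have "real p ^ ?m e \<le> real p ^ ?m (e + f) \<or> real p ^ ?m f \<le> real p ^ ?m (e + f)"
    using p1 by auto
  moreover have "real p ^ k > 0" for k using p1 by simp
  ultimately have "rat_padic_abs p (Rat.Fract (e + f) g) \<le> rat_padic_abs p (Rat.Fract e g) \<or>
             rat_padic_abs p (Rat.Fract (e + f) g) \<le> rat_padic_abs p (Rat.Fract f g)"
    using nz g by (auto simp: rat_padic_abs_Fract[OF p] intro!: divide_left_mono)
  then have "rat_padic_abs p (x + y) \<le> rat_padic_abs p x \<or>
             rat_padic_abs p (x + y) \<le> rat_padic_abs p y"
    by (simp only: xyg flip: xg yg)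
  then show ?thesis by auto
qed

lemma rat_padic_abs_triangle:
  "rat_padic_abs p (x + y) \<le> rat_padic_abs p x + rat_padic_abs p y"
  using rat_padic_abs_ultrametric[of x y] rat_padic_abs_nonneg[of x] rat_padic_abs_nonneg[of y]
  by linarith

lemma rat_padic_abs_diff_le:
  "\<bar>rat_padic_abs p x - rat_padic_abs p y\<bar> \<le> rat_padic_abs p (x - y)"
  using rat_padic_abs_triangle[of "x - y" y] rat_padic_abs_triangle[of "y - x" x]
    rat_padic_abs_minus_commute[of x y] by simp

lemma rat_padic_abs_inverse: "rat_padic_abs p (inverse x) = inverse (rat_padic_abs p x)"
proof (cases "x = 0")
  case False
  then show ?thesis
    using rat_padic_abs_mult[of x "inverse x"] rat_padic_abs_1 rat_padic_abs_eq_0_iff[of x]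
    by (simp add: inverse_unique)
qed simp

end

lemma rat_padic_abs_prime: "prime p \<Longrightarrow> rat_padic_abs p (of_nat p) = 1 / real p"
  using rat_padic_abs_Fract[of p "int p" 1]
  by (simp add: Fract_of_int_eq prime_gt_0_nat not_prime_unit multiplicity_self)


subsection \<open>Cauchy sequences and null sequences\<close>

definition padic_cauchy :: "nat \<Rightarrow> (nat \<Rightarrow> rat) \<Rightarrow> bool" where
  "padic_cauchy p X \<longleftrightarrow>
     (\<forall>e>0. \<exists>N. \<forall>m\<ge>N. \<forall>n\<ge>N. rat_padic_abs p (X m - X n) < e)"

definition padic_null :: "nat \<Rightarrow> (nat \<Rightarrow> rat) \<Rightarrow> bool" where
  "padic_null p X \<longleftrightarrow> (\<lambda>n. rat_padic_abs p (X n)) \<longlonglongrightarrow> 0"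

lemma padic_cauchy_const [simp]: "padic_cauchy p (\<lambda>_. c)"
  by (simp add: padic_cauchy_def)

context
  fixes p :: nat
  assumes p: "prime p"
begin

lemma padic_null_const_iff: "padic_null p (\<lambda>_. c) \<longleftrightarrow> c = 0"
  by (simp add: padic_null_def LIMSEQ_const_iff rat_padic_abs_eq_0_iff[OF p])

lemma padic_null_minus: "padic_null p X \<Longrightarrow> padic_null p (\<lambda>n. - X n)"
  by (simp add: padic_null_def rat_padic_abs_minus[OF p])

lemma padic_null_add:
  assumes "padic_null p X" "padic_null p Y"
  shows "padic_null p (\<lambda>n. X n + Y n)"
  unfolding padic_null_def
proof (rule tendsto_sandwich[where f = "\<lambda>_. 0"])
  show "(\<lambda>n. rat_padic_abs p (X n) + rat_padic_abs p (Y n)) \<longlonglongrightarrow> 0"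
    using tendsto_add[OF assms[unfolded padic_null_def]] by simp
qed (auto simp: rat_padic_abs_nonneg[OF p] rat_padic_abs_triangle[OF p])

lemma padic_null_diff: "padic_null p X \<Longrightarrow> padic_null p Y \<Longrightarrow> padic_null p (\<lambda>n. X n - Y n)"
  using padic_null_add[OF _ padic_null_minus, of X Y] by simp

lemma padic_cauchy_convergent_abs:
  assumes "padic_cauchy p X"
  shows "convergent (\<lambda>n. rat_padic_abs p (X n))"
proof -
  have "Cauchy (\<lambda>n. rat_padic_abs p (X n))"
    unfolding Cauchy_def dist_real_def
    using assms rat_padic_abs_diff_le[OF p] le_less_trans
    unfolding padic_cauchy_def by meson
  then show ?thesis by (rule Cauchy_convergent)
qed

lemma padic_cauchy_bounded:
  assumes "padic_cauchy p X"
  obtains B where "B > 0" "\<And>n. rat_padic_abs p (X n) \<le> B"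
proof -
  have "Bseq (\<lambda>n. rat_padic_abs p (X n))"
    using padic_cauchy_convergent_abs[OF assms] by (rule convergent_imp_Bseq)
  then obtain B where "B > 0" "\<And>n. norm (rat_padic_abs p (X n)) \<le> B" by (auto simp: Bseq_def)
  then show ?thesis using that rat_padic_abs_nonneg[OF p] by (auto intro: that)
qed

lemma padic_null_mult_bounded:
  assumes X: "padic_cauchy p X" and Y: "padic_null p Y"
  shows "padic_null p (\<lambda>n. X n * Y n)"
proof -
  obtain B where B: "B > 0" "\<And>n. rat_padic_abs p (X n) \<le> B" using padic_cauchy_bounded[OF X] by blast
  show ?thesis unfolding padic_null_def
  proof (rule tendsto_sandwich[where f = "\<lambda>_. 0"])
    show "(\<lambda>n. B * rat_padic_abs p (Y n)) \<longlonglongrightarrow> 0"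
      using tendsto_mult_left[OF Y[unfolded padic_null_def], of B] by simp
    qed (auto simp: rat_padic_abs_nonneg[OF p] rat_padic_abs_mult[OF p] intro!: always_eventually mult_right_mono B(2))
qed

lemma padic_cauchy_minus: "padic_cauchy p X \<Longrightarrow> padic_cauchy p (\<lambda>n. - X n)"
  by (simp add: padic_cauchy_def rat_padic_abs_minus_commute[OF p])

lemma padic_cauchy_add:
  assumes X: "padic_cauchy p X" and Y: "padic_cauchy p Y"
  shows "padic_cauchy p (\<lambda>n. X n + Y n)"
  unfolding padic_cauchy_def
proof (intro allI impI)
  fix e :: real assume e: "e > 0"
  obtain M where M: "\<And>m n. m \<ge> M \<Longrightarrow> n \<ge> M \<Longrightarrow> rat_padic_abs p (X m - X n) < e"
    using X e unfolding padic_cauchy_def by blast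
  obtain N where N: "\<And>m n. m \<ge> N \<Longrightarrow> n \<ge> N \<Longrightarrow> rat_padic_abs p (Y m - Y n) < e"
    using Y e unfolding padic_cauchy_def by blast
  have "rat_padic_abs p (X m + Y m - (X n + Y n)) < e" if "m \<ge> max M N" "n \<ge> max M N" for m n
    using rat_padic_abs_ultrametric[OF p, of "X m - X n" "Y m - Y n"] M[of m n] N[of m n] that
    by (simp add: algebra_simps)
  then show "\<exists>N. \<forall>m\<ge>N. \<forall>n\<ge>N. rat_padic_abs p (X m + Y m - (X n + Y n)) < e" by blast
qed

lemma padic_cauchy_mult:
  assumes X: "padic_cauchy p X" and Y: "padic_cauchy p Y"
  shows "padic_cauchy p (\<lambda>n. X n * Y n)"
  unfolding padic_cauchy_def
proof (intro allI impI)
  fix e :: real assume e: "e > 0"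
  obtain A where A: "A > 0" "\<And>n. rat_padic_abs p (X n) \<le> A" using padic_cauchy_bounded[OF X] by blast
  obtain B where B: "B > 0" "\<And>n. rat_padic_abs p (Y n) \<le> B" using padic_cauchy_bounded[OF Y] by blast
  obtain M where M: "\<And>m n. m \<ge> M \<Longrightarrow> n \<ge> M \<Longrightarrow> rat_padic_abs p (X m - X n) < e / B"
    using X e B unfolding padic_cauchy_def by (meson divide_pos_pos)
  obtain N where N: "\<And>m n. m \<ge> N \<Longrightarrow> n \<ge> N \<Longrightarrow> rat_padic_abs p (Y m - Y n) < e / A"
    using Y e A unfolding padic_cauchy_def by (meson divide_pos_pos)
  have "rat_padic_abs p (X m * Y m - X n * Y n) < e" if mn: "m \<ge> max M N" "n \<ge> max M N" for m n
  proof -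
    have "rat_padic_abs p (X m * (Y m - Y n)) \<le> A * rat_padic_abs p (Y m - Y n)"
      by (simp add: rat_padic_abs_mult[OF p] mult_right_mono A rat_padic_abs_nonneg[OF p])
    also have "\<dots> < e" using N[of m n] mn A by (simp add: field_simps)
    finally have 1: "rat_padic_abs p (X m * (Y m - Y n)) < e" .
    have "rat_padic_abs p ((X m - X n) * Y n) \<le> rat_padic_abs p (X m - X n) * B"
      by (simp add: rat_padic_abs_mult[OF p] mult_left_mono B rat_padic_abs_nonneg[OF p])
    also have "\<dots> < e" using M[of m n] mn B by (simp add: field_simps)
    finally have 2: "rat_padic_abs p ((X m - X n) * Y n) < e" .
    have "X m * Y m - X n * Y n = X m * (Y m - Y n) + (X m - X n) * Y n"
      by (simp add: algebra_simps)
    then show ?thesis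
      using rat_padic_abs_ultrametric[OF p, of "X m * (Y m - Y n)" "(X m - X n) * Y n"] 1 2 by simp
  qed
  then show "\<exists>N. \<forall>m\<ge>N. \<forall>n\<ge>N. rat_padic_abs p (X m * Y m - X n * Y n) < e" by blast
qed

lemma padic_cauchy_not_null:
  assumes X: "padic_cauchy p X" and nz: "\<not> padic_null p X"
  obtains b N where "b > 0" "\<And>n. n \<ge> N \<Longrightarrow> rat_padic_abs p (X n) > b"
proof -
  obtain L where L: "(\<lambda>n. rat_padic_abs p (X n)) \<longlonglongrightarrow> L"
    using padic_cauchy_convergent_abs[OF X] by (auto simp: convergent_def)
  have "L \<noteq> 0" using L nz by (auto simp: padic_null_def)
  moreover have "L \<ge> 0" using L by (rule LIMSEQ_le_const) (auto simp: rat_padic_abs_nonneg[OF p])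
  ultimately have "L > L / 2" "L / 2 > 0" by auto
  moreover from this obtain N where "\<And>n. n \<ge> N \<Longrightarrow> L / 2 < rat_padic_abs p (X n)"
    using order_tendstoD(1)[OF L, of "L / 2"] by (auto simp: eventually_sequentially)
  ultimately show ?thesis using that by blast
qed

lemma padic_cauchy_inverse:
  assumes X: "padic_cauchy p X" and nz: "\<not> padic_null p X"
  shows "padic_cauchy p (\<lambda>n. inverse (X n))"
  unfolding padic_cauchy_def
proof (intro allI impI)
  fix e :: real assume e: "e > 0"
  obtain b M where b: "b > 0" and M: "\<And>n. n \<ge> M \<Longrightarrow> rat_padic_abs p (X n) > b"
    using padic_cauchy_not_null[OF X nz] by blast
  obtain N where N: "\<And>m n. m \<ge> N \<Longrightarrow> n \<ge> N \<Longrightarrow> rat_padic_abs p (X m - X n) < e * (b * b)"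
    using X e b unfolding padic_cauchy_def by (metis mult_pos_pos)
  have "rat_padic_abs p (inverse (X m) - inverse (X n)) < e"
    if mn: "m \<ge> max M N" "n \<ge> max M N" for m n
  proof -
    let ?a = "rat_padic_abs p (X m)" and ?c = "rat_padic_abs p (X n)"
    have ac: "?a > b" "?c > b" using M mn by auto
    then have nz: "X m \<noteq> 0" "X n \<noteq> 0" using b by auto
    have "inverse (X m) - inverse (X n) = (X n - X m) * inverse (X m) * inverse (X n)"
      using nz by (simp add: field_simps)
    then have "rat_padic_abs p (inverse (X m) - inverse (X n)) =
               rat_padic_abs p (X n - X m) / (?a * ?c)"
      by (simp add: rat_padic_abs_mult[OF p] rat_padic_abs_inverse[OF p] divide_inverse)
    also have "\<dots> < e"
    proof -
      have "b * b < ?a * ?c" using ac b by (intro mult_strict_mono) auto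
      then have "e * (b * b) < e * (?a * ?c)" using e by simp
      then have "rat_padic_abs p (X n - X m) < e * (?a * ?c)" using N[of n m] mn by simp
      moreover have "?a * ?c > 0" using ac b by auto
      ultimately show ?thesis by (simp add: pos_divide_less_eq)
    qed
    finally show ?thesis .
  qed
  then show "\<exists>N. \<forall>m\<ge>N. \<forall>n\<ge>N. rat_padic_abs p (inverse (X m) - inverse (X n)) < e" by blast
qed

lemma padic_null_imp_cauchy_diff:
  assumes X: "padic_cauchy p X" and XY: "padic_null p (\<lambda>n. X n - Y n)"
  shows "padic_cauchy p Y"
  unfolding padic_cauchy_def
proof (intro allI impI)
  fix e :: real assume e: "e > 0"
  obtain M where M: "\<And>m n. m \<ge> M \<Longrightarrow> n \<ge> M \<Longrightarrow> rat_padic_abs p (X m - X n) < e"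
    using X e unfolding padic_cauchy_def by blast
  obtain N where N: "\<And>n. n \<ge> N \<Longrightarrow> rat_padic_abs p (X n - Y n) < e"
    using order_tendstoD(2)[OF XY[unfolded padic_null_def] e] by (auto simp: eventually_sequentially)
  have "rat_padic_abs p (Y m - Y n) < e" if mn: "m \<ge> max M N" "n \<ge> max M N" for m n
  proof -
    have eq: "Y m - Y n = ((X m - X n) + (Y m - X m)) + (X n - Y n)" by simp
    show ?thesis unfolding eq
      using rat_padic_abs_ultrametric[OF p, of "(X m - X n) + (Y m - X m)" "X n - Y n"]
        rat_padic_abs_ultrametric[OF p, of "X m - X n" "Y m - X m"] M[of m n] N[of n] N[of m] mn
        rat_padic_abs_minus_commute[OF p, of "X m" "Y m"] by simp
  qed
  then show "\<exists>N. \<forall>m\<ge>N. \<forall>n\<ge>N. rat_padic_abs p (Y m - Y n) < e" by blast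
qed

end


subsection \<open>The type of \<open>p\<close>-adic numbers\<close>

text \<open>
  The type \<open>'p padic\<close> is \<open>\<rat>\<^sub>p\<close> for \<open>p = CARD('p)\<close>, a prime by the class constraint:
  the completion of \<open>\<rat>\<close> for the \<open>p\<close>-adic absolute value, that is, Cauchy sequences
  modulo null sequences.
\<close>

definition padic_class :: "nat \<Rightarrow> (nat \<Rightarrow> rat) \<Rightarrow> (nat \<Rightarrow> rat) set" where
  "padic_class p X = {Y. padic_cauchy p Y \<and> padic_null p (\<lambda>n. X n - Y n)}"

typedef (overloaded) ('p::prime_card) padic =
  "padic_class CARD('p) ` {X. padic_cauchy CARD('p) X}"
  by (intro exI[of _ "padic_class CARD('p) (\<lambda>_. 0)"]) auto

definition Padic :: "(nat \<Rightarrow> rat) \<Rightarrow> 'p::prime_card padic" where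
  "Padic X = Abs_padic (padic_class CARD('p) X)"

definition padic_rep :: "'p::prime_card padic \<Rightarrow> nat \<Rightarrow> rat" where
  "padic_rep x = (SOME X. X \<in> Rep_padic x)"

lemma eq_Padic:
  assumes X: "padic_cauchy CARD('p) X" and Y: "padic_cauchy CARD('p) Y"
  shows "(Padic X :: 'p::prime_card padic) = Padic Y \<longleftrightarrow> padic_null CARD('p) (\<lambda>n. X n - Y n)"
proof -
  note p = prime_card[where 'a='p]
  have "(Padic X :: 'p padic) = Padic Y \<longleftrightarrow> padic_class CARD('p) X = padic_class CARD('p) Y"
    unfolding Padic_def using X Y by (intro Abs_padic_inject) auto
  also have "\<dots> \<longleftrightarrow> padic_null CARD('p) (\<lambda>n. X n - Y n)"
  proof
    assume eq: "padic_class CARD('p) X = padic_class CARD('p) Y"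
    have "Y \<in> padic_class CARD('p) Y"
      using Y by (simp add: padic_class_def padic_null_const_iff[OF p])
    then have "Y \<in> padic_class CARD('p) X" unfolding eq .
    then show "padic_null CARD('p) (\<lambda>n. X n - Y n)" by (simp add: padic_class_def)
  next
    assume XY: "padic_null CARD('p) (\<lambda>n. X n - Y n)"
    have "padic_null CARD('p) (\<lambda>n. X n - Z n) \<longleftrightarrow> padic_null CARD('p) (\<lambda>n. Y n - Z n)" for Z
      using padic_null_diff[OF p _ XY, of "\<lambda>n. X n - Z n"] padic_null_add[OF p XY, of "\<lambda>n. Y n - Z n"]
      by auto
    then show "padic_class CARD('p) X = padic_class CARD('p) Y" by (auto simp: padic_class_def)
  qed
  finally show ?thesis .
qed

lemma padic_cauchy_rep: "padic_cauchy CARD('p) (padic_rep (x :: 'p::prime_card padic))"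
  and Padic_rep [simp]: "Padic (padic_rep x) = x"
proof -
  note p = prime_card[where 'a='p]
  obtain X where X: "padic_cauchy CARD('p) X" "Rep_padic x = padic_class CARD('p) X"
    using Rep_padic[of x] by auto
  then have xX: "x = Padic X" unfolding Padic_def by (metis Rep_padic_inverse)
  have "X \<in> Rep_padic x" using X by (simp add: padic_class_def padic_null_const_iff[OF p])
  then have "padic_rep x \<in> Rep_padic x" unfolding padic_rep_def by (rule someI[where P = "\<lambda>X. X \<in> Rep_padic x"])
  then have *: "padic_cauchy CARD('p) (padic_rep x)" "padic_null CARD('p) (\<lambda>n. X n - padic_rep x n)"
    using X by (auto simp: padic_class_def)
  then show "padic_cauchy CARD('p) (padic_rep x)" "Padic (padic_rep x) = x"
    using X eq_Padic[of X "padic_rep x", where 'p='p] by (auto simp: xX)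
qed

lemma padic_null_rep_Padic:
  "padic_cauchy CARD('p) X \<Longrightarrow> padic_null CARD('p) (\<lambda>n. padic_rep (Padic X :: 'p::prime_card padic) n - X n)"
  by (subst eq_Padic[symmetric, where 'p='p]) (auto simp: padic_cauchy_rep)

lemma Padic_cases [cases type: padic]:
  fixes x :: "'p::prime_card padic"
  obtains X where "x = Padic X" "padic_cauchy CARD('p) X"
  using Padic_rep[of x] padic_cauchy_rep[of x] by metis

instantiation padic :: (prime_card) field
begin

definition "0 = (Padic (\<lambda>_. 0) :: 'a padic)"
definition "1 = (Padic (\<lambda>_. 1) :: 'a padic)"
definition "x + y = (Padic (\<lambda>n. padic_rep x n + padic_rep y n) :: 'a padic)"
definition "- x = (Padic (\<lambda>n. - padic_rep x n) :: 'a padic)"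
definition "x - y = x + - (y :: 'a padic)"
definition "x * y = (Padic (\<lambda>n. padic_rep x n * padic_rep y n) :: 'a padic)"
definition "inverse x = (if x = 0 then 0 else Padic (\<lambda>n. inverse (padic_rep x n)) :: 'a padic)"
definition "x div y = x * inverse (y :: 'a padic)"

lemma add_Padic:
  assumes X: "padic_cauchy CARD('a) X" and Y: "padic_cauchy CARD('a) Y"
  shows "(Padic X :: 'a padic) + Padic Y = Padic (\<lambda>n. X n + Y n)"
proof -
  note p = prime_card[where 'a='a]
  let ?X = "padic_rep (Padic X :: 'a padic)" and ?Y = "padic_rep (Padic Y :: 'a padic)"
  have eq: "?X n + ?Y n - (X n + Y n) = (?X n - X n) + (?Y n - Y n)" for n by simp
  show ?thesis unfolding plus_padic_def
    by (subst eq_Padic) (use assms in \<open>auto simp: eq padic_cauchy_rep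
        intro!: padic_cauchy_add[OF p] padic_null_add[OF p] padic_null_rep_Padic\<close>)
qed

lemma minus_Padic:
  assumes X: "padic_cauchy CARD('a) X"
  shows "- (Padic X :: 'a padic) = Padic (\<lambda>n. - X n)"
proof -
  note p = prime_card[where 'a='a]
  let ?X = "padic_rep (Padic X :: 'a padic)"
  have eq: "- ?X n - - X n = - (?X n - X n)" for n by simp
  show ?thesis unfolding uminus_padic_def
    by (subst eq_Padic) (use assms in \<open>simp_all only: eq padic_cauchy_rep padic_cauchy_minus[OF p]
      padic_null_minus[OF p] padic_null_rep_Padic\<close>)
qed

lemma diff_Padic:
  assumes X: "padic_cauchy CARD('a) X" and Y: "padic_cauchy CARD('a) Y"
  shows "(Padic X :: 'a padic) - Padic Y = Padic (\<lambda>n. X n - Y n)"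
  using assms
  by (simp add: minus_padic_def minus_Padic add_Padic padic_cauchy_minus[OF prime_card[where 'a='a]])

lemma mult_Padic:
  assumes X: "padic_cauchy CARD('a) X" and Y: "padic_cauchy CARD('a) Y"
  shows "(Padic X :: 'a padic) * Padic Y = Padic (\<lambda>n. X n * Y n)"
proof -
  note p = prime_card[where 'a='a]
  let ?X = "padic_rep (Padic X :: 'a padic)" and ?Y = "padic_rep (Padic Y :: 'a padic)"
  have eq: "?X n * ?Y n - X n * Y n = ?X n * (?Y n - Y n) + Y n * (?X n - X n)" for n
    by (simp add: algebra_simps)
  show ?thesis unfolding times_padic_def
    by (subst eq_Padic) (use assms in \<open>auto simp: eq padic_cauchy_rep
        intro!: padic_cauchy_mult[OF p] padic_null_add[OF p] padic_null_mult_bounded[OF p]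
          padic_null_rep_Padic\<close>)
qed

lemma Padic_eq_0_iff:
  "padic_cauchy CARD('a) X \<Longrightarrow> (Padic X :: 'a padic) = 0 \<longleftrightarrow> padic_null CARD('a) X"
  by (simp add: zero_padic_def eq_Padic)

instance
proof
  note p = prime_card[where 'a='a]
  note cauchy = padic_cauchy_add[OF p] padic_cauchy_minus[OF p] padic_cauchy_mult[OF p]
  fix a b c :: "'a padic"
  show "a + b = b + a"
    by (cases a; cases b) (simp add: add_Padic add.commute)
  show "a + b + c = a + (b + c)"
    by (cases a; cases b; cases c) (simp add: add_Padic cauchy add.assoc)
  show "0 + a = a"
    by (cases a) (simp add: zero_padic_def add_Padic)
  show "- a + a = 0"
    by (cases a) (simp add: zero_padic_def add_Padic minus_Padic cauchy)
  show "a - b = a + - b"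
    by (rule minus_padic_def)
  show "a * b * c = a * (b * c)"
    by (cases a; cases b; cases c) (simp add: mult_Padic cauchy mult.assoc)
  show "a * b = b * a"
    by (cases a; cases b) (simp add: mult_Padic mult.commute)
  show "1 * a = a"
    by (cases a) (simp add: one_padic_def mult_Padic)
  show "(a + b) * c = a * c + b * c"
    by (cases a; cases b; cases c) (simp add: mult_Padic add_Padic cauchy distrib_right)
  show "(0 :: 'a padic) \<noteq> 1"
    by (simp add: zero_padic_def one_padic_def eq_Padic padic_null_const_iff[OF p])
  show "inverse a * a = 1" if "a \<noteq> 0"
  proof -
    let ?X = "padic_rep a"
    have X: "padic_cauchy CARD('a) ?X" by (rule padic_cauchy_rep)
    have nz: "\<not> padic_null CARD('a) ?X" using Padic_eq_0_iff[OF X] that by simp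
    obtain e N where "e > 0" "\<And>n. n \<ge> N \<Longrightarrow> rat_padic_abs CARD('a) (?X n) > e"
      using padic_cauchy_not_null[OF p X nz] by blast
    then have "?X n \<noteq> 0" if "n \<ge> N" for n using that by force
    then have "eventually (\<lambda>n. rat_padic_abs CARD('a) (inverse (?X n) * ?X n - 1) = 0) sequentially"
      by (auto simp: eventually_sequentially intro!: exI[of _ N])
    then have null: "padic_null CARD('a) (\<lambda>n. inverse (?X n) * ?X n - 1)"
      unfolding padic_null_def by (rule tendsto_eventually)
    have "inverse a * a = Padic (\<lambda>n. inverse (?X n)) * Padic ?X"
      using that by (simp add: inverse_padic_def)
    also have "\<dots> = Padic (\<lambda>n. inverse (?X n) * ?X n)"
      by (intro mult_Padic padic_cauchy_inverse[OF p] X nz)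
    also have "\<dots> = 1"
      using null unfolding one_padic_def
      by (subst eq_Padic) (auto intro!: padic_cauchy_mult[OF p] padic_cauchy_inverse[OF p] X nz)
    finally show ?thesis .
  qed
  show "a div b = a * inverse b"
    by (rule divide_padic_def)
  show "inverse (0 :: 'a padic) = 0"
    by (simp add: inverse_padic_def)
qed

end

lemma of_nat_padic: "(of_nat n :: 'p::prime_card padic) = Padic (\<lambda>_. of_nat n)"
  by (induction n) (simp_all add: zero_padic_def one_padic_def add_Padic)

instance padic :: (prime_card) field_char_0
proof
  show "inj (of_nat :: nat \<Rightarrow> 'a padic)"
    by (rule injI) (simp add: of_nat_padic eq_Padic padic_null_const_iff[OF prime_card[where 'a='a]])
qed

lemma of_int_padic: "(of_int n :: 'p::prime_card padic) = Padic (\<lambda>_. of_int n)"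
  by (cases n rule: int_diff_cases) (simp add: of_nat_padic diff_Padic)

lemma of_rat_padic: "(of_rat q :: 'p::prime_card padic) = Padic (\<lambda>_. q)"
proof (cases q)
  case (Fract a b)
  then have "of_int b * (Padic (\<lambda>_. q) :: 'p padic) = of_int a"
    by (simp add: of_int_padic mult_Padic Fract_of_int_quotient)
  then show ?thesis using Fract by (simp add: of_rat_rat field_simps)
qed


subsection \<open>The absolute value and the topology\<close>

definition padic_abs :: "'p::prime_card padic \<Rightarrow> real" where
  "padic_abs x = lim (\<lambda>n. rat_padic_abs CARD('p) (padic_rep x n))"

lemma tendsto_padic_abs:
  assumes X: "padic_cauchy CARD('p) X"
  shows "(\<lambda>n. rat_padic_abs CARD('p) (X n)) \<longlonglongrightarrow> padic_abs (Padic X :: 'p::prime_card padic)"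
proof -
  note p = prime_card[where 'a='p]
  let ?Y = "padic_rep (Padic X :: 'p padic)"
  have Y: "(\<lambda>n. rat_padic_abs CARD('p) (?Y n)) \<longlonglongrightarrow> padic_abs (Padic X :: 'p padic)"
    unfolding padic_abs_def
    using padic_cauchy_convergent_abs[OF p padic_cauchy_rep, of "Padic X :: 'p padic"]
    by (simp add: convergent_LIMSEQ_iff)
  have le: "norm (rat_padic_abs CARD('p) (X n) - rat_padic_abs CARD('p) (?Y n)) \<le>
              rat_padic_abs CARD('p) (?Y n - X n)" for n
    using rat_padic_abs_diff_le[OF p, of "?Y n" "X n"] by (simp add: abs_minus_commute)
  have "(\<lambda>n. rat_padic_abs CARD('p) (?Y n - X n)) \<longlonglongrightarrow> 0"
    using padic_null_rep_Padic[OF X] by (simp add: padic_null_def)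
  then have "(\<lambda>n. rat_padic_abs CARD('p) (X n) - rat_padic_abs CARD('p) (?Y n)) \<longlonglongrightarrow> 0"
    by (rule Lim_null_comparison[OF always_eventually[OF allI[OF le]]])
  from tendsto_add[OF this Y] show ?thesis by simp
qed

lemma padic_abs_ultrametric: "padic_abs (x + y :: 'p::prime_card padic) \<le> max (padic_abs x) (padic_abs y)"
proof -
  note p = prime_card[where 'a='p]
  obtain X where X: "x = Padic X" "padic_cauchy CARD('p) X" by (cases x)
  obtain Y where Y: "y = Padic Y" "padic_cauchy CARD('p) Y" by (cases y)
  show ?thesis unfolding X(1) Y(1) add_Padic[OF X(2) Y(2)]
    by (rule LIMSEQ_le[OF tendsto_padic_abs[OF padic_cauchy_add[OF p X(2) Y(2)]]
        tendsto_max[OF tendsto_padic_abs[OF X(2)] tendsto_padic_abs[OF Y(2)]]])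
      (auto simp: rat_padic_abs_ultrametric[OF p])
qed

lemma padic_abs_eq_0_iff: "padic_abs (x :: 'p::prime_card padic) = 0 \<longleftrightarrow> x = 0"
proof -
  obtain X where X: "x = Padic X" "padic_cauchy CARD('p) X" by (cases x)
  have "padic_abs (Padic X :: 'p padic) = 0 \<longleftrightarrow> padic_null CARD('p) X"
    using tendsto_padic_abs[OF X(2)] LIMSEQ_unique[OF tendsto_padic_abs[OF X(2)], of 0]
    by (auto simp: padic_null_def)
  then show ?thesis by (simp add: X Padic_eq_0_iff)
qed

lemma padic_abs_nonneg: "padic_abs (x :: 'p::prime_card padic) \<ge> 0"
proof -
  obtain X where X: "x = Padic X" "padic_cauchy CARD('p) X" by (cases x)
  show ?thesis unfolding X(1)
    by (rule LIMSEQ_le_const[OF tendsto_padic_abs[OF X(2)]])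
      (auto simp: rat_padic_abs_nonneg[OF prime_card[where 'a='p]])
qed

lemma padic_abs_minus: "padic_abs (- x :: 'p::prime_card padic) = padic_abs x"
proof -
  note p = prime_card[where 'a='p]
  obtain X where X: "x = Padic X" "padic_cauchy CARD('p) X" by (cases x)
  have "(\<lambda>n. rat_padic_abs CARD('p) (X n)) \<longlonglongrightarrow> padic_abs (- x)"
    using tendsto_padic_abs[OF padic_cauchy_minus[OF p X(2)]]
    by (simp add: X minus_Padic rat_padic_abs_minus[OF p])
  then show ?thesis using tendsto_padic_abs[OF X(2)] unfolding X(1) by (rule LIMSEQ_unique)
qed

instantiation padic :: (prime_card) metric_space
begin

definition dist_padic_def:
  "dist (x :: 'a padic) y = padic_abs (x - y)"

definition uniformity_padic_def:
  "(uniformity :: ('a padic \<times> 'a padic) filter) = (INF e\<in>{0 <..}. principal {(x, y). dist x y < e})"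

definition open_padic_def:
  "open (U :: 'a padic set) \<longleftrightarrow> (\<forall>x\<in>U. eventually (\<lambda>(x', y). x' = x \<longrightarrow> y \<in> U) uniformity)"

instance
proof
  show "uniformity = (INF e\<in>{0 <..}. principal {(x :: 'a padic, y). dist x y < e})"
    by (rule uniformity_padic_def)
  show "open U \<longleftrightarrow> (\<forall>x\<in>U. eventually (\<lambda>(x', y). x' = x \<longrightarrow> y \<in> U) uniformity)"
    for U :: "'a padic set"
    by (rule open_padic_def)
  show "dist x y = 0 \<longleftrightarrow> x = y" for x y :: "'a padic"
    by (simp add: dist_padic_def padic_abs_eq_0_iff)
  show "dist x y \<le> dist x z + dist y z" for x y z :: "'a padic"
  proof -
    have "x - y = (x - z) + - (y - z)" by simp
    then have "padic_abs (x - y) \<le> max (padic_abs (x - z)) (padic_abs (y - z))"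
      using padic_abs_ultrametric[of "x - z" "- (y - z)"] padic_abs_minus[of "y - z"] by simp
    then show ?thesis
      unfolding dist_padic_def using padic_abs_nonneg[of "x - z"] padic_abs_nonneg[of "y - z"]
      by linarith
  qed
qed

end

lemma padic_abs_mult: "padic_abs (x * y :: 'p::prime_card padic) = padic_abs x * padic_abs y"
proof -
  note p = prime_card[where 'a='p]
  obtain X where X: "x = Padic X" "padic_cauchy CARD('p) X" by (cases x)
  obtain Y where Y: "y = Padic Y" "padic_cauchy CARD('p) Y" by (cases y)
  have "(\<lambda>n. rat_padic_abs CARD('p) (X n * Y n)) \<longlonglongrightarrow> padic_abs x * padic_abs y"
    unfolding rat_padic_abs_mult[OF p] X(1) Y(1)
    by (intro tendsto_mult tendsto_padic_abs X Y)
  moreover have "(\<lambda>n. rat_padic_abs CARD('p) (X n * Y n)) \<longlonglongrightarrow> padic_abs (x * y)"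
    unfolding X(1) Y(1) mult_Padic[OF X(2) Y(2)]
    by (intro tendsto_padic_abs padic_cauchy_mult[OF p] X Y)
  ultimately show ?thesis by (rule LIMSEQ_unique[symmetric])
qed

lemma padic_abs_of_rat: "padic_abs (of_rat q :: 'p::prime_card padic) = rat_padic_abs CARD('p) q"
proof -
  have "(\<lambda>_. rat_padic_abs CARD('p) q) \<longlonglongrightarrow> padic_abs (of_rat q :: 'p padic)"
    unfolding of_rat_padic by (rule tendsto_padic_abs) simp
  then show ?thesis by (simp add: LIMSEQ_const_iff)
qed

lemma padic_abs_Padic_diff_of_rat_le:
  assumes X: "padic_cauchy CARD('p) X" and le: "\<And>n. n \<ge> N \<Longrightarrow> rat_padic_abs CARD('p) (X n - q) \<le> e"
  shows "padic_abs (Padic X - of_rat q :: 'p::prime_card padic) \<le> e"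
proof -
  note p = prime_card[where 'a='p]
  have "padic_cauchy CARD('p) (\<lambda>n. X n - q)"
    using padic_cauchy_add[OF p X, of "\<lambda>_. - q"] by simp
  from tendsto_padic_abs[OF this]
  have "(\<lambda>n. rat_padic_abs CARD('p) (X n - q)) \<longlonglongrightarrow> padic_abs (Padic X - of_rat q :: 'p padic)"
    by (simp add: of_rat_padic diff_Padic X)
  then show ?thesis by (rule LIMSEQ_le_const2) (use le in blast)
qed

lemma rat_dense_padic:
  fixes x :: "'p::prime_card padic"
  assumes "e > 0"
  obtains q where "padic_abs (x - of_rat q) < e"
proof -
  obtain X where X: "x = Padic X" "padic_cauchy CARD('p) X" by (cases x)
  from \<open>e > 0\<close> have "e / 2 > 0" by simp
  then obtain N where N: "\<And>m n. m \<ge> N \<Longrightarrow> n \<ge> N \<Longrightarrow> rat_padic_abs CARD('p) (X m - X n) < e / 2"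
    using X(2) unfolding padic_cauchy_def by meson
  have "padic_abs (x - of_rat (X N)) \<le> e / 2"
    unfolding X(1) using N by (intro padic_abs_Padic_diff_of_rat_le[OF X(2), of N] less_imp_le) auto
  with \<open>e > 0\<close> show ?thesis by (intro that[of "X N"]) simp
qed

instance padic :: (prime_card) complete_space
proof
  fix S :: "nat \<Rightarrow> 'a padic"
  assume S: "Cauchy S"
  have "\<exists>q. padic_abs (S n - of_rat q) < inverse (of_nat (Suc n))" for n
    by (rule rat_dense_padic[of "inverse (of_nat (Suc n))" "S n"]) auto
  then obtain q where q: "\<And>n. dist (S n) (of_rat (q n)) < inverse (of_nat (Suc n))"
    unfolding dist_padic_def by metis
  have lim0: "(\<lambda>n. dist (S n) (of_rat (q n))) \<longlonglongrightarrow> 0"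
    by (rule tendsto_sandwich[OF _ _ tendsto_const LIMSEQ_inverse_real_of_nat])
      (use q in \<open>auto intro!: always_eventually less_imp_le simp del: of_nat_Suc\<close>)
  have cauchy: "padic_cauchy CARD('a) q"
    unfolding padic_cauchy_def
  proof (intro allI impI)
    fix e :: real assume "e > 0"
    then have e: "e / 3 > 0" by simp
    obtain M where M: "\<And>n. n \<ge> M \<Longrightarrow> dist (S n) (of_rat (q n)) < e / 3"
      using order_tendstoD(2)[OF lim0 e] by (auto simp: eventually_sequentially)
    obtain N where N: "\<And>m n. m \<ge> N \<Longrightarrow> n \<ge> N \<Longrightarrow> dist (S m) (S n) < e / 3"
      using metric_CauchyD[OF S e] by blast
    have "rat_padic_abs CARD('a) (q m - q n) < e" if mn: "m \<ge> max M N" "n \<ge> max M N" for m n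
    proof -
      have "rat_padic_abs CARD('a) (q m - q n) = dist (of_rat (q m)) (of_rat (q n) :: 'a padic)"
        by (simp add: dist_padic_def padic_abs_of_rat flip: of_rat_diff)
      also have "\<dots> \<le> dist (S m) (of_rat (q m)) + dist (S m) (S n) + dist (S n) (of_rat (q n))"
        using dist_triangle[of "of_rat (q m)" "of_rat (q n)" "S m"]
          dist_triangle[of "S m" "of_rat (q n)" "S n"] by (simp add: dist_commute)
      also have "\<dots> < e" using M[of m] M[of n] N[of m n] mn by simp
      finally show ?thesis .
    qed
    then show "\<exists>N. \<forall>m\<ge>N. \<forall>n\<ge>N. rat_padic_abs CARD('a) (q m - q n) < e" by blast
  qed
  have "(\<lambda>n. dist (of_rat (q n)) (Padic q :: 'a padic)) \<longlonglongrightarrow> 0"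
  proof (rule LIMSEQ_I)
    fix e :: real assume "e > 0"
    then have "e / 2 > 0" by simp
    then obtain N where N: "\<And>m n. m \<ge> N \<Longrightarrow> n \<ge> N \<Longrightarrow> rat_padic_abs CARD('a) (q m - q n) < e / 2"
      using cauchy unfolding padic_cauchy_def by meson
    have "dist (of_rat (q n)) (Padic q :: 'a padic) < e" if "n \<ge> N" for n
    proof -
      have "padic_abs (Padic q - of_rat (q n) :: 'a padic) \<le> e / 2"
        using N that by (intro padic_abs_Padic_diff_of_rat_le[OF cauchy, of N] less_imp_le) auto
      then show ?thesis
        using \<open>e > 0\<close> unfolding dist_commute[of "of_rat (q n)"] by (simp add: dist_padic_def)
    qed
    then show "\<exists>no. \<forall>n\<ge>no. norm (dist (of_rat (q n)) (Padic q :: 'a padic) - 0) < e" by auto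
  qed
  with lim0 have "(\<lambda>n. dist (S n) (of_rat (q n)) + dist (of_rat (q n)) (Padic q :: 'a padic)) \<longlonglongrightarrow> 0"
    by (rule tendsto_add_zero)
  then have "(\<lambda>n. dist (S n) (Padic q)) \<longlonglongrightarrow> 0"
    by (rule Lim_null_comparison[rotated]) (auto intro!: always_eventually dist_triangle)
  then show "convergent S"
    unfolding convergent_def by (metis tendsto_dist_iff)
qed


section \<open>Haar measure on \<open>\<rat>\<^sub>p\<^sup>m\<close>\<close>

text \<open>
  The Borel sets are those of the product topology, which is the topology of the supremum of the
  absolute values of the coordinates. The measure is normalised by \<open>\<mu>(\<int>\<^sub>p\<^sup>m) = 1\<close>. The defining
  properties have exactly one solution; existence is proved below.
\<close>

definition padic_haar_measure :: "('p::prime_card padic ^ 'm::finite) measure \<Rightarrow> bool" where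
  "padic_haar_measure M \<longleftrightarrow>
     sets M = sets borel \<and>
     emeasure M {x. \<forall>i. padic_abs (x $ i) \<le> 1} = 1 \<and>
     (\<forall>c. \<forall>A\<in>sets borel. emeasure M ((+) c ` A) = emeasure M A)"

definition padic_haar :: "('p::prime_card padic ^ 'm::finite) measure" where
  "padic_haar = (SOME M. padic_haar_measure M)"


subsection \<open>Existence\<close>

text \<open>
  Reversing base-\<open>p\<close> expansions maps \<open>\<Sum> d\<^sub>k p\<^bsup>-k-1\<^esup> \<in> [0, \<infinity>)\<close> to \<open>\<Sum> d\<^sub>k p\<^bsup>k\<^esup> \<in> \<rat>\<^sub>p\<close>. The preimage of
  a ball of radius \<open>p\<^bsup>-n\<^esup>\<close> is a half-open interval of length \<open>p\<^bsup>-n\<^esup>\<close>, so the image of Lebesgue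
  measure under the coordinatewise map is a Haar measure.
\<close>

context
  fixes p :: nat
  assumes p: "prime p"
begin

lemma rat_padic_abs_of_int_le_1: "rat_padic_abs p (of_int k) \<le> 1"
proof (cases "k = 0")
  case False
  moreover have "real p ^ multiplicity (int p) k \<ge> 1"
    using prime_ge_1_nat[OF p] by (intro one_le_power) simp
  ultimately show ?thesis
    using rat_padic_abs_Fract[OF p, of k 1] prime_gt_0_nat[OF p]
    by (simp add: Fract_of_int_eq[symmetric] divide_le_eq_1_pos flip: of_int_rat)
qed simp

lemma rat_padic_abs_of_int_dvd: "int p dvd k \<Longrightarrow> rat_padic_abs p (of_int k) \<le> 1 / real p"
  using rat_padic_abs_of_int_le_1 prime_gt_0_nat[OF p]
  by (auto simp: rat_padic_abs_mult[OF p] rat_padic_abs_prime[OF p] field_simps elim!: dvdE)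

lemma rat_padic_abs_of_int_not_dvd: "\<not> int p dvd k \<Longrightarrow> rat_padic_abs p (of_int k) = 1"
  using rat_padic_abs_Fract[OF p, of k 1]
  by (cases "k = 0") (simp_all add: not_dvd_imp_multiplicity_0 Fract_of_int_eq[symmetric] flip: of_int_rat)

lemma rat_padic_abs_prime_power: "rat_padic_abs p (of_nat p ^ n) = 1 / real p ^ n"
  by (induction n) (simp_all add: rat_padic_abs_1[OF p] rat_padic_abs_mult[OF p] rat_padic_abs_prime[OF p])

lemma rat_padic_abs_digit:
  assumes "rat_padic_abs p y \<le> 1"
  obtains d where "d < p" "rat_padic_abs p (y - of_nat d) \<le> 1 / real p"
proof (cases "y = 0")
  case True
  then show ?thesis using that[of 0] prime_gt_0_nat[OF p] by simp
next
  case False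
  obtain a b where y: "y = Rat.Fract a b" "b > 0" "coprime a b" by (cases y)
  have a: "a \<noteq> 0" using False y by (auto simp: rat_number_collapse)
  have p1: "real p > 1" using prime_gt_1_nat[OF p] by simp
  have pb: "\<not> int p dvd b"
  proof
    assume "int p dvd b"
    have "real p ^ multiplicity (int p) b \<le> real p ^ multiplicity (int p) a"
      using assms y a p1 by (simp add: rat_padic_abs_Fract[OF p] pos_divide_le_eq)
    then have "multiplicity (int p) b \<le> multiplicity (int p) a" using p1 by simp
    moreover have "multiplicity (int p) b > 0"
      using \<open>int p dvd b\<close> y(2) p by (subst prime_multiplicity_gt_zero_iff) auto
    ultimately have "multiplicity (int p) a > 0" by simp
    then have "int p dvd a" using not_dvd_imp_multiplicity_0 by force
    with \<open>int p dvd b\<close> y(3) have "is_unit (int p)" using coprime_common_divisor by blast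
    with p show False by (auto simp: not_prime_unit)
  qed
  then have "coprime b (int p)" using p by (metis coprime_commute prime_imp_coprime prime_nat_int_transfer)
  then obtain c where c: "[b * c = 1] (mod int p)" using cong_solve_coprime_int by blast
  define d where "d = nat (a * c mod int p)"
  have p0: "int p > 0" using p prime_gt_0_nat by simp
  have d: "int d = a * c mod int p" "d < p"
    using p0 unfolding d_def by (auto simp: nat_less_iff)
  have "[a * c mod int p = a * c] (mod int p)" by (simp add: cong_def)
  then have "[int d * b = a * c * b] (mod int p)" unfolding d by (rule cong_scalar_right)
  also have "a * c * b = a * (b * c)" by simp
  also have "[a * (b * c) = a * 1] (mod int p)" using c by (rule cong_scalar_left)
  finally have "int p dvd a - int d * b"
    by (simp add: cong_iff_dvd_diff dvd_diff_commute)
  then have "rat_padic_abs p (of_int (a - int d * b)) \<le> 1 / real p"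
    by (rule rat_padic_abs_of_int_dvd)
  moreover have "(y - of_nat d) * of_int b = of_int (a - int d * b)"
    using y(2) unfolding y(1) by (simp add: Fract_of_int_quotient field_simps)
  then have "rat_padic_abs p (y - of_nat d) = rat_padic_abs p (of_int (a - int d * b))"
    using rat_padic_abs_mult[OF p, of "y - of_nat d" "of_int b"] rat_padic_abs_of_int_not_dvd[OF pb]
    by simp
  ultimately show ?thesis using that d by simp
qed

end

function digit_rev :: "nat \<Rightarrow> nat \<Rightarrow> rat" where
  "digit_rev p u =
     (if u = 0 \<or> p \<le> 1 then 0 else of_nat (u mod p) + digit_rev p (u div p) / of_nat p)"
  by auto
termination by (relation "Wellfounded.measure snd") auto

declare digit_rev.simps [simp del]

context
  fixes p :: nat
  assumes p: "prime p"
begin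

lemma digit_rev_rec: "digit_rev p u = of_nat (u mod p) + digit_rev p (u div p) / of_nat p"
proof (cases "u = 0")
  case True
  then show ?thesis by (simp add: digit_rev.simps)
next
  case False
  then show ?thesis using prime_gt_1_nat[OF p] by (subst digit_rev.simps) simp
qed

lemma rat_padic_abs_divide_p: "rat_padic_abs p (x / of_nat p) = rat_padic_abs p x * real p"
  using prime_gt_0_nat[OF p]
  by (simp add: divide_inverse rat_padic_abs_mult[OF p] rat_padic_abs_inverse[OF p] rat_padic_abs_prime[OF p])

lemma digit_rev_separated: "u \<noteq> v \<Longrightarrow> rat_padic_abs p (digit_rev p u - digit_rev p v) \<ge> 1"
proof (induction "u + v" arbitrary: u v rule: less_induct)
  case less
  have p1: "p > 1" using prime_gt_1_nat[OF p] .
  define D where "D = (of_int (int (u mod p) - int (v mod p)) :: rat)"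
  define A where "A = (digit_rev p (u div p) - digit_rev p (v div p)) / of_nat p"
  have DA: "digit_rev p u - digit_rev p v = D + A"
    unfolding D_def A_def
    using digit_rev_rec[of u] digit_rev_rec[of v] by (simp add: diff_divide_distrib)
  show ?case
  proof (cases "u div p = v div p")
    case True
    then have ne: "u mod p \<noteq> v mod p" using less.prems by (metis div_mult_mod_eq)
    have "\<not> int p dvd int (u mod p) - int (v mod p)"
    proof
      assume "int p dvd int (u mod p) - int (v mod p)"
      moreover have "int (u mod p) - int (v mod p) \<noteq> 0" using ne by simp
      ultimately have "\<bar>int p\<bar> \<le> \<bar>int (u mod p) - int (v mod p)\<bar>" by (intro dvd_imp_le_int)
      moreover have "\<bar>int (u mod p) - int (v mod p)\<bar> < int p"
        using mod_less_divisor[of p u] mod_less_divisor[of p v] p1 by linarith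
      ultimately show False by simp
    qed
    then show ?thesis unfolding DA using True rat_padic_abs_of_int_not_dvd[OF p]
      by (simp add: A_def D_def del: of_int_diff)
  next
    case False
    have "u div p + v div p < u + v"
    proof -
      have "u div p \<le> u" "v div p \<le> v" by (rule div_le_dividend)+
      moreover have "u div p < u \<or> v div p < v"
        using less.prems p1 by (cases "u = 0") (auto intro: div_less_dividend)
      ultimately show ?thesis by linarith
    qed
    then have "rat_padic_abs p (digit_rev p (u div p) - digit_rev p (v div p)) \<ge> 1"
      using False by (rule less.hyps)
    then have "rat_padic_abs p A \<ge> real p"
      unfolding A_def rat_padic_abs_divide_p using p1 by simp
    moreover have "rat_padic_abs p D \<le> 1"
      unfolding D_def by (rule rat_padic_abs_of_int_le_1[OF p])
    moreover have "rat_padic_abs p A \<le> max (rat_padic_abs p (D + A)) (rat_padic_abs p D)"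
      using rat_padic_abs_ultrametric[OF p, of "D + A" "- D"] by (simp add: rat_padic_abs_minus[OF p])
    ultimately show ?thesis unfolding DA using p1 by linarith
  qed
qed

lemma digit_rev_dense: "\<exists>u. rat_padic_abs p (x - digit_rev p u) \<le> 1 / real p"
proof -
  have p0: "real p > 1" using prime_gt_1_nat[OF p] by simp
  have *: "\<exists>u. rat_padic_abs p (x - digit_rev p u) \<le> 1 / real p"
    if "rat_padic_abs p x * real p \<le> real p ^ k" for k x
    using that
  proof (induction k arbitrary: x)
    case 0
    then show ?case
      using p0 by (intro exI[of _ 0]) (simp add: digit_rev.simps field_simps)
  next
    case (Suc k)
    have "rat_padic_abs p (of_nat p * x) * real p \<le> real p ^ k"
      using Suc.prems p0 by (simp add: rat_padic_abs_mult[OF p] rat_padic_abs_prime[OF p])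
    then obtain u where u: "rat_padic_abs p (of_nat p * x - digit_rev p u) \<le> 1 / real p"
      using Suc.IH by blast
    define y where "y = x - digit_rev p u / of_nat p"
    have "y = (of_nat p * x - digit_rev p u) / of_nat p"
      using p0 by (simp add: y_def field_simps)
    then have "rat_padic_abs p y = rat_padic_abs p (of_nat p * x - digit_rev p u) * real p"
      by (simp only: rat_padic_abs_divide_p)
    then have "rat_padic_abs p y \<le> 1"
      using u p0 by (simp add: field_simps)
    then obtain d where d: "d < p" "rat_padic_abs p (y - of_nat d) \<le> 1 / real p"
      using rat_padic_abs_digit[OF p] by blast
    have "digit_rev p (p * u + d) = of_nat d + digit_rev p u / of_nat p"
      using d(1) by (subst digit_rev_rec) simp
    then have "x - digit_rev p (p * u + d) = y - of_nat d" by (simp add: y_def)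
    then show ?case using d(2) by metis
  qed
  obtain k where "rat_padic_abs p x * real p < real p ^ k"
    using real_arch_pow[OF p0] by blast
  then show ?thesis using * less_imp_le by blast
qed

end

definition monna_approx :: "nat \<Rightarrow> real \<Rightarrow> nat \<Rightarrow> rat" where
  "monna_approx p t n = of_nat p ^ n / of_nat p * digit_rev p (nat \<lfloor>t * real p ^ n\<rfloor>)"

definition monna :: "real \<Rightarrow> 'p::prime_card padic" where
  "monna t = Padic (monna_approx CARD('p) t)"

context
  fixes p :: nat
  assumes p: "prime p"
begin

lemma monna_approx_Suc:
  "monna_approx p t (Suc n) =
     monna_approx p t n + of_nat p ^ n * of_nat (nat \<lfloor>t * real p ^ Suc n\<rfloor> mod p)"
proof -
  have p0: "p > 0" using prime_gt_0_nat[OF p] .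
  define u where "u = nat \<lfloor>t * real p ^ Suc n\<rfloor>"
  have "\<lfloor>t * real p ^ n\<rfloor> = \<lfloor>t * real p ^ Suc n / real_of_int (int p)\<rfloor>"
    using p0 by simp
  also have "\<dots> = \<lfloor>t * real p ^ Suc n\<rfloor> div int p"
    by (rule floor_divide_real_eq_div) simp
  finally have "nat \<lfloor>t * real p ^ n\<rfloor> = u div p"
    by (simp add: u_def nat_div_distrib')
  then have n: "monna_approx p t n = of_nat p ^ n / of_nat p * digit_rev p (u div p)"
    by (simp add: monna_approx_def)
  have "monna_approx p t (Suc n) = of_nat p ^ n * digit_rev p u"
    using p0 by (simp add: monna_approx_def u_def)
  also have "digit_rev p u = of_nat (u mod p) + digit_rev p (u div p) / of_nat p"
    by (rule digit_rev_rec[OF p])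
  finally show ?thesis
    unfolding u_def[symmetric] n by (simp add: algebra_simps)
qed

lemma monna_approx_diff_le:
  assumes "n \<le> m"
  shows "rat_padic_abs p (monna_approx p t m - monna_approx p t n) \<le> 1 / real p ^ n"
  using assms
proof (induction m rule: dec_induct)
  case base
  then show ?case by simp
next
  case (step m)
  have p1: "real p \<ge> 1" using prime_ge_1_nat[OF p] by simp
  define d where "d = nat \<lfloor>t * real p ^ Suc m\<rfloor> mod p"
  have "rat_padic_abs p (of_nat p ^ m * of_nat d) \<le> 1 / real p ^ m * 1"
    unfolding rat_padic_abs_mult[OF p] rat_padic_abs_prime_power[OF p]
    using rat_padic_abs_of_int_le_1[OF p, of "int d"] p1 by (intro mult_left_mono) auto
  also have "\<dots> \<le> 1 / real p ^ n"
    using step p1 by (auto intro!: divide_left_mono power_increasing)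
  finally have "rat_padic_abs p (of_nat p ^ m * of_nat d) \<le> 1 / real p ^ n" .
  moreover have eq: "monna_approx p t (Suc m) - monna_approx p t n =
      (monna_approx p t m - monna_approx p t n) + of_nat p ^ m * of_nat d"
    unfolding monna_approx_Suc d_def by simp
  ultimately show ?case
    unfolding eq using step.IH rat_padic_abs_ultrametric[OF p, of "monna_approx p t m - monna_approx p t n" "of_nat p ^ m * of_nat d"]
    by linarith
qed

lemma padic_cauchy_monna_approx: "padic_cauchy p (monna_approx p t)"
  unfolding padic_cauchy_def
proof (intro allI impI)
  fix e :: real assume "e > 0"
  moreover have p1: "real p > 1" using prime_gt_1_nat[OF p] by simp
  ultimately obtain N where N: "(1 / real p) ^ N < e"
    using real_arch_pow_inv[of e "1 / real p"] by auto
  have "rat_padic_abs p (monna_approx p t m - monna_approx p t n) < e" if "m \<ge> N" "n \<ge> N" for m n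
    using rat_padic_abs_ultrametric[OF p, of "monna_approx p t m - monna_approx p t N"
        "monna_approx p t N - monna_approx p t n"]
      monna_approx_diff_le[OF that(1), of t] monna_approx_diff_le[OF that(2), of t]
      rat_padic_abs_minus_commute[OF p, of "monna_approx p t N" "monna_approx p t n"] N
    by (simp add: power_one_over)
  then show "\<exists>N. \<forall>m\<ge>N. \<forall>n\<ge>N. rat_padic_abs p (monna_approx p t m - monna_approx p t n) < e"
    by blast
qed

lemma monna_approx_ball:
  obtains u where "\<And>t. rat_padic_abs p (monna_approx p t n - q) \<le> 1 / real p ^ n \<longleftrightarrow>
                        nat \<lfloor>t * real p ^ n\<rfloor> = u"
proof -
  have p1: "real p > 1" using prime_gt_1_nat[OF p] by simp
  define s where "s = (of_nat p ^ n / of_nat p :: rat)"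
  have s0: "s \<noteq> 0" using p1 by (simp add: s_def)
  have abs_s: "rat_padic_abs p s = real p / real p ^ n"
    by (simp add: s_def rat_padic_abs_divide_p[OF p] rat_padic_abs_prime_power[OF p])
  have scale: "rat_padic_abs p (s * z) \<le> 1 / real p ^ n \<longleftrightarrow> rat_padic_abs p z \<le> 1 / real p" for z
    using p1 by (simp add: rat_padic_abs_mult[OF p] abs_s field_simps)
  obtain u where u: "rat_padic_abs p (q / s - digit_rev p u) \<le> 1 / real p"
    using digit_rev_dense[OF p] by blast
  show ?thesis
  proof (rule that[of u])
    fix t :: real
    let ?v = "nat \<lfloor>t * real p ^ n\<rfloor>"
    have "monna_approx p t n - q = s * (digit_rev p ?v - q / s)"
      using s0 by (simp add: monna_approx_def s_def[symmetric] algebra_simps)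
    then have "rat_padic_abs p (monna_approx p t n - q) \<le> 1 / real p ^ n \<longleftrightarrow>
               rat_padic_abs p (digit_rev p ?v - q / s) \<le> 1 / real p"
      by (simp only: scale)
    also have "\<dots> \<longleftrightarrow> ?v = u"
    proof
      assume "?v = u"
      then show "rat_padic_abs p (digit_rev p ?v - q / s) \<le> 1 / real p"
        using u by (simp only: rat_padic_abs_minus_commute[OF p, of "digit_rev p u"])
    next
      assume *: "rat_padic_abs p (digit_rev p ?v - q / s) \<le> 1 / real p"
      have "rat_padic_abs p (digit_rev p ?v - digit_rev p u) \<le> 1 / real p"
        using rat_padic_abs_ultrametric[OF p, of "digit_rev p ?v - q / s" "q / s - digit_rev p u"] * u
        by simp
      also have "\<dots> < 1" using p1 by simp
      finally show "?v = u" using digit_rev_separated[OF p, of ?v u] by force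
    qed
    finally show "rat_padic_abs p (monna_approx p t n - q) \<le> 1 / real p ^ n \<longleftrightarrow> ?v = u" .
  qed
qed

end

lemma padic_abs_minus_commute: "padic_abs (x - y :: 'p::prime_card padic) = padic_abs (y - x)"
  using padic_abs_minus[of "x - y"] by simp

lemma padic_abs_diff_le_iff:
  assumes "padic_abs (x - y :: 'p::prime_card padic) \<le> r"
  shows "padic_abs (z - x) \<le> r \<longleftrightarrow> padic_abs (z - y) \<le> r"
proof
  have *: "z - x + (x - y) = z - y" "z - y + (y - x) = z - x" by simp_all
  show "padic_abs (z - y) \<le> r" if "padic_abs (z - x) \<le> r"
    using assms that padic_abs_ultrametric[of "z - x" "x - y"] unfolding * by linarith
  show "padic_abs (z - x) \<le> r" if "padic_abs (z - y) \<le> r"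
    using assms that padic_abs_ultrametric[of "z - y" "y - x"] padic_abs_minus_commute[of x y]
    unfolding * by linarith
qed

lemma monna_ball:
  obtains u where "\<And>t. t \<ge> 0 \<Longrightarrow> padic_abs (monna t - x :: 'p::prime_card padic) \<le> 1 / real CARD('p) ^ n \<longleftrightarrow>
     u / real CARD('p) ^ n \<le> t \<and> t < u / real CARD('p) ^ n + 1 / real CARD('p) ^ n" "u \<ge> 0"
proof -
  note p = prime_card[where 'a='p]
  let ?p = "CARD('p)" and ?r = "1 / real CARD('p) ^ n"
  have p0: "real ?p > 0" using prime_gt_0_nat[OF p] by simp
  have r: "?r > 0" using p0 by simp
  obtain q where q: "padic_abs (x - of_rat q) < ?r" using rat_dense_padic[OF r] .
  obtain u where u: "\<And>t. rat_padic_abs ?p (monna_approx ?p t n - q) \<le> ?r \<longleftrightarrow> nat \<lfloor>t * real ?p ^ n\<rfloor> = u"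
    using monna_approx_ball[OF p] by blast
  show ?thesis
  proof (rule that[of "real u"])
    fix t :: real assume t: "t \<ge> 0"
    let ?a = "of_rat (monna_approx ?p t n) :: 'p padic"
    have a: "padic_abs (monna t - ?a) \<le> ?r"
      unfolding monna_def using monna_approx_diff_le[OF p, of n]
      by (intro padic_abs_Padic_diff_of_rat_le[OF padic_cauchy_monna_approx[OF p]])
    have "padic_abs (monna t - x) \<le> ?r \<longleftrightarrow> padic_abs (monna t - of_rat q :: 'p padic) \<le> ?r"
      by (rule padic_abs_diff_le_iff[OF less_imp_le[OF q]])
    also have "\<dots> \<longleftrightarrow> padic_abs (of_rat q - ?a) \<le> ?r"
      using padic_abs_diff_le_iff[OF a, of "of_rat q"] padic_abs_minus_commute[of "monna t" "of_rat q :: 'p padic"]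
      by simp
    also have "padic_abs (of_rat q - ?a) = rat_padic_abs ?p (monna_approx ?p t n - q)"
      by (simp add: padic_abs_of_rat rat_padic_abs_minus_commute[OF p, of q] flip: of_rat_diff)
    also have "\<dots> \<le> ?r \<longleftrightarrow> nat \<lfloor>t * real ?p ^ n\<rfloor> = u" by (rule u)
    also have "\<dots> \<longleftrightarrow> \<lfloor>t * real ?p ^ n\<rfloor> = int u" using t p0 by auto
    also have "\<dots> \<longleftrightarrow> real u \<le> t * real ?p ^ n \<and> t * real ?p ^ n < real u + 1"
      by (simp add: floor_eq_iff)
    also have "\<dots> \<longleftrightarrow> real u / real ?p ^ n \<le> t \<and> t < real u / real ?p ^ n + ?r"
      using p0 by (simp add: field_simps)
    finally show "padic_abs (monna t - x) \<le> ?r \<longleftrightarrow>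
        real u / real ?p ^ n \<le> t \<and> t < real u / real ?p ^ n + ?r" .
  qed simp
qed

definition padic_polydisc :: "'p::prime_card padic ^ 'm::finite \<Rightarrow> nat \<Rightarrow> ('p padic ^ 'm) set" where
  "padic_polydisc x n = {y. \<forall>i. padic_abs (y $ i - x $ i) \<le> 1 / real CARD('p) ^ n}"

lemma padic_polydisc_eqI:
  assumes "y \<in> padic_polydisc (x :: 'p::prime_card padic ^ 'm::finite) n"
  shows "padic_polydisc y n = padic_polydisc x n"
proof -
  have y: "padic_abs (y $ i - x $ i) \<le> 1 / real CARD('p) ^ n" for i
    using assms by (simp add: padic_polydisc_def)
  show ?thesis by (simp add: padic_polydisc_def padic_abs_diff_le_iff[OF y])
qed

lemma padic_polydisc_mono:
  "m \<le> n \<Longrightarrow> padic_polydisc (x :: 'p::prime_card padic ^ 'm::finite) n \<subseteq> padic_polydisc x m"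
proof -
  assume "m \<le> n"
  then have "1 / real CARD('p) ^ n \<le> 1 / real CARD('p) ^ m"
    using prime_ge_1_nat[OF prime_card[where 'a='p]]
    by (intro divide_left_mono power_increasing) auto
  then show ?thesis unfolding padic_polydisc_def using order.trans by blast
qed

lemma centre_in_padic_polydisc: "x \<in> padic_polydisc x n"
  by (simp add: padic_polydisc_def padic_abs_eq_0_iff[of 0, simplified])

lemma open_padic_polydisc: "open (padic_polydisc (x :: 'p::prime_card padic ^ 'm::finite) n)"
proof -
  have r: "1 / real CARD('p) ^ n > 0" using prime_gt_0_nat[OF prime_card[where 'a='p]] by simp
  have "open {z. padic_abs (z - y) \<le> 1 / real CARD('p) ^ n}" for y :: "'p padic"
    unfolding open_dist
  proof (intro ballI exI[of _ "1 / real CARD('p) ^ n"] conjI r allI impI)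
    fix z w :: "'p padic"
    assume "z \<in> {z. padic_abs (z - y) \<le> 1 / real CARD('p) ^ n}" "dist w z < 1 / real CARD('p) ^ n"
    then show "w \<in> {z. padic_abs (z - y) \<le> 1 / real CARD('p) ^ n}"
      using padic_abs_diff_le_iff[of z y "1 / real CARD('p) ^ n" w] by (simp add: dist_padic_def)
  qed
  then have op: "open {z. padic_abs (z - x $ i) \<le> 1 / real CARD('p) ^ n}" for i .
  show ?thesis
    unfolding open_vec_def
    by (intro ballI exI[of _ "\<lambda>i. {z. padic_abs (z - x $ i) \<le> 1 / real CARD('p) ^ n}"])
      (use op in \<open>auto simp: padic_polydisc_def\<close>)
qed

lemma open_contains_rat_polydisc:
  fixes x :: "'p::prime_card padic ^ 'm::finite"
  assumes "open U" "x \<in> U"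
  obtains q :: "rat ^ 'm" and n where
    "x \<in> padic_polydisc (\<chi> i. of_rat (q $ i)) n" "padic_polydisc (\<chi> i. of_rat (q $ i)) n \<subseteq> U"
proof -
  let ?r = "\<lambda>n. 1 / real CARD('p) ^ n"
  have p1: "real CARD('p) > 1" using prime_gt_1_nat[OF prime_card[where 'a='p]] by simp
  obtain A where A: "\<And>i. open (A i)" "\<And>i. x $ i \<in> A i" "\<And>y. (\<forall>i. y $ i \<in> A i) \<Longrightarrow> y \<in> U"
    using assms unfolding open_vec_def by meson
  have "\<exists>n. \<forall>z. padic_abs (z - x $ i) \<le> ?r n \<longrightarrow> z \<in> A i" for i
  proof -
    obtain e where e: "e > 0" "\<And>z. dist z (x $ i) < e \<Longrightarrow> z \<in> A i"
      using A(1,2)[of i] unfolding open_dist by blast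
    obtain n where "(1 / real CARD('p)) ^ n < e"
      using real_arch_pow_inv[of e "1 / real CARD('p)"] e(1) p1 by auto
    then have "?r n < e" by (simp add: power_one_over)
    then show ?thesis using e(2) unfolding dist_padic_def by (meson le_less_trans)
  qed
  then obtain N where N: "\<And>i z. padic_abs (z - x $ i) \<le> ?r (N i) \<Longrightarrow> z \<in> A i" by metis
  define n where "n = Max (range N)"
  have "padic_polydisc x n \<subseteq> U"
  proof
    fix y assume y: "y \<in> padic_polydisc x n"
    have "y $ i \<in> A i" for i
    proof (rule N)
      have "N i \<le> n" unfolding n_def by (rule Max_ge) auto
      with y have "y \<in> padic_polydisc x (N i)" using padic_polydisc_mono by blast
      then show "padic_abs (y $ i - x $ i) \<le> ?r (N i)" by (simp add: padic_polydisc_def)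
    qed
    then show "y \<in> U" using A(3) by blast
  qed
  moreover have "\<exists>q. padic_abs (x $ i - of_rat q) < ?r n" for i
    by (rule rat_dense_padic[of "?r n" "x $ i"]) (use p1 in auto)
  then obtain q where q: "\<And>i. padic_abs (x $ i - of_rat (q i)) < ?r n" by metis
  then have "x \<in> padic_polydisc (\<chi> i. of_rat ((\<chi> i. q i) $ i)) n"
    by (auto simp: padic_polydisc_def intro: less_imp_le)
  ultimately show ?thesis using that padic_polydisc_eqI by metis
qed

lemma sets_borel_padic_vec:
  "sets (borel :: ('p::prime_card padic ^ 'm::finite) measure) =
     sigma_sets UNIV (insert {} {padic_polydisc x n |x n. True})" (is "_ = sigma_sets UNIV ?G")
proof -
  have "sets (borel :: ('p padic ^ 'm) measure) = sigma_sets UNIV {S. open S}"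
    by (simp add: borel_def)
  also have "\<dots> = sigma_sets UNIV ?G"
  proof (rule sigma_sets_eqI)
    fix U :: "('p padic ^ 'm) set"
    assume "U \<in> {S. open S}"
    then have U: "open U" by simp
    define D where "D = (\<lambda>(q :: rat ^ 'm, n). padic_polydisc (\<chi> i. of_rat (q $ i)) n :: ('p padic ^ 'm) set)"
    define I where "I = {k. D k \<subseteq> U}"
    have "U = \<Union> (D ` I)"
    proof (intro equalityI subsetI)
      fix x assume "x \<in> U"
      then obtain q n where "x \<in> D (q, n)" "D (q, n) \<subseteq> U"
        using open_contains_rat_polydisc[OF U] unfolding D_def prod.case by metis
      then show "x \<in> \<Union> (D ` I)" by (auto simp: I_def)
    qed (auto simp: I_def)
    also have "\<dots> \<in> sigma_sets UNIV ?G"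
    proof (rule sigma_sets_UNION)
      show "countable (D ` I)" by (intro countable_image) auto
      fix B assume "B \<in> D ` I"
      then show "B \<in> sigma_sets UNIV ?G" by (auto simp: D_def intro!: sigma_sets.Basic)
    qed
    finally show "U \<in> sigma_sets UNIV ?G" .
  next
    fix B assume "B \<in> ?G"
    then show "B \<in> sigma_sets UNIV {S. open S}"
      using open_padic_polydisc by (auto intro!: sigma_sets.Basic sigma_sets.Empty)
  qed
  finally show ?thesis .
qed

lemma padic_polydisc_Int:
  assumes "m \<le> n"
  shows "padic_polydisc x m \<inter> padic_polydisc y n = {} \<or>
         padic_polydisc x m \<inter> padic_polydisc y n = padic_polydisc y n"
proof (cases "padic_polydisc x m \<inter> padic_polydisc y n = {}")
  case False
  then obtain z where z: "z \<in> padic_polydisc x m" "z \<in> padic_polydisc y n" by blast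
  have "padic_polydisc y n \<subseteq> padic_polydisc x m"
    unfolding padic_polydisc_eqI[OF z(1), symmetric] padic_polydisc_eqI[OF z(2), symmetric]
    by (rule padic_polydisc_mono[OF assms])
  then show ?thesis by blast
qed simp

lemma Int_stable_padic_polydisc:
  "Int_stable (insert {} {padic_polydisc x n |x n. True} :: ('p::prime_card padic ^ 'm::finite) set set)"
    (is "Int_stable ?G")
proof (rule Int_stableI)
  fix A B assume A: "A \<in> ?G" and B: "B \<in> ?G"
  show "A \<inter> B \<in> ?G"
  proof (cases "A = {} \<or> B = {}")
    case False
    then obtain x m y n where AB: "A = padic_polydisc x m" "B = padic_polydisc y n" using A B by blast
    have "A \<inter> B = {} \<or> A \<inter> B = A \<or> A \<inter> B = B"
    proof (cases "m \<le> n")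
      case True
      from padic_polydisc_Int[OF this, of x y] show ?thesis unfolding AB by blast
    next
      case False
      then have "n \<le> m" by simp
      from padic_polydisc_Int[OF this, of y x] show ?thesis unfolding AB by blast
    qed
    then show ?thesis using A B by (elim disjE) simp_all
  qed auto
qed

lemma emeasure_lborel_half_open_cube:
  fixes a :: "real ^ 'm::finite"
  assumes h: "h \<ge> 0"
  shows "emeasure lborel {v. \<forall>i. a $ i \<le> v $ i \<and> v $ i < a $ i + h} = ennreal (h ^ CARD('m))"
    (is "emeasure _ ?S = _")
    and "{v. \<forall>i. a $ i \<le> v $ i \<and> v $ i < a $ i + h} \<in> sets borel"
proof -
  define b where "b = (\<chi> i. a $ i + h)"
  have S: "?S = (\<Inter>i. {v. a $ i \<le> v $ i} \<inter> {v. v $ i < a $ i + h})" by auto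
  show meas: "?S \<in> sets borel"
    unfolding S by (intro sets.countable_INT' sets.Int borel_closed borel_open)
      (auto intro!: closed_Collect_le open_Collect_less continuous_intros)
  have ne: "cbox a b \<noteq> {}" using h by (simp add: interval_ne_empty_cart b_def)
  have "measure lborel (cbox a b) = h ^ CARD('m)"
    by (subst content_cbox_cart[OF ne]) (simp add: b_def)
  then have cbox: "emeasure lborel (cbox a b) = ennreal (h ^ CARD('m))"
    using emeasure_eq_ennreal_measure[of lborel "cbox a b"] emeasure_lborel_cbox_finite[of a b] by simp
  have box: "emeasure lborel (box a b) = emeasure lborel (cbox a b)"
    by (simp add: emeasure_lborel_box_eq emeasure_lborel_cbox_eq)
  have "box a b \<subseteq> ?S" "?S \<subseteq> cbox a b"
    by (auto simp: mem_box_cart b_def less_imp_le)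
  then have "emeasure lborel (box a b) \<le> emeasure lborel ?S" "emeasure lborel ?S \<le> emeasure lborel (cbox a b)"
    using meas by (auto intro!: emeasure_mono)
  then show "emeasure lborel ?S = ennreal (h ^ CARD('m))" using cbox box by simp
qed

theorem padic_haar_measure_exists: "\<exists>M :: ('p::prime_card padic ^ 'm::finite) measure. padic_haar_measure M"
proof -
  let ?G = "insert {} {padic_polydisc x n |x n. True} :: ('p padic ^ 'm) set set"
  let ?r = "\<lambda>n. 1 / real CARD('p) ^ n"
  define Q where "Q = {v :: real ^ 'm. \<forall>i. 0 \<le> v $ i}"
  define L where "L = restrict_space lborel Q"
  define \<Phi> where "\<Phi> = (\<lambda>v :: real ^ 'm. (\<chi> i. monna (v $ i)) :: 'p padic ^ 'm)"
  define M where "M = distr L borel \<Phi>"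
  have "Q = (\<Inter>i. {v. 0 \<le> v $ i})" by (auto simp: Q_def)
  then have Q: "Q \<in> sets borel"
    by (auto intro!: sets.countable_INT' borel_closed closed_Collect_le continuous_intros)
  have L: "space L = Q" by (simp add: L_def space_restrict_space)
  have emL: "emeasure L A = emeasure lborel A" if "A \<in> sets borel" "A \<subseteq> Q" for A
    unfolding L_def using that Q by (intro emeasure_restrict_space) auto
  have setsL: "A \<in> sets L" if "A \<in> sets borel" "A \<subseteq> Q" for A
    unfolding L_def using that Q by (subst sets_restrict_space_iff) auto
  have pre: "\<exists>a. \<Phi> -` padic_polydisc x n \<inter> Q = {v. \<forall>i. a $ i \<le> v $ i \<and> v $ i < a $ i + ?r n} \<and>
               {v. \<forall>i. a $ i \<le> v $ i \<and> v $ i < a $ i + ?r n} \<subseteq> Q" for x n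
  proof -
    have "\<exists>u. u \<ge> 0 \<and> (\<forall>t\<ge>0. padic_abs (monna t - x $ i) \<le> ?r n \<longleftrightarrow>
              u / real CARD('p) ^ n \<le> t \<and> t < u / real CARD('p) ^ n + ?r n)" for i
      using monna_ball[of "x $ i" n] by metis
    then obtain u where u0: "\<And>i. u i \<ge> 0" and
      u: "\<And>i t. t \<ge> 0 \<Longrightarrow> padic_abs (monna t - x $ i) \<le> ?r n \<longleftrightarrow>
            u i / real CARD('p) ^ n \<le> t \<and> t < u i / real CARD('p) ^ n + ?r n"
      by metis
    define a where "a = (\<chi> i. u i / real CARD('p) ^ n)"
    have a0: "a $ i \<ge> 0" for i using u0 by (simp add: a_def)
    have sub: "{v. \<forall>i. a $ i \<le> v $ i \<and> v $ i < a $ i + ?r n} \<subseteq> Q"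
      using a0 order.trans unfolding Q_def by blast
    moreover have "v \<in> \<Phi> -` padic_polydisc x n \<longleftrightarrow> (\<forall>i. a $ i \<le> v $ i \<and> v $ i < a $ i + ?r n)"
      if "v \<in> Q" for v
      using that u by (simp add: \<Phi>_def padic_polydisc_def Q_def a_def)
    ultimately show ?thesis by (intro exI[of _ a]) blast
  qed
  have r0: "?r n \<ge> 0" for n by simp
  have meas: "\<Phi> \<in> measurable L borel"
  proof (rule measurable_sigma_sets[OF sets_borel_padic_vec])
    fix B assume "B \<in> ?G"
    then consider "B = {}" | x n where "B = padic_polydisc x n" by blast
    then show "\<Phi> -` B \<inter> space L \<in> sets L"
    proof cases
      case 2
      obtain a where a: "\<Phi> -` padic_polydisc x n \<inter> Q = {v. \<forall>i. a $ i \<le> v $ i \<and> v $ i < a $ i + ?r n}"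
          "{v. \<forall>i. a $ i \<le> v $ i \<and> v $ i < a $ i + ?r n} \<subseteq> Q"
        using pre by blast
      show ?thesis unfolding L 2 a(1)
        by (rule setsL[OF emeasure_lborel_half_open_cube(2)[OF r0] a(2)])
    qed simp
  qed auto
  have setsM: "sets M = sets borel" and spaceM: "space M = UNIV" by (simp_all add: M_def)
  have disc: "emeasure M (padic_polydisc x n) = ennreal (?r n ^ CARD('m))" for x n
  proof -
    have "padic_polydisc x n \<in> sets borel" by (intro borel_open open_padic_polydisc)
    then have "emeasure M (padic_polydisc x n) = emeasure L (\<Phi> -` padic_polydisc x n \<inter> Q)"
      unfolding M_def by (simp add: emeasure_distr[OF meas] L)
    moreover obtain a where a: "\<Phi> -` padic_polydisc x n \<inter> Q = {v. \<forall>i. a $ i \<le> v $ i \<and> v $ i < a $ i + ?r n}"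
        "{v. \<forall>i. a $ i \<le> v $ i \<and> v $ i < a $ i + ?r n} \<subseteq> Q"
      using pre by blast
    ultimately show ?thesis
      using emeasure_lborel_half_open_cube(1)[OF r0] emL[OF emeasure_lborel_half_open_cube(2)[OF r0] a(2)]
      by simp
  qed
  have "emeasure M ((+) c ` A) = emeasure M A" if A: "A \<in> sets borel" for c A
  proof -
    have vimage: "(\<lambda>y. y - c) -` padic_polydisc x n = padic_polydisc (x + c) n" for x n
      by (auto simp: padic_polydisc_def algebra_simps)
    have tr: "(\<lambda>y. y - c) \<in> measurable M borel"
    proof (rule measurable_sigma_sets[OF sets_borel_padic_vec])
      fix B assume "B \<in> ?G"
      then consider "B = {}" | x n where "B = padic_polydisc x n" by blast
      then show "(\<lambda>y. y - c) -` B \<inter> space M \<in> sets M"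
      proof cases
        case 2
        then show ?thesis
          using vimage borel_open[OF open_padic_polydisc] by (simp add: M_def)
      qed simp
    qed auto
    define N where "N = distr M borel (\<lambda>y. y - c)"
    have "M = N"
    proof (rule measure_eqI_generator_eq[where E = ?G and \<Omega> = UNIV
          and A = "\<lambda>k. padic_polydisc (\<chi> i. of_rat ((from_nat k :: rat ^ 'm) $ i)) 0"])
      show "Int_stable ?G" by (rule Int_stable_padic_polydisc)
      show "emeasure M X = emeasure N X" if "X \<in> ?G" for X
        using that unfolding N_def
        by (auto simp: emeasure_distr[OF tr] vimage disc borel_open[OF open_padic_polydisc] spaceM)
      show "sets M = sigma_sets UNIV ?G" "sets N = sigma_sets UNIV ?G"
        by (simp_all only: setsM N_def sets_distr sets_borel_padic_vec)
      show "(\<Union>k. padic_polydisc (\<chi> i. of_rat ((from_nat k :: rat ^ 'm) $ i)) 0) = (UNIV :: ('p padic ^ 'm) set)"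
      proof (intro equalityI subsetI UNIV_I)
        fix x :: "'p padic ^ 'm"
        have "\<exists>q. padic_abs (x $ i - of_rat q) < 1" for i
          by (rule rat_dense_padic[of 1 "x $ i"]) auto
        then obtain q where q: "\<And>i. padic_abs (x $ i - of_rat (q i)) < 1" by metis
        then have "x \<in> padic_polydisc (\<chi> i. of_rat ((from_nat (to_nat (\<chi> i. q i)) :: rat ^ 'm) $ i)) 0"
          by (auto simp: padic_polydisc_def intro: less_imp_le)
        then show "x \<in> (\<Union>k. padic_polydisc (\<chi> i. of_rat ((from_nat k :: rat ^ 'm) $ i)) 0)" by blast
      qed
    qed (auto simp: disc)
    then have "emeasure M A = emeasure N A" by simp
    also have "\<dots> = emeasure M ((\<lambda>y. y - c) -` A \<inter> space M)"
      unfolding N_def by (rule emeasure_distr[OF tr A])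
    also have "(\<lambda>y. y - c) -` A \<inter> space M = (+) c ` A"
    proof (intro equalityI subsetI)
      fix y assume "y \<in> (\<lambda>y. y - c) -` A \<inter> space M"
      then show "y \<in> (+) c ` A" by (intro image_eqI[of _ _ "y - c"]) auto
    qed (auto simp: spaceM)
    finally show ?thesis ..
  qed
  moreover have "emeasure M {x. \<forall>i. padic_abs (x $ i) \<le> 1} = 1"
    using disc[of 0 0] by (simp add: padic_polydisc_def)
  ultimately have "padic_haar_measure M"
    using setsM by (simp add: padic_haar_measure_def)
  then show ?thesis ..
qed

lemma padic_haar: "padic_haar_measure padic_haar"
  unfolding padic_haar_def using padic_haar_measure_exists by (rule someI_ex)


section \<open>Cayley graphs and their independence ratio\<close>

definition cayley_graph :: "'v::ab_group_add set \<Rightarrow> ('v \<times> 'v) set" where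
  "cayley_graph S = {(x, y). x - y \<in> S}"

definition borel_independent :: "('v::topological_space \<times> 'v) set \<Rightarrow> 'v set \<Rightarrow> bool" where
  "borel_independent E I \<longleftrightarrow> I \<in> sets borel \<and> (\<forall>x\<in>I. \<forall>y\<in>I. (x, y) \<notin> E)"

text \<open>\<open>B r\<close> is the ball of radius \<open>r\<close> around \<open>0\<close>, for the norm in use.\<close>

definition upper_density :: "'v measure \<Rightarrow> (real \<Rightarrow> 'v set) \<Rightarrow> 'v set \<Rightarrow> ereal" where
  "upper_density M B I = Limsup at_top (\<lambda>r. ereal (measure M (I \<inter> B r) / measure M (B r)))"

definition independence_ratio ::
    "'v::topological_space measure \<Rightarrow> (real \<Rightarrow> 'v set) \<Rightarrow> ('v \<times> 'v) set \<Rightarrow> ereal" where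
  "independence_ratio M B E = (SUP I\<in>{I. borel_independent E I}. upper_density M B I)"

text \<open>
  The library's metric on \<open>'a ^ 'n\<close> is Euclidean; on \<open>\<rat>\<^sub>p\<^sup>m\<close> the balls are taken for the supremum norm.
\<close>

definition padic_sup_norm :: "'p::prime_card padic ^ 'm::finite \<Rightarrow> real" where
  "padic_sup_norm x = (MAX i. padic_abs (x $ i))"

definition real_independence_ratio :: "((real ^ 'm::finite) \<times> (real ^ 'm)) set \<Rightarrow> ereal" where
  "real_independence_ratio = independence_ratio lborel (\<lambda>r. {x. norm x \<le> r})"

definition padic_independence_ratio ::
    "(('p::prime_card padic ^ 'm::finite) \<times> ('p padic ^ 'm)) set \<Rightarrow> ereal" where
  "padic_independence_ratio = independence_ratio padic_haar (\<lambda>r. {x. padic_sup_norm x \<le> r})"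


section \<open>Polynomial curves\<close>

definition lin_indep_family :: "('i::finite \<Rightarrow> 'k::field poly) \<Rightarrow> bool" where
  "lin_indep_family F \<longleftrightarrow> (\<forall>c. (\<Sum>i\<in>UNIV. Polynomial.smult (c i) (F i)) = 0 \<longrightarrow> (\<forall>i. c i = 0))"

definition poly_curve :: "('m::finite \<Rightarrow> 'k::field poly) \<Rightarrow> 'k \<Rightarrow> 'k ^ 'm" where
  "poly_curve f s = (\<chi> i. poly (f i) s)"

definition curve_set ::
    "('k::field \<Rightarrow> real) \<Rightarrow> ('m::finite \<Rightarrow> 'k poly) \<Rightarrow> real \<Rightarrow> real \<Rightarrow> ('k ^ 'm) set" where
  "curve_set absv f lo hi =
     {v. v \<noteq> 0 \<and> (\<exists>s. lo \<le> absv s \<and> absv s \<le> hi \<and> (v = poly_curve f s \<or> v = - poly_curve f s))}"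

end

theory Submission
  imports Defs
begin

text \<open>
  Let \<open>I\<close> be independent, \<open>J \<subseteq> I \<inter> B\<^sub>r\<close> compact of at least half the measure, and \<open>K = \<Sum> w\<^sub>\<xi> e\<^sub>\<xi>\<close> a finite
  trigonometric sum with \<open>w\<^sub>\<xi> \<ge> 0\<close>, concentrated near \<open>0\<close>. With \<open>b\<^sub>\<xi> = w\<^sub>\<xi> |\<integral>\<^sub>J e\<^sub>\<xi>|\<^sup>2\<close> one has
  \<open>\<Sum> b\<^sub>\<xi> e\<^sub>\<xi>(v) = \<integral>\<integral>\<^bsub>J\<times>J\<^esub> K(x - y + v)\<close>. For \<open>v = f(s)\<close> this is negligible, because \<open>J - J\<close> has positive
  distance from the curve. Averaging over \<open>s\<close> with respect to \<open>ds/|s|\<close>, the trivial character contributes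
  \<open>(T - a) w\<^sub>0 |J|\<^sup>2\<close>, and every other one contributes at least \<open>- C b\<^sub>\<xi>\<close>, so that
  \<open>(T - a) |J|\<^sup>2\<close> is at most a constant times \<open>|B\<^sub>r| |J|\<close>.

  The lower bound \<open>- C\<close> for \<open>\<integral> Re e\<^sub>\<xi>(f(s)) ds/|s|\<close> is uniform in \<open>\<xi>\<close>: the phase is a polynomial in \<open>s\<close>.
  Apart from a set of scales of bounded logarithmic measure, either the phase is close to \<open>0\<close>, so that
  the integrand is nonnegative, or one monomial of the phase is large and dominates the others, so that
  the integral over that scale is controlled by integration by parts (over \<open>\<real>\<close>) or vanishes (over \<open>\<rat>\<^sub>p\<close>).
  The constant term of the phase is a linear combination of its other coefficients, since
  \<open>1, f\<^sub>1, \<dots>, f\<^sub>m\<close> are independent, hence it is negligible once \<open>a\<close> is large and the other terms are small.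
\<close>

section \<open>Autocorrelation and density\<close>

text \<open>Two features make the estimate uniform. Only a lower bound for the averages of the
  nontrivial characters is required, because the weights \<open>b\<^sub>\<xi>\<close> are
  nonnegative and their sum is the double integral at \<open>v = 0\<close>; thus no cancellation has
  to be found where the phase is small. Moreover the kernel has to be sharpened according to the
  distance between \<open>J - J\<close> and the curve, over which there is no control. This is
  harmless because its mass, its constant Fourier coefficient and the error that it leaves along the
  curve carry a common factor, which cancels at the end. The two fields differ in the kernel. Over
  \<real> a nonzero finite trigonometric sum cannot vanish on an open set, so a power of the cosine
  is used, whose tail must be compared with its constant coefficient. Over
  \<open>\<rat>\<^sub>p\<close> balls are subgroups, and a finite character sum is exactly a
  multiple of the indicator of a polydisc, so the error is 0.\<close>

lemma character_minus:
  fixes \<phi> :: "'v::ab_group_add \<Rightarrow> complex"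
  assumes "\<And>x y. \<phi> (x + y) = \<phi> x * \<phi> y" "\<And>x. norm (\<phi> x) = 1"
  shows "\<phi> (- x) = cnj (\<phi> x)"
proof -
  have nz: "\<phi> y \<noteq> 0" for y using assms(2)[of y] by auto
  have "\<phi> 0 = 1" using assms(1)[of 0 0] nz[of 0] by simp
  then have 1: "\<phi> x * \<phi> (- x) = 1" using assms(1)[of x "- x"] by simp
  have "\<phi> x * cnj (\<phi> x) = 1" using assms(2)[of x] by (simp add: complex_norm_square[symmetric])
  then show ?thesis using 1 nz[of x] by (metis mult_left_cancel)
qed

lemma set_integrable_sum:
  fixes f :: "'k \<Rightarrow> 'a \<Rightarrow> 'b::{banach, second_countable_topology}"
  assumes "\<And>i. i \<in> I \<Longrightarrow> set_integrable M A (f i)"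
  shows "set_integrable M A (\<lambda>x. \<Sum>i\<in>I. f i x)"
  using assms unfolding set_integrable_def by (simp add: scaleR_sum_right)

lemma set_integral_sum:
  fixes f :: "'k \<Rightarrow> 'a \<Rightarrow> 'b::{banach, second_countable_topology}"
  assumes "\<And>i. i \<in> I \<Longrightarrow> set_integrable M A (f i)"
  shows "(LINT x:A|M. \<Sum>i\<in>I. f i x) = (\<Sum>i\<in>I. LINT x:A|M. f i x)"
  using assms unfolding set_integrable_def set_lebesgue_integral_def
  by (simp add: scaleR_sum_right Bochner_Integration.integral_sum)

text \<open>Multiplicativity gives \<open>\<phi> \<xi> (x - y + v) = \<phi> \<xi> x * cnj (\<phi>
  \<xi> y) * \<phi> \<xi> v\<close>, so each term of the iterated integral factors into an integral
  over \<open>J\<close>, its conjugate and the value at \<open>v\<close>.\<close>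

lemma autocorrelation_expansion:
  fixes M :: "'v::ab_group_add measure" and \<phi> :: "'k \<Rightarrow> 'v \<Rightarrow> complex" and w :: "'k \<Rightarrow> real"
  assumes J: "J \<in> sets M" "emeasure M J < \<infinity>"
    and meas: "\<And>\<xi>. \<xi> \<in> \<Xi> \<Longrightarrow> \<phi> \<xi> \<in> borel_measurable M"
    and add: "\<And>\<xi> x y. \<xi> \<in> \<Xi> \<Longrightarrow> \<phi> \<xi> (x + y) = \<phi> \<xi> x * \<phi> \<xi> y"
    and unit: "\<And>\<xi> x. \<xi> \<in> \<Xi> \<Longrightarrow> norm (\<phi> \<xi> x) = 1"
  shows "(LINT y:J|M. LINT x:J|M. Re (\<Sum>\<xi>\<in>\<Xi>. w \<xi> * \<phi> \<xi> (x - y + v))) =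
           (\<Sum>\<xi>\<in>\<Xi>. w \<xi> * (norm (LINT x:J|M. \<phi> \<xi> x))\<^sup>2 * Re (\<phi> \<xi> v))"
proof -
  have int: "set_integrable M J (\<phi> \<xi>)" if "\<xi> \<in> \<Xi>" for \<xi>
    unfolding set_integrable_def
    by (rule integrableI_bounded_set[where A = J and B = 1])
      (use J meas[OF that] unit[OF that] in \<open>auto simp: indicator_def\<close>)
  have minus: "\<phi> \<xi> (- x) = cnj (\<phi> \<xi> x)" if "\<xi> \<in> \<Xi>" for \<xi> x
    using that add unit by (intro character_minus) auto
  have split: "\<phi> \<xi> (x - y + v) = \<phi> \<xi> x * (cnj (\<phi> \<xi> y) * \<phi> \<xi> v)" if "\<xi> \<in> \<Xi>" for \<xi> x y
    using add[OF that, of "x + - y" v] add[OF that, of x "- y"] minus[OF that] by simp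
  have split': "of_real c * \<phi> \<xi> (x - y + v) = (of_real c * (cnj (\<phi> \<xi> y) * \<phi> \<xi> v)) * \<phi> \<xi> x"
    if "\<xi> \<in> \<Xi>" for c \<xi> x y
    by (simp only: split[OF that] mult_ac)
  let ?h = "\<lambda>\<xi>. LINT x:J|M. \<phi> \<xi> x"
  have cnj_int: "(LINT x:J|M. cnj (\<phi> \<xi> x)) = cnj (?h \<xi>)" for \<xi>
    unfolding set_lebesgue_integral_def
    using Bochner_Integration.integral_cnj[of M "\<lambda>x. indicator J x *\<^sub>R \<phi> \<xi> x"] by simp
  have icnj: "set_integrable M J (\<lambda>x. cnj (\<phi> \<xi> x))" if "\<xi> \<in> \<Xi>" for \<xi>
    using integrable_cnj[OF int[OF that, unfolded set_integrable_def]] by (simp add: set_integrable_def)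
  have "(LINT x:J|M. Re (\<Sum>\<xi>\<in>\<Xi>. w \<xi> * \<phi> \<xi> (x - y + v))) =
      Re (\<Sum>\<xi>\<in>\<Xi>. cnj (\<phi> \<xi> y) * (w \<xi> * ?h \<xi> * \<phi> \<xi> v))" for y
  proof -
    have si: "set_integrable M J (\<lambda>x. \<Sum>\<xi>\<in>\<Xi>. w \<xi> * \<phi> \<xi> (x - y + v))"
    proof (rule set_integrable_cong[THEN iffD2, OF refl refl])
      show "(\<Sum>\<xi>\<in>\<Xi>. w \<xi> * \<phi> \<xi> (x - y + v)) = (\<Sum>\<xi>\<in>\<Xi>. (w \<xi> * (cnj (\<phi> \<xi> y) * \<phi> \<xi> v)) * \<phi> \<xi> x)" for x
        by (rule sum.cong[OF refl split'])
      show "set_integrable M J (\<lambda>x. \<Sum>\<xi>\<in>\<Xi>. (w \<xi> * (cnj (\<phi> \<xi> y) * \<phi> \<xi> v)) * \<phi> \<xi> x)"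
        by (intro set_integrable_sum set_integrable_mult_right int)
    qed
    have "(LINT x:J|M. Re (\<Sum>\<xi>\<in>\<Xi>. w \<xi> * \<phi> \<xi> (x - y + v))) =
        Re (LINT x:J|M. (\<Sum>\<xi>\<in>\<Xi>. w \<xi> * \<phi> \<xi> (x - y + v)))"
      using si unfolding set_integrable_def set_lebesgue_integral_def
      by (subst integral_Re[symmetric]) (auto simp: indicator_def)
    also have "(LINT x:J|M. (\<Sum>\<xi>\<in>\<Xi>. w \<xi> * \<phi> \<xi> (x - y + v))) =
       (LINT x:J|M. (\<Sum>\<xi>\<in>\<Xi>. (w \<xi> * (cnj (\<phi> \<xi> y) * \<phi> \<xi> v)) * \<phi> \<xi> x))"
      by (intro set_lebesgue_integral_cong J allI impI sum.cong[OF refl split'])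
    also have "\<dots> = (\<Sum>\<xi>\<in>\<Xi>. (w \<xi> * (cnj (\<phi> \<xi> y) * \<phi> \<xi> v)) * ?h \<xi>)"
      by (subst set_integral_sum) (auto intro!: int)
    finally show ?thesis by (simp add: algebra_simps)
  qed
  then have "(LINT y:J|M. LINT x:J|M. Re (\<Sum>\<xi>\<in>\<Xi>. w \<xi> * \<phi> \<xi> (x - y + v))) =
      (LINT y:J|M. Re (\<Sum>\<xi>\<in>\<Xi>. cnj (\<phi> \<xi> y) * (w \<xi> * ?h \<xi> * \<phi> \<xi> v)))" by simp
  also have "\<dots> = Re (LINT y:J|M. (\<Sum>\<xi>\<in>\<Xi>. cnj (\<phi> \<xi> y) * (w \<xi> * ?h \<xi> * \<phi> \<xi> v)))"
  proof -
    have "set_integrable M J (\<lambda>y. \<Sum>\<xi>\<in>\<Xi>. cnj (\<phi> \<xi> y) * (w \<xi> * ?h \<xi> * \<phi> \<xi> v))"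
      by (intro set_integrable_sum set_integrable_mult_left icnj)
    then show ?thesis
      unfolding set_integrable_def set_lebesgue_integral_def
      by (subst integral_Re[symmetric]) (auto simp: indicator_def)
  qed
  also have "(LINT y:J|M. (\<Sum>\<xi>\<in>\<Xi>. cnj (\<phi> \<xi> y) * (w \<xi> * ?h \<xi> * \<phi> \<xi> v))) =
      (\<Sum>\<xi>\<in>\<Xi>. cnj (?h \<xi>) * (w \<xi> * ?h \<xi> * \<phi> \<xi> v))"
    by (subst set_integral_sum) (auto intro!: icnj simp: cnj_int)
  also have "\<dots> = (\<Sum>\<xi>\<in>\<Xi>. of_real (w \<xi> * (norm (?h \<xi>))\<^sup>2) * \<phi> \<xi> v)"
    by (intro sum.cong refl) (simp only: of_real_mult complex_norm_square mult_ac)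
  finally show ?thesis by simp
qed

text \<open>All that the two cases extract from an independent set. The expansion at
  \<open>v = 0\<close>, where every character is 1, bounds the total weight; at points of
  \<open>V\<close>, which will be the curve, it turns smallness of the kernel into smallness of the
  weighted character sum.\<close>

lemma spectral_weights:
  fixes M :: "'v::ab_group_add measure" and \<phi> :: "'k \<Rightarrow> 'v \<Rightarrow> complex" and w :: "'k \<Rightarrow> real"
  assumes J: "J \<in> sets M" "emeasure M J < \<infinity>"
    and meas: "\<And>\<xi>. \<xi> \<in> \<Xi> \<Longrightarrow> \<phi> \<xi> \<in> borel_measurable M"
    and add: "\<And>\<xi> x y. \<xi> \<in> \<Xi> \<Longrightarrow> \<phi> \<xi> (x + y) = \<phi> \<xi> x * \<phi> \<xi> y"
    and unit: "\<And>\<xi> x. \<xi> \<in> \<Xi> \<Longrightarrow> norm (\<phi> \<xi> x) = 1"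
    and w: "\<And>\<xi>. \<xi> \<in> \<Xi> \<Longrightarrow> w \<xi> \<ge> 0"
    and \<xi>0: "\<And>x. \<phi> \<xi>0 x = 1"
    and K: "\<And>z. K z = Re (\<Sum>\<xi>\<in>\<Xi>. w \<xi> * \<phi> \<xi> z)"
    and small: "\<And>x y v. x \<in> J \<Longrightarrow> y \<in> J \<Longrightarrow> v \<in> V \<Longrightarrow> K (x - y + v) \<le> \<epsilon>"
    and mass: "\<And>y. y \<in> J \<Longrightarrow> (LINT x:J|M. K (x - y)) \<le> \<kappa>"
    and nonneg: "\<epsilon> \<ge> 0" "\<kappa> \<ge> 0"
  obtains b where "\<And>\<xi>. \<xi> \<in> \<Xi> \<Longrightarrow> b \<xi> \<ge> 0" "b \<xi>0 = w \<xi>0 * (measure M J)\<^sup>2"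
    "sum b \<Xi> \<le> \<kappa> * measure M J"
    "\<And>v. v \<in> V \<Longrightarrow> (\<Sum>\<xi>\<in>\<Xi>. b \<xi> * Re (\<phi> \<xi> v)) \<le> \<epsilon> * (measure M J)\<^sup>2"
proof -
  define b where "b \<xi> = w \<xi> * (norm (LINT x:J|M. \<phi> \<xi> x))\<^sup>2" for \<xi>
  have const: "(LINT x:J|M. (c::real)) = c * measure M J" for c
    using J by (simp add: set_lebesgue_integral_def)
  \<comment> \<open>A nonintegrable \<open>h\<close> has integral 0 by convention, and
    \<open>c \<ge> 0\<close> covers that case.\<close>
  have le: "(LINT x:J|M. h x) \<le> c * measure M J" if "\<And>x. x \<in> J \<Longrightarrow> h x \<le> c" "c \<ge> 0" for h and c :: real
  proof (cases "set_integrable M J h")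
    case True
    have "(LINT x:J|M. h x) \<le> (LINT x:J|M. c)"
      by (rule set_integral_mono[OF True])
        (use J that in \<open>auto simp: set_integrable_def\<close>)
    then show ?thesis by (simp add: const)
  next
    case False
    then show ?thesis using that(2) by (simp add: set_lebesgue_integral_def set_integrable_def not_integrable_integral_eq)
  qed
  have exp: "(\<Sum>\<xi>\<in>\<Xi>. b \<xi> * Re (\<phi> \<xi> v)) = (LINT y:J|M. LINT x:J|M. K (x - y + v))" for v
    using autocorrelation_expansion[OF J meas add unit, where \<Xi> = \<Xi> and w = w and v = v]
    by (simp add: b_def K)
  show ?thesis
  proof (rule that[of b])
    show "b \<xi> \<ge> 0" if "\<xi> \<in> \<Xi>" for \<xi> using w[OF that] by (simp add: b_def)
    show "b \<xi>0 = w \<xi>0 * (measure M J)\<^sup>2"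
      using J by (simp add: b_def \<xi>0 set_lebesgue_integral_def)
    have one: "Re (\<phi> \<xi> 0) = 1" if "\<xi> \<in> \<Xi>" for \<xi>
      using add[OF that, of 0 0] unit[OF that, of 0] by auto
    have "sum b \<Xi> = (\<Sum>\<xi>\<in>\<Xi>. b \<xi> * Re (\<phi> \<xi> 0))" using one by simp
    also have "\<dots> = (LINT y:J|M. LINT x:J|M. K (x - y + 0))" by (subst exp) auto
    also have "\<dots> \<le> \<kappa> * measure M J" by (rule le) (use mass nonneg in auto)
    finally show "sum b \<Xi> \<le> \<kappa> * measure M J" .
    show "(\<Sum>\<xi>\<in>\<Xi>. b \<xi> * Re (\<phi> \<xi> v)) \<le> \<epsilon> * (measure M J)\<^sup>2" if "v \<in> V" for v
    proof -
      have "(\<Sum>\<xi>\<in>\<Xi>. b \<xi> * Re (\<phi> \<xi> v)) = (LINT y:J|M. LINT x:J|M. K (x - y + v))" by (subst exp) auto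
      also have "\<dots> \<le> (\<epsilon> * measure M J) * measure M J"
        by (intro le) (use small that nonneg in auto)
      finally show ?thesis by (simp add: power2_eq_square)
    qed
  qed
qed

section \<open>Upper density, finite colourings and compact approximation\<close>

lemma upper_density_le:
  assumes "eventually (\<lambda>r. measure M (B r) > 0 \<and> measure M (I \<inter> B r) \<le> C * measure M (B r)) at_top"
  shows "upper_density M B I \<le> ereal C"
  unfolding upper_density_def
proof (rule Limsup_bounded)
  show "eventually (\<lambda>r. ereal (measure M (I \<inter> B r) / measure M (B r)) \<le> ereal C) at_top"
    using assms by eventually_elim (simp add: divide_le_eq)
qed

text \<open>The sets \<open>A t\<close> form a finite colouring. If every class had upper density
  below \<open>1 / card F\<close>, these strict bounds would hold for all classes at a common radius
  and add up to less than the measure of the ball.\<close>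

lemma independence_ratio_pos:
  assumes F: "finite F" "\<And>t. t \<in> F \<Longrightarrow> borel_independent E (A t)" "(\<Union>t\<in>F. A t) = UNIV"
    and M: "sets M = sets borel"
    and B: "eventually (\<lambda>r. B r \<in> sets borel \<and> emeasure M (B r) < \<infinity> \<and> measure M (B r) > 0) at_top"
  shows "0 < independence_ratio M B E"
proof -
  have n0: "card F > 0" using F by (auto simp: card_gt_0_iff)
  have "\<exists>t\<in>F. \<not> upper_density M B (A t) < ereal (1 / card F)"
  proof (rule ccontr)
    assume "\<not> ?thesis"
    then have lt: "Limsup at_top (\<lambda>r. ereal (measure M (A t \<inter> B r) / measure M (B r))) < ereal (1 / card F)" if "t \<in> F" for t
      using that unfolding upper_density_def by blast
    have "\<forall>t\<in>F. eventually (\<lambda>r. ereal (measure M (A t \<inter> B r) / measure M (B r)) < ereal (1 / card F)) at_top"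
      using Limsup_lessD[OF lt] by blast
    then have "eventually (\<lambda>r. \<forall>t\<in>F. measure M (A t \<inter> B r) / measure M (B r) < 1 / card F) at_top"
      using F(1) by (simp add: eventually_ball_finite_distrib)
    with B have "eventually (\<lambda>r::real. False) at_top"
    proof eventually_elim
      case (elim r)
      have At: "A t \<in> sets borel" if "t \<in> F" for t using F(2)[OF that] by (simp add: borel_independent_def)
      have "measure M (B r) = measure M (\<Union>t\<in>F. A t \<inter> B r)"
      proof -
        have "(\<Union>t\<in>F. A t \<inter> B r) = B r" using F(3) by blast
        then show ?thesis by simp
      qed
      also have "\<dots> \<le> (\<Sum>t\<in>F. measure M (A t \<inter> B r))"
        using At elim F(1) M
        by (intro measure_UNION_le) (auto)
      also have "\<dots> < (\<Sum>t\<in>F. measure M (B r) * (1 / card F))"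
        using elim F(1) n0 by (intro sum_strict_mono) (auto simp: field_simps)
      also have "\<dots> = measure M (B r)" using n0 by simp
      finally show False by simp
    qed
    then show False by simp
  qed
  then obtain t where t: "t \<in> F" "ereal (1 / card F) \<le> upper_density M B (A t)" by (auto simp: not_less)
  have "0 < ereal (1 / card F)" using n0 by simp
  also note t(2)
  also have "upper_density M B (A t) \<le> independence_ratio M B E"
    unfolding independence_ratio_def using F(2)[OF t(1)] by (intro SUP_upper) simp
  finally show ?thesis .
qed

lemma independence_ratio_le:
  assumes "\<And>I. borel_independent E I \<Longrightarrow> upper_density M B I \<le> c"
  shows "independence_ratio M B E \<le> c"
  unfolding independence_ratio_def using assms by (intro SUP_least) auto

text \<open>Compactness will keep differences at a positive distance from the forbidden vectors; the
  price is a factor 2 in the density bound.\<close>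

lemma compact_subset_half_measure:
  fixes M :: "'a::{second_countable_topology, complete_space} measure"
  assumes M: "sets M = sets borel" and A: "A \<in> sets borel" "emeasure M A < \<infinity>"
  obtains J where "compact J" "J \<subseteq> A" "measure M A / 2 \<le> measure M J"
proof (cases "measure M A = 0")
  case True
  then show ?thesis using that[of "{}"] by simp
next
  case False
  \<comment> \<open>Inner regularity is applied to a finite measure, so \<open>M\<close> is first
    restricted to \<open>A\<close>.\<close>
  define N where "N = density M (indicator A)"
  have sN: "sets N = sets borel" by (simp add: N_def M)
  have AM: "A \<in> sets M" using A M by simp
  have em: "emeasure N X = emeasure M (A \<inter> X)" if "X \<in> sets borel" for X
    using that A M unfolding N_def by (simp add: emeasure_density indicator_inter_arith[symmetric])
  have fin: "emeasure N (space N) \<noteq> \<infinity>"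
    using em[of UNIV] A sets_eq_imp_space_eq[OF sN] by simp
  have "emeasure N A = (SUP K\<in>{K. K \<subseteq> A \<and> compact K}. emeasure N K)"
    by (rule inner_regular[OF sN fin A(1)])
  moreover have eA: "emeasure N A = ennreal (measure M A)"
    using em[OF A(1)] A by (simp add: emeasure_eq_ennreal_measure)
  moreover have "ennreal (measure M A / 2) < ennreal (measure M A)"
    using False by (intro ennreal_lessI) (auto simp: zero_less_measure_iff)
  ultimately have "ennreal (measure M A / 2) < (SUP K\<in>{K. K \<subseteq> A \<and> compact K}. emeasure N K)" by simp
  then obtain K where K: "K \<subseteq> A" "compact K" "ennreal (measure M A / 2) < emeasure N K"
    by (auto simp: less_SUP_iff)
  have "emeasure N K = emeasure M K"
    using em[of K] K by (simp add: borel_compact Int_absorb1)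
  moreover have "emeasure M K \<noteq> \<infinity>"
    using emeasure_mono[OF K(1), of M] A AM by (auto simp: top_unique)
  ultimately have "measure M A / 2 \<le> measure M K"
    using K(3) by (auto simp: emeasure_eq_ennreal_measure ennreal_less_iff)
  then show ?thesis using K by (intro that) auto
qed

lemma finite_residue_functions [simp]: "finite (UNIV \<rightarrow>\<^sub>E {..<(k::nat)} :: ('m::finite \<Rightarrow> nat) set)"
  by (intro finite_PiE) auto

section \<open>The phase polynomials\<close>

text \<open>The phase of the character with frequency \<open>\<theta>\<close> along the curve, as a
  polynomial in the curve parameter.\<close>

definition dot_poly :: "('m::finite \<Rightarrow> 'k::field poly) \<Rightarrow> 'k ^ 'm \<Rightarrow> 'k poly" where
  "dot_poly f \<theta> = (\<Sum>i\<in>UNIV. Polynomial.smult (\<theta> $ i) (f i))"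

lemma poly_dot_poly: "poly (dot_poly f \<theta>) s = (\<Sum>i\<in>UNIV. \<theta> $ i * poly (f i) s)"
  by (simp add: dot_poly_def poly_sum)

lemma coeff_dot_poly: "Polynomial.coeff (dot_poly f \<theta>) j = (\<Sum>i\<in>UNIV. \<theta> $ i * Polynomial.coeff (f i) j)"
  by (simp add: dot_poly_def coeff_sum)

lemma lin_indep_with_const:
  fixes f :: "'m::finite \<Rightarrow> 'k::field poly"
  assumes "lin_indep_family (case_option 1 f)" "dot_poly f \<theta> = [:c:]"
  shows "\<theta> = 0"
proof -
  have "(\<Sum>i\<in>UNIV. Polynomial.smult (case_option (- c) (\<lambda>i. \<theta> $ i) i) (case_option 1 f i)) =
      Polynomial.smult (- c) 1 + dot_poly f \<theta>"
    by (simp add: UNIV_option_conv sum.reindex dot_poly_def)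
  also have "\<dots> = 0" by (simp add: assms(2) one_pCons)
  finally have "\<forall>i. case_option (- c) (\<lambda>i. \<theta> $ i) i = 0" using assms(1) unfolding lin_indep_family_def by blast
  then have "\<theta> $ i = 0" for i by (metis option.simps(5))
  then show ?thesis by (simp add: vec_eq_iff)
qed

lemma lin_indep_with_const_nonzero:
  fixes f :: "'m::finite \<Rightarrow> 'k::field poly"
  assumes "lin_indep_family (case_option 1 f)"
  shows "f i \<noteq> 0"
proof
  assume "f i = 0"
  then have "dot_poly f (axis i 1) = [:0:]"
    by (auto simp: dot_poly_def axis_def intro!: sum.neutral)
  from lin_indep_with_const[OF assms this] show False by (simp add: axis_eq_0_iff)
qed

text \<open>Deleting the constant term of \<open>dot_poly f \<theta>\<close> is injective in
  \<theta> by independence, so a linear left inverse recovers \<theta>, and with it the constant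
  term, from the coefficients 1 to \<open>d\<close>. The numbers \<open>g j\<close> depend on
  \<open>f\<close> alone, which makes the resulting bound on the constant term uniform over all
  characters.\<close>

lemma coeff_0_combination:
  fixes f :: "'m::finite \<Rightarrow> 'k::field poly"
  assumes "lin_indep_family (case_option 1 f)" "\<And>i. Polynomial.degree (f i) \<le> d"
  obtains g where "\<And>\<theta>. Polynomial.coeff (dot_poly f \<theta>) 0 = (\<Sum>j=1..d. g j * Polynomial.coeff (dot_poly f \<theta>) j)"
proof -
  interpret vector_space_pair "(*s) :: 'k \<Rightarrow> 'k ^ 'm \<Rightarrow> _" "Polynomial.smult :: 'k \<Rightarrow> 'k poly \<Rightarrow> _"
    by unfold_locales (auto simp: vec_eq_iff algebra_simps smult_add_left smult_add_right)
  define L where "L \<theta> = dot_poly f \<theta> - [:Polynomial.coeff (dot_poly f \<theta>) 0:]" for \<theta>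
  have dot_add: "dot_poly f (x + y) = dot_poly f x + dot_poly f y" for x y
    by (simp add: dot_poly_def smult_add_left sum.distrib)
  have dot_scale: "dot_poly f (c *s x) = Polynomial.smult c (dot_poly f x)" for c x
    by (simp add: dot_poly_def smult_sum2)
  have lin: "Vector_Spaces.linear (*s) Polynomial.smult L"
    by unfold_locales (auto simp: L_def dot_add dot_scale smult_diff_right algebra_simps
        vec_eq_iff smult_add_left smult_add_right)
  have "inj L"
  proof (subst linear_inj_iff_eq_0[OF lin], intro allI impI)
    fix \<theta> assume "L \<theta> = 0"
    then have "dot_poly f \<theta> = [:Polynomial.coeff (dot_poly f \<theta>) 0:]" by (simp add: L_def)
    then show "\<theta> = 0" by (rule lin_indep_with_const[OF assms(1)])
  qed
  then obtain g where g: "Vector_Spaces.linear Polynomial.smult (*s) g" "g \<circ> L = id"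
    using linear_injective_left_inverse[OF lin] by blast
  interpret g: Vector_Spaces.linear "Polynomial.smult :: 'k \<Rightarrow> 'k poly \<Rightarrow> _" "(*s) :: 'k \<Rightarrow> 'k ^ 'm \<Rightarrow> _" g by (rule g(1))
  have degree: "Polynomial.degree (dot_poly f \<theta>) \<le> d" for \<theta>
    unfolding dot_poly_def using assms(2)
    by (intro degree_sum_le) (auto intro: order_trans[OF degree_smult_le])
  \<comment> \<open>By linearity the left inverse is determined by its values on the
    monomials.\<close>
  have "\<theta> = (\<Sum>j=1..d. Polynomial.coeff (dot_poly f \<theta>) j *s g (Polynomial.monom 1 j))" for \<theta>
  proof -
    have "L \<theta> = (\<Sum>j=1..d. Polynomial.smult (Polynomial.coeff (dot_poly f \<theta>) j) (Polynomial.monom 1 j))"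
    proof (rule poly_eqI)
      fix n
      have "Polynomial.coeff (\<Sum>j=1..d. Polynomial.smult (Polynomial.coeff (dot_poly f \<theta>) j) (Polynomial.monom 1 j)) n =
          (\<Sum>j=1..d. if j = n then Polynomial.coeff (dot_poly f \<theta>) n else 0)"
        unfolding coeff_sum coeff_smult coeff_monom by (intro sum.cong) auto
      also have "\<dots> = (if n \<in> {1..d} then Polynomial.coeff (dot_poly f \<theta>) n else 0)"
        by (subst sum.delta) auto
      also have "\<dots> = Polynomial.coeff (L \<theta>) n"
        using degree[of \<theta>] by (cases n) (auto simp: L_def coeff_eq_0)
      finally show "Polynomial.coeff (L \<theta>) n = Polynomial.coeff (\<Sum>j=1..d. Polynomial.smult (Polynomial.coeff (dot_poly f \<theta>) j) (Polynomial.monom 1 j)) n" by simp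
    qed
    then have "g (L \<theta>) = (\<Sum>j=1..d. Polynomial.coeff (dot_poly f \<theta>) j *s g (Polynomial.monom 1 j))"
      by (simp add: g.sum g.scale)
    then show ?thesis using g(2) by (metis comp_apply id_apply)
  qed
  then have \<theta>: "\<theta> $ i = (\<Sum>j=1..d. Polynomial.coeff (dot_poly f \<theta>) j * g (Polynomial.monom 1 j) $ i)" for \<theta> i
    by (metis (no_types, lifting) sum.cong sum_component vector_smult_component)
  have "Polynomial.coeff (dot_poly f \<theta>) 0 =
      (\<Sum>j=1..d. (\<Sum>i\<in>UNIV. g (Polynomial.monom 1 j) $ i * Polynomial.coeff (f i) 0) * Polynomial.coeff (dot_poly f \<theta>) j)" for \<theta>
  proof -
    have "Polynomial.coeff (dot_poly f \<theta>) 0 =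
        (\<Sum>i\<in>UNIV. (\<Sum>j=1..d. Polynomial.coeff (dot_poly f \<theta>) j * g (Polynomial.monom 1 j) $ i) * Polynomial.coeff (f i) 0)"
      unfolding coeff_dot_poly[of f \<theta> 0] by (intro sum.cong refl arg_cong2[where f = "(*)"] \<theta>)
    also have "\<dots> = (\<Sum>j=1..d. \<Sum>i\<in>UNIV. Polynomial.coeff (dot_poly f \<theta>) j * g (Polynomial.monom 1 j) $ i * Polynomial.coeff (f i) 0)"
      by (subst sum.swap) (simp add: sum_distrib_right)
    finally show ?thesis unfolding sum_distrib_right by (simp only: mult_ac)
  qed
  then show ?thesis by (rule that)
qed

text \<open>One integration by parts with \<open>sin h / h'\<close>. Each end term is at most 2 in
  absolute value. The remainder is at most \<open>4 * D / m t\<close>, and the exponential growth of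
  \<open>m\<close> makes its integral at most \<open>4 * D\<close>, however long the interval
  is.\<close>

lemma non_stationary_phase:
  fixes h h' h'' m :: "real \<Rightarrow> real"
  assumes le: "\<alpha> \<le> \<beta>"
    and h: "\<And>t. t \<in> {\<alpha>..\<beta>} \<Longrightarrow> (h has_real_derivative h' t) (at t)"
    and h': "\<And>t. t \<in> {\<alpha>..\<beta>} \<Longrightarrow> (h' has_real_derivative h'' t) (at t)"
    and lower: "\<And>t. t \<in> {\<alpha>..\<beta>} \<Longrightarrow> m t / 2 \<le> \<bar>h' t\<bar>"
    and upper: "\<And>t. t \<in> {\<alpha>..\<beta>} \<Longrightarrow> \<bar>h'' t\<bar> \<le> D * m t"
    and m: "\<And>t. t \<in> {\<alpha>..\<beta>} \<Longrightarrow> exp (t - \<alpha>) \<le> m t"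
    and D: "D \<ge> 0"
  shows "\<bar>LBINT t:{\<alpha>..\<beta>}. cos (h t)\<bar> \<le> 4 + 4 * D"
proof -
  let ?G = "\<lambda>t. sin (h t) / h' t"
  let ?e = "\<lambda>t. sin (h t) * h'' t / (h' t)\<^sup>2"
  have mpos: "m t > 0" "m t \<ge> 1" if "t \<in> {\<alpha>..\<beta>}" for t
    using m[OF that] that by (auto intro: less_le_trans[OF exp_gt_zero] order_trans[OF _ m])
  have nz: "h' t \<noteq> 0" if "t \<in> {\<alpha>..\<beta>}" for t using lower[OF that] mpos[OF that] by auto
  have "(?G has_vector_derivative (cos (h t) - ?e t)) (at t within {\<alpha>..\<beta>})" if "t \<in> {\<alpha>..\<beta>}" for t
    unfolding has_real_derivative_iff_has_vector_derivative[symmetric]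
    using nz[OF that]
    by (auto intro!: derivative_eq_intros DERIV_subset[OF h[OF that]] DERIV_subset[OF h'[OF that]]
        simp: field_simps power2_eq_square)
  then have G: "((\<lambda>t. cos (h t) - ?e t) has_integral (?G \<beta> - ?G \<alpha>)) {\<alpha>..\<beta>}"
    by (intro fundamental_theorem_of_calculus le)
  have "continuous_on {\<alpha>..\<beta>} h"
    by (intro continuous_at_imp_continuous_on ballI DERIV_isCont[OF h])
  then have cont: "continuous_on {\<alpha>..\<beta>} (\<lambda>t. cos (h t))" by (intro continuous_intros)
  then have intc: "(\<lambda>t. cos (h t)) integrable_on {\<alpha>..\<beta>}" by (rule integrable_continuous_real)
  \<comment> \<open>The remainder is integrable as a difference of two integrable functions;
    continuity of \<open>h''\<close> is not assumed.\<close>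
  have "((\<lambda>t. cos (h t) - (cos (h t) - ?e t)) has_integral (integral {\<alpha>..\<beta>} (\<lambda>t. cos (h t)) - (?G \<beta> - ?G \<alpha>))) {\<alpha>..\<beta>}"
    by (intro has_integral_diff G integrable_integral intc)
  then have e: "(?e has_integral (integral {\<alpha>..\<beta>} (\<lambda>t. cos (h t)) - (?G \<beta> - ?G \<alpha>))) {\<alpha>..\<beta>}" by simp
  have "((\<lambda>t. 4 * D * exp (\<alpha> - t)) has_integral (- 4 * D * exp (\<alpha> - \<beta>) - (- 4 * D * exp (\<alpha> - \<alpha>)))) {\<alpha>..\<beta>}"
    by (intro fundamental_theorem_of_calculus le)
      (auto intro!: derivative_eq_intros simp: has_real_derivative_iff_has_vector_derivative[symmetric])
  note hi = this
  have g: "(\<lambda>t. 4 * D * exp (\<alpha> - t)) integrable_on {\<alpha>..\<beta>}" using hi by (rule has_integral_integrable)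
  have gi: "integral {\<alpha>..\<beta>} (\<lambda>t. 4 * D * exp (\<alpha> - t)) \<le> 4 * D"
    unfolding integral_unique[OF hi] using D by simp
  have eb: "norm (?e t) \<le> 4 * D * exp (\<alpha> - t)" if t: "t \<in> {\<alpha>..\<beta>}" for t
  proof -
    have "(m t / 2)\<^sup>2 \<le> (h' t)\<^sup>2"
      using lower[OF t] mpos[OF t] by (metis abs_ge_zero less_eq_real_def power2_abs power_mono zero_le_divide_iff zero_le_numeral)
    then have q: "(m t)\<^sup>2 / 4 \<le> (h' t)\<^sup>2" by (simp add: power_divide)
    have "norm (?e t) = \<bar>sin (h t)\<bar> * \<bar>h'' t\<bar> / (h' t)\<^sup>2" by (simp add: abs_mult)
    also have "\<dots> \<le> 1 * (D * m t) / ((m t)\<^sup>2 / 4)"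
      using q upper[OF t] mpos[OF t] D by (intro frac_le mult_mono) auto
    also have "\<dots> = 4 * D / m t" using mpos[OF t] by (simp add: power2_eq_square)
    also have "\<dots> \<le> 4 * D / exp (t - \<alpha>)" using m[OF t] D by (intro divide_left_mono) (auto simp: mpos[OF t])
    also have "\<dots> = 4 * D * exp (\<alpha> - t)" by (simp add: exp_diff)
    finally show ?thesis .
  qed
  have "norm (integral {\<alpha>..\<beta>} ?e) \<le> integral {\<alpha>..\<beta>} (\<lambda>t. 4 * D * exp (\<alpha> - t))"
    by (intro integral_norm_bound_integral g eb) (use e in \<open>auto simp: has_integral_integrable\<close>)
  then have 1: "\<bar>integral {\<alpha>..\<beta>} (\<lambda>t. cos (h t)) - (?G \<beta> - ?G \<alpha>)\<bar> \<le> 4 * D"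
    using gi integral_unique[OF e] by simp
  have G2: "\<bar>?G t\<bar> \<le> 2" if t: "t \<in> {\<alpha>..\<beta>}" for t
  proof -
    have "\<bar>?G t\<bar> \<le> 1 / (1/2)"
      unfolding abs_divide using lower[OF t] mpos[OF t] by (intro frac_le) auto
    then show ?thesis by simp
  qed
  have "set_integrable lborel {\<alpha>..\<beta>} (\<lambda>t. cos (h t))"
    by (rule borel_integrable_atLeastAtMost'[OF cont])
  then have "(LBINT t:{\<alpha>..\<beta>}. cos (h t)) = integral {\<alpha>..\<beta>} (\<lambda>t. cos (h t))"
    by (rule set_borel_integral_eq_integral)
  moreover have "\<bar>?G \<alpha>\<bar> \<le> 2" "\<bar>?G \<beta>\<bar> \<le> 2" using G2 le by force+
  ultimately show ?thesis using 1 by linarith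
qed

section \<open>Exceptional windows on the logarithmic scale\<close>

definition "window \<sigma> u l = {t::real. u \<le> \<sigma> * t \<and> \<sigma> * t \<le> u + l}"

text \<open>Taking preimages under \<open>t \<mapsto> \<sigma> * t\<close> divides lengths by
  \<open>\<bar>\<sigma>\<bar>\<close>. In the applications \<sigma> is a degree or a difference of
  degrees, and the coefficients enter only through the position \<open>u\<close>, so the length is
  bounded independently of them.\<close>

lemma window_interval:
  assumes "\<bar>\<sigma>\<bar> \<ge> 1" "l \<ge> 0"
  obtains x y where "window \<sigma> u l = {x..y}" "x \<le> y" "y - x \<le> l"
proof (cases "\<sigma> > 0")
  case True
  have "window \<sigma> u l = {u / \<sigma>..(u + l) / \<sigma>}" using True by (auto simp: window_def field_simps)
  moreover have "(u + l) / \<sigma> - u / \<sigma> = l / \<sigma>" by (simp add: diff_divide_distrib[symmetric])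
  moreover have "l / \<sigma> \<le> l / 1" using assms True by (intro divide_left_mono) auto
  moreover have "l / \<sigma> \<ge> 0" using assms True by simp
  ultimately show ?thesis by (intro that[of "u / \<sigma>" "(u + l) / \<sigma>"]) auto
next
  case False
  then have s: "\<sigma> < 0" using assms by auto
  then have "window \<sigma> u l = {(u + l) / \<sigma>..u / \<sigma>}" by (auto simp: window_def field_simps)
  moreover have "u / \<sigma> - (u + l) / \<sigma> = l / (- \<sigma>)" by (simp add: diff_divide_distrib[symmetric])
  moreover have "l / (- \<sigma>) \<le> l / 1" using assms s by (intro divide_left_mono) auto
  moreover have "l / (- \<sigma>) \<ge> 0" using assms s by (intro divide_nonneg_pos) auto
  ultimately show ?thesis by (intro that[of "(u + l) / \<sigma>" "u / \<sigma>"]) auto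
qed

lemma measure_window:
  assumes "\<bar>\<sigma>\<bar> \<ge> 1" "l \<ge> 0"
  shows "window \<sigma> u l \<in> sets borel"
    and "emeasure lborel (window \<sigma> u l) < \<infinity>"
    and "measure lborel (window \<sigma> u l) \<le> l"
proof -
  obtain x y where "window \<sigma> u l = {x..y}" "x \<le> y" "y - x \<le> l" using window_interval[OF assms] .
  then show "window \<sigma> u l \<in> sets borel" "emeasure lborel (window \<sigma> u l) < \<infinity>" "measure lborel (window \<sigma> u l) \<le> l"
    by auto
qed

text \<open>The p-adic counterpart of \<open>measure_window\<close>: there the scales are the
  multiples of \<open>q = ln p\<close>. The extra 1 appears because a closed interval may contain
  lattice points at both ends.\<close>

lemma card_window:
  assumes "\<bar>\<sigma>\<bar> \<ge> 1" "l \<ge> 0" "q > 0"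
  shows "finite {k::int. of_int k * q \<in> window \<sigma> u l}"
    and "card {k::int. of_int k * q \<in> window \<sigma> u l} \<le> l / q + 1"
proof -
  obtain x y where xy: "window \<sigma> u l = {x..y}" "x \<le> y" "y - x \<le> l" using window_interval[OF assms(1,2)] .
  have eq: "{k::int. of_int k * q \<in> window \<sigma> u l} = {\<lceil>x / q\<rceil>..\<lfloor>y / q\<rfloor>}"
    using assms(3) unfolding xy(1) by (auto simp: le_floor_iff ceiling_le_iff field_simps)
  show "finite {k::int. of_int k * q \<in> window \<sigma> u l}" unfolding eq by simp
  have "y / q - x / q \<le> l / q" using xy(3) assms(3) by (simp add: diff_divide_distrib[symmetric] divide_right_mono)
  moreover have "l / q \<ge> 0" using assms by simp
  moreover have "x / q \<le> of_int \<lceil>x / q\<rceil>" "of_int \<lfloor>y / q\<rfloor> \<le> y / q" by simp_all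
  moreover have "real (nat (\<lfloor>y / q\<rfloor> + 1 - \<lceil>x / q\<rceil>)) \<le> max 0 (of_int \<lfloor>y / q\<rfloor> + 1 - of_int \<lceil>x / q\<rceil>)"
    by (simp add: max_def)
  ultimately show "card {k::int. of_int k * q \<in> window \<sigma> u l} \<le> l / q + 1"
    unfolding eq card_atLeastAtMost_int by linarith
qed

text \<open>For \<open>\<gamma> j > 0\<close> this is the set where
  \<open>lo \<le> \<gamma> j * exp (j * t) \<le> hi\<close>: the term is neither negligible nor
  large enough to force oscillation. For \<open>\<gamma> j = 0\<close> it is still a window of the
  same length, so the measure bounds need no case distinction.\<close>

definition low_window :: "(nat \<Rightarrow> real) \<Rightarrow> real \<Rightarrow> real \<Rightarrow> nat \<Rightarrow> real set" where
  "low_window \<gamma> lo hi j = window j (ln lo - ln (\<gamma> j)) (ln (hi / lo))"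

text \<open>For positive coefficients, the set where term \<open>j\<close> is at least term
  \<open>i\<close> but at most \<kappa> times as large.\<close>

definition tie_window :: "(nat \<Rightarrow> real) \<Rightarrow> real \<Rightarrow> nat \<Rightarrow> nat \<Rightarrow> real set" where
  "tie_window \<gamma> \<kappa> j i = window (real i - real j) (ln (\<gamma> j) - ln (\<gamma> i) - ln \<kappa>) (ln \<kappa>)"

text \<open>
  On a logarithmic scale the terms \<open>\<gamma>\<^sub>j e\<^bsup>jt\<^esup>\<close> are lines with distinct integer slopes, so away from a set
  of \<open>t\<close> of bounded measure either all of them are small or one of them dominates the others.
\<close>

lemma dominant_term_cases:
  fixes \<gamma> :: "nat \<Rightarrow> real" and t :: real
  assumes "d \<ge> 1" "\<And>j. \<gamma> j \<ge> 0" "0 < lo" "lo \<le> hi" "1 \<le> \<kappa>"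
  obtains (small) "\<And>j. j \<in> {1..d} \<Longrightarrow> \<gamma> j * exp (j * t) < lo"
    | (low) j where "j \<in> {1..d}" "t \<in> low_window \<gamma> lo hi j"
    | (tie) j i where "j \<in> {1..d}" "i \<in> {1..d} - {j}" "t \<in> tie_window \<gamma> \<kappa> j i"
    | (dominant) j where "j \<in> {1..d}" "hi \<le> \<gamma> j * exp (j * t)"
        "\<And>i. i \<in> {1..d} - {j} \<Longrightarrow> \<kappa> * (\<gamma> i * exp (i * t)) \<le> \<gamma> j * exp (j * t)"
proof -
  let ?m = "\<lambda>j::nat. \<gamma> j * exp (j * t)"
  \<comment> \<open>The size of the largest term decides: below \<open>lo\<close> all terms are
    small, between \<open>lo\<close> and \<open>hi\<close> its index yields a low window, and above
    \<open>hi\<close> it either dominates or has a competitor within the factor \<kappa>.\<close>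
  define M where "M = Max (?m ` {1..d})"
  have ne: "?m ` {1..d} \<noteq> {}" using assms(1) by auto
  then have "M \<in> ?m ` {1..d}" unfolding M_def by (intro Max_in) auto
  then obtain j where j: "j \<in> {1..d}" "M = ?m j" by auto
  have max: "?m i \<le> M" if "i \<in> {1..d}" for i
    unfolding M_def by (rule Max_ge) (use that in auto)
  have lnm: "ln (?m i) = ln (\<gamma> i) + i * t" "?m i > 0" if "\<gamma> i \<noteq> 0" for i
    using that assms(2)[of i] by (auto simp: ln_mult)
  consider "M < lo" | "lo \<le> M" "M \<le> hi" | "hi \<le> M" by linarith
  then show ?thesis
  proof cases
    case 1
    then show ?thesis using max by (intro small) force
  next
    case 2
    then have cj: "\<gamma> j \<noteq> 0" using j assms(3) by auto
    have "ln lo \<le> ln (?m j)" "ln (?m j) \<le> ln hi"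
      using 2 assms(3) lnm(2)[OF cj] unfolding j(2) by (intro ln_mono; linarith)+
    then have "t \<in> low_window \<gamma> lo hi j"
      using assms(3,4) unfolding low_window_def window_def lnm[OF cj] by (simp add: ln_div)
    then show ?thesis by (rule low[OF j(1)])
  next
    case 3
    then have cj: "\<gamma> j \<noteq> 0" using j assms(3,4) by auto
    show ?thesis
    proof (cases "\<forall>i\<in>{1..d} - {j}. \<kappa> * ?m i \<le> ?m j")
      case True
      then show ?thesis using 3 j dominant by blast
    next
      case False
      then obtain i where i: "i \<in> {1..d} - {j}" "\<not> \<kappa> * ?m i \<le> ?m j" by blast
      have ci: "\<gamma> i \<noteq> 0" using i assms(2)[of j] by auto
      have "ln (?m j) \<le> ln (\<kappa> * ?m i)" using i(2) lnm(2)[OF cj] by (intro ln_mono) auto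
      also have "\<dots> = ln \<kappa> + ln (?m i)" using lnm(2)[OF ci] assms(5) by (subst ln_mult) auto
      finally have "ln (?m j) \<le> ln \<kappa> + ln (?m i)" .
      moreover have "ln (?m i) \<le> ln (?m j)" using max[of i] i j(2) lnm(2)[OF ci] by (intro ln_mono) auto
      ultimately have "t \<in> tie_window \<gamma> \<kappa> j i"
        unfolding tie_window_def window_def lnm(1)[OF ci] lnm(1)[OF cj] by (simp add: algebra_simps)
      then show ?thesis by (rule tie[OF j(1) i(1)])
    qed
  qed
qed

lemma between_linear_le:
  fixes s :: real
  assumes "x \<le> t" "t \<le> y" "r + s * x \<le> r' + s' * x" "r + s * y \<le> r' + s' * y"
  shows "r + s * t \<le> r' + s' * t"
proof (cases "s \<le> s'")
  case True
  then have "(s' - s) * (t - x) \<ge> 0" using assms by simp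
  then show ?thesis using assms by (simp add: algebra_simps)
next
  case False
  then have "(s - s') * (y - t) \<ge> 0" using assms by simp
  then show ?thesis using assms by (simp add: algebra_simps)
qed

section \<open>Lower bounds for averages of cosines of exponential sums\<close>

context
  fixes d :: nat and c :: "nat \<Rightarrow> real" and a T :: real
  assumes d: "d \<ge> 1"
begin

text \<open>Taking logarithms makes every condition affine in \<open>t\<close>, so the set is an
  interval, as integration by parts requires. In the factor \<open>2 * d\<^sup>2\<close>, one
  \<open>d\<close> absorbs the degree produced by differentiation, the other the number of remaining
  terms, and the 2 leaves half of the leading term.\<close>

definition "dominant (j::nat) = {t::real. c j \<noteq> 0 \<and> a \<le> t \<and> t \<le> T \<and> 0 \<le> ln \<bar>c j\<bar> + j * t \<and>
    (\<forall>i\<in>{1..d} - {j}. c i \<noteq> 0 \<longrightarrow> ln (2 * d\<^sup>2) + ln \<bar>c i\<bar> + i * t \<le> ln \<bar>c j\<bar> + j * t)}"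

lemma dominant_iff:
  fixes t :: real and j :: nat
  shows "t \<in> dominant j \<longleftrightarrow> a \<le> t \<and> t \<le> T \<and> 1 \<le> \<bar>c j\<bar> * exp (j * t) \<and>
    (\<forall>i\<in>{1..d} - {j}. 2 * d\<^sup>2 * (\<bar>c i\<bar> * exp (i * t)) \<le> \<bar>c j\<bar> * exp (j * t))"
proof -
  have ex: "exp (ln \<bar>c i\<bar> + i * t) = \<bar>c i\<bar> * exp (i * t)" if "c i \<noteq> 0" for i
    using that by (simp add: exp_add)
  have ex2: "exp (ln (2 * real (d\<^sup>2)) + ln \<bar>c i\<bar> + i * t) = 2 * d\<^sup>2 * (\<bar>c i\<bar> * exp (i * t))" if "c i \<noteq> 0" for i
    using that d by (simp add: exp_add)
  have 1: "0 \<le> ln \<bar>c i\<bar> + i * t \<longleftrightarrow> 1 \<le> \<bar>c i\<bar> * exp (i * t)" if "c i \<noteq> 0" for i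
    using ex[OF that] by (metis exp_le_cancel_iff exp_zero)
  have 2: "ln (2 * real (d\<^sup>2)) + ln \<bar>c i\<bar> + i * t \<le> ln \<bar>c j\<bar> + j * t \<longleftrightarrow>
      2 * d\<^sup>2 * (\<bar>c i\<bar> * exp (i * t)) \<le> \<bar>c j\<bar> * exp (j * t)" if "c i \<noteq> 0" "c j \<noteq> 0" for i
    using ex[OF that(2)] ex2[OF that(1)] by (metis exp_le_cancel_iff)
  show ?thesis
  proof (cases "c j = 0")
    case True
    then show ?thesis by (auto simp: dominant_def)
  next
    case False
    have "(c i \<noteq> 0 \<longrightarrow> ln (2 * real (d\<^sup>2)) + ln \<bar>c i\<bar> + i * t \<le> ln \<bar>c j\<bar> + j * t) \<longleftrightarrow>
      2 * d\<^sup>2 * (\<bar>c i\<bar> * exp (i * t)) \<le> \<bar>c j\<bar> * exp (j * t)" for i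
      using 2[of i] False by (cases "c i = 0") auto
    then show ?thesis using False 1[OF False] unfolding dominant_def by simp
  qed
qed

lemma dominant_interval: "\<exists>\<alpha> \<beta>. dominant j = {\<alpha>..\<beta>}"
proof -
  have "dominant j = (if c j = 0 then {} else
     {a..T} \<inter> {t. 0 \<le> ln \<bar>c j\<bar> + j * t} \<inter>
     (\<Inter>i\<in>{i\<in>{1..d} - {j}. c i \<noteq> 0}. {t. ln (2 * d\<^sup>2) + ln \<bar>c i\<bar> + i * t \<le> ln \<bar>c j\<bar> + j * t}))"
    by (auto simp: dominant_def)
  also have "compact \<dots>"
    by (auto intro!: compact_Int_closed closed_INT closed_Collect_le continuous_intros)
  finally have "compact (dominant j)" .
  moreover have "is_interval (dominant j)"
    unfolding is_interval_1
  proof (intro ballI allI impI)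
    fix x y t assume x: "x \<in> dominant j" and y: "y \<in> dominant j" and t: "x \<le> t \<and> t \<le> y"
    show "t \<in> dominant j"
      using x y t between_linear_le[of x t y 0 0 "ln \<bar>c j\<bar>" "real j"]
        between_linear_le[of x t y _ _ "ln \<bar>c j\<bar>" "real j"]
      unfolding dominant_def by auto
  qed
  ultimately show ?thesis
    using connected_compact_interval_1 is_interval_connected_1 by blast
qed

lemma dominant_disjoint:
  assumes "t \<in> dominant i" "t \<in> dominant j" "i \<in> {1..d}" "j \<in> {1..d}"
  shows "i = j"
proof (rule ccontr)
  assume "i \<noteq> j"
  define x y where "x = \<bar>c i\<bar> * exp (i * t)" and "y = \<bar>c j\<bar> * exp (j * t)"
  have xy: "1 \<le> x" "1 \<le> y" "2 * real (d\<^sup>2) * x \<le> y" "2 * real (d\<^sup>2) * y \<le> x"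
    using assms \<open>i \<noteq> j\<close> unfolding dominant_iff x_def y_def by auto
  have "1 \<le> real (d\<^sup>2)" using d by simp
  then have "2 * 1 * x \<le> 2 * real (d\<^sup>2) * x" "2 * 1 * y \<le> 2 * real (d\<^sup>2) * y"
    using xy by (auto intro!: mult_right_mono)
  then show False using xy by linarith
qed

text \<open>The constant term drops out of the derivative, so only the terms 1 to \<open>d\<close>
  compete. The factor \<open>(d + 1) * d\<^sup>2\<close> is the number of summands of the second
  derivative times the largest squared degree.\<close>

lemma integral_dominant:
  assumes j: "j \<in> {1..d}"
  shows "\<bar>LBINT t:dominant j. cos (\<Sum>i\<le>d. c i * exp (i * t))\<bar> \<le> 4 + 4 * (real (d + 1) * d\<^sup>2)"
proof -
  obtain \<alpha> \<beta> where ab: "dominant j = {\<alpha>..\<beta>}" using dominant_interval by blast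
  show ?thesis
  proof (cases "\<alpha> \<le> \<beta>")
    case False
    then show ?thesis using ab by (simp add: set_lebesgue_integral_def)
  next
    case True
    let ?m = "\<lambda>t::real. \<bar>c j\<bar> * exp (j * t)"
    let ?h' = "\<lambda>t::real. \<Sum>i\<le>d. i * c i * exp (i * t)"
    let ?h'' = "\<lambda>t::real. \<Sum>i\<le>d. (i * i) * c i * exp (i * t)"
    have dd: "1 \<le> real (d\<^sup>2)" using d by simp
    show ?thesis unfolding ab
    proof (rule non_stationary_phase[where h' = ?h' and h'' = ?h'' and m = ?m])
      fix t assume "t \<in> {\<alpha>..\<beta>}"
      then have t: "t \<in> dominant j" using ab by simp
      then have m1: "?m t \<ge> 1" by (simp add: dominant_iff)
      have dom: "2 * d\<^sup>2 * (\<bar>c i\<bar> * exp (i * t)) \<le> ?m t" if "i \<in> {1..d} - {j}" for i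
        using t that by (auto simp: dominant_iff)
      show "((\<lambda>t. \<Sum>i\<le>d. c i * exp (i * t)) has_real_derivative ?h' t) (at t)"
        by (auto intro!: derivative_eq_intros sum.cong)
      show "(?h' has_real_derivative ?h'' t) (at t)"
        by (auto intro!: derivative_eq_intros sum.cong)
      show "?m t / 2 \<le> \<bar>?h' t\<bar>"
      proof -
        have "\<bar>?h' t - j * c j * exp (j * t)\<bar> = \<bar>\<Sum>i\<in>{..d} - {j}. i * c i * exp (i * t)\<bar>"
          using j by (subst sum.remove[of "{..d}" j]) auto
        also have "\<dots> \<le> (\<Sum>i\<in>{..d} - {j}. \<bar>i * c i * exp (i * t)\<bar>)" by (rule sum_abs)
        also have "\<dots> \<le> (\<Sum>i\<in>{..d} - {j}. ?m t / (2 * d))"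
        proof (rule sum_mono)
          fix i assume i: "i \<in> {..d} - {j}"
          show "\<bar>i * c i * exp (i * t)\<bar> \<le> ?m t / (2 * d)"
          proof (cases "i = 0")
            case False
            with i have i': "i \<in> {1..d} - {j}" by auto
            have "2 * d * \<bar>i * c i * exp (i * t)\<bar> = 2 * (d * i) * (\<bar>c i\<bar> * exp (i * t))"
              by (simp add: abs_mult)
            also have "\<dots> \<le> 2 * d\<^sup>2 * (\<bar>c i\<bar> * exp (i * t))"
              using i by (intro mult_right_mono) (auto simp: power2_eq_square simp flip: of_nat_mult)
            also have "\<dots> \<le> ?m t" using dom[OF i'] .
            finally show ?thesis using d by (simp add: field_simps)
          qed simp
        qed
        also have "\<dots> = ?m t / 2" using j d by (simp add: card_Diff_singleton)
        finally have "\<bar>?h' t - j * c j * exp (j * t)\<bar> \<le> ?m t / 2" .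
        moreover have "\<bar>j * c j * exp (j * t)\<bar> \<ge> 1 * ?m t"
          unfolding abs_mult mult.assoc using j by (intro mult_mono) auto
        ultimately show ?thesis by linarith
      qed
      show "\<bar>?h'' t\<bar> \<le> (real (d + 1) * d\<^sup>2) * ?m t"
      proof -
        have "\<bar>?h'' t\<bar> \<le> (\<Sum>i\<le>d. \<bar>(i * i) * c i * exp (i * t)\<bar>)" by (rule sum_abs)
        also have "\<dots> \<le> (\<Sum>i\<le>d. d\<^sup>2 * ?m t)"
        proof (rule sum_mono)
          fix i assume i: "i \<in> {..d}"
          show "\<bar>real (i * i) * c i * exp (i * t)\<bar> \<le> d\<^sup>2 * ?m t"
          proof (cases "i = 0")
            case False
            have ci: "\<bar>c i\<bar> * exp (i * t) \<le> ?m t"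
            proof (cases "i = j")
              case ne: False
              with False i have i': "i \<in> {1..d} - {j}" by auto
              have "1 * (\<bar>c i\<bar> * exp (i * t)) \<le> 2 * d\<^sup>2 * (\<bar>c i\<bar> * exp (i * t))"
                using dd by (intro mult_right_mono) auto
              then show ?thesis using dom[OF i'] by simp
            qed simp
            have "\<bar>real (i * i) * c i * exp (i * t)\<bar> = real (i * i) * (\<bar>c i\<bar> * exp (i * t))" by (simp add: abs_mult)
            also have "\<dots> \<le> real (d\<^sup>2) * ?m t"
              unfolding power2_eq_square using i
              by (intro mult_mono[OF _ ci] of_nat_mono mult_le_mono) auto
            finally show ?thesis .
          qed simp
        qed
        finally show ?thesis by simp
      qed
      \<comment> \<open>The leading term is at least 1 already at the left end and has degree at
        least 1, so from there on it grows at least like \<open>exp (t - \<alpha>)\<close>.\<close>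
      have "\<alpha> \<in> dominant j" using True ab by simp
      then have "1 * exp (t - \<alpha>) \<le> (\<bar>c j\<bar> * exp (j * \<alpha>)) * exp (j * (t - \<alpha>))"
        using j \<open>t \<in> {\<alpha>..\<beta>}\<close> by (intro mult_mono) (auto simp: dominant_iff mult_le_cancel_right1)
      also have "\<dots> = ?m t" by (simp add: mult.assoc exp_add[symmetric] algebra_simps)
      finally show "exp (t - \<alpha>) \<le> ?m t" by simp
    qed (use True in auto)
  qed
qed

text \<open>The threshold \<open>1 / (2 * d)\<close> leaves at most 1/2 for the sum of the
  nonconstant terms. Since \<open>exp (j * t) \<ge> exp a\<close> for \<open>j \<ge> 1\<close>, the
  coefficients themselves are smaller by a factor \<open>exp a\<close>, which outweighs
  \<open>K\<close> and leaves at most 1/2 for the constant term. The phase is then at most 1 in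
  absolute value, below \<open>pi / 2\<close>.\<close>

lemma cos_nonneg_if_small:
  fixes t :: real
  assumes K: "\<bar>c 0\<bar> \<le> K * (\<Sum>j=1..d. \<bar>c j\<bar>)" "K \<le> exp a" "K \<ge> 0" and a: "0 \<le> a" and t: "a \<le> t"
    and small: "\<And>j. j \<in> {1..d} \<Longrightarrow> \<bar>c j\<bar> * exp (j * t) < 1 / (2 * d)"
  shows "0 \<le> cos (\<Sum>i\<le>d. c i * exp (i * t))"
proof -
  let ?m = "\<lambda>j::nat. \<bar>c j\<bar> * exp (j * t)"
  have e1: "exp a \<le> exp (i * t)" if "i \<in> {1..d}" for i :: nat
  proof -
    have "1 * t \<le> i * t" using that a t by (intro mult_right_mono) auto
    then show ?thesis using t by simp
  qed
  have s: "(\<Sum>i=1..d. ?m i) \<le> (\<Sum>i=1..d. 1 / (2 * d))"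
    using small by (intro sum_mono less_imp_le)
  then have s: "(\<Sum>i=1..d. ?m i) \<le> 1 / 2" using d by simp
  have "exp a * \<bar>c 0\<bar> \<le> exp a * (K * (\<Sum>j=1..d. \<bar>c j\<bar>))" using K by (intro mult_left_mono) auto
  also have "\<dots> = K * (\<Sum>j=1..d. \<bar>c j\<bar> * exp a)" by (simp add: sum_distrib_left sum_distrib_right mult_ac)
  also have "\<dots> \<le> K * (\<Sum>j=1..d. ?m j)"
    by (intro mult_left_mono sum_mono K e1) auto
  also have "\<dots> \<le> K * (1 / 2)" using s K by (intro mult_left_mono)
  also have "\<dots> \<le> exp a * (1 / 2)" using K by simp
  finally have c0: "\<bar>c 0\<bar> \<le> 1 / 2" by simp
  have "(\<Sum>i\<le>d. c i * exp (i * t)) = c 0 + (\<Sum>i=1..d. c i * exp (i * t))"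
    by (simp add: atMost_atLeast0 sum.atLeast_Suc_atMost)
  moreover have "\<bar>\<Sum>i=1..d. c i * exp (i * t)\<bar> \<le> (\<Sum>i=1..d. ?m i)"
    using sum_abs[of "\<lambda>i. c i * exp (i * t)" "{1..d}"] by (simp add: abs_mult)
  ultimately have "\<bar>\<Sum>i\<le>d. c i * exp (i * t)\<bar> \<le> pi / 2" using c0 s pi_ge_two by linarith
  then show ?thesis by (intro cos_ge_zero) auto
qed

abbreviation "low j \<equiv> low_window (\<lambda>j. \<bar>c j\<bar>) (1 / (2 * d)) 1 j"

abbreviation "tie j i \<equiv> tie_window (\<lambda>j. \<bar>c j\<bar>) (2 * d\<^sup>2) j i"

text \<open>On an exceptional window the cosine is at least -1, which one indicator pays for; on a
  dominant interval it is kept exactly, so that its oscillation can be used; elsewhere it is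
  nonnegative. The windows are not cut down to \<open>{a..T}\<close>, which only lowers the
  minorant.\<close>

lemma cos_minorant:
  fixes t :: real
  assumes K: "\<bar>c 0\<bar> \<le> K * (\<Sum>j=1..d. \<bar>c j\<bar>)" "K \<le> exp a" "K \<ge> 0" and a: "0 \<le> a"
  shows "(\<Sum>j=1..d. indicator (dominant j) t * cos (\<Sum>i\<le>d. c i * exp (i * t))) -
      (\<Sum>j=1..d. indicator (low j) t) -
      (\<Sum>j=1..d. \<Sum>i\<in>{1..d} - {j}. indicator (tie j i) t)
    \<le> indicator {a..T} t * cos (\<Sum>i\<le>d. c i * exp (i * t))" (is "?D - ?L - ?V \<le> _")
proof -
  let ?h = "\<Sum>i\<le>d. c i * exp (i * t)"
  have L0: "?L \<ge> 0" and V0: "?V \<ge> 0" by (intro sum_nonneg; simp)+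
  show ?thesis
  proof (cases "\<exists>j\<in>{1..d}. t \<in> dominant j")
    case True
    then obtain j where j: "j \<in> {1..d}" "t \<in> dominant j" by blast
    have "?D = indicator (dominant j) t * cos ?h + (\<Sum>i\<in>{1..d} - {j}. indicator (dominant i) t * cos ?h)"
      using j by (subst sum.remove[of _ j]) auto
    also have "(\<Sum>i\<in>{1..d} - {j}. indicator (dominant i) t * cos ?h) = 0"
    proof (intro sum.neutral ballI)
      fix i assume "i \<in> {1..d} - {j}"
      then have "t \<notin> dominant i" using dominant_disjoint[of t i j] j by blast
      then show "indicator (dominant i) t * cos ?h = 0" by simp
    qed
    also have "indicator (dominant j) t * cos ?h + 0 = indicator {a..T} t * cos ?h"
      using j by (auto simp: dominant_def indicator_def)
    finally show ?thesis using L0 V0 by linarith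
  next
    case nodom: False
    then have D0: "?D = 0" by (intro sum.neutral) (auto simp: indicator_def)
    show ?thesis
    proof (cases "t \<in> {a..T}")
      case False
      then have "indicator {a..T} t * cos ?h = 0" by simp
      then show ?thesis using D0 L0 V0 by linarith
    next
      case True
      have "1 \<le> d\<^sup>2" using d by (rule one_le_power)
      then have "1 \<le> 2 * d\<^sup>2" by linarith
      then have d1: "1 \<le> real (2 * d\<^sup>2)" by (simp only: real_of_nat_ge_one_iff)
      have d2: "1 / real (2 * d) \<le> 1" "0 < 1 / real (2 * d)" using d by simp_all
      have L1: "1 \<le> ?L" if "j \<in> {1..d}" "t \<in> low j" for j
        using that member_le_sum[of j "{1..d}" "\<lambda>j. indicator (low j) t :: real"] by auto
      have V1: "1 \<le> ?V" if "j \<in> {1..d}" "i \<in> {1..d} - {j}" "t \<in> tie j i" for i j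
      proof -
        have "1 \<le> (\<Sum>i\<in>{1..d} - {j}. indicator (tie j i) t :: real)"
          using that member_le_sum[of i "{1..d} - {j}" "\<lambda>i. indicator (tie j i) t :: real"] by auto
        also have "\<dots> \<le> ?V"
          using that by (intro member_le_sum[of j "{1..d}" "\<lambda>j. \<Sum>i\<in>{1..d} - {j}. indicator (tie j i) t :: real"] sum_nonneg) auto
        finally show ?thesis .
      qed
      have c: "cos ?h \<ge> -1" "indicator {a..T} t * cos ?h = cos ?h" using True by simp_all
      show ?thesis
      proof (rule dominant_term_cases[OF d, of "\<lambda>j. \<bar>c j\<bar>" "1 / (2 * d)" 1 "2 * d\<^sup>2" t])
        fix j assume "j \<in> {1..d}" "t \<in> low j"
        then show ?thesis using L1[of j] V0 c unfolding D0 by linarith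
      next
        fix j i assume "j \<in> {1..d}" "i \<in> {1..d} - {j}" "t \<in> tie j i"
        then show ?thesis using V1[of j i] L0 c unfolding D0 by linarith
      next
        assume "\<And>j. j \<in> {1..d} \<Longrightarrow> \<bar>c j\<bar> * exp (j * t) < 1 / (2 * d)"
        then have "0 \<le> cos ?h" using cos_nonneg_if_small[OF K a, of t] True by simp
        then show ?thesis using V0 L0 c unfolding D0 by linarith
      next
        fix j assume "j \<in> {1..d}" "1 \<le> \<bar>c j\<bar> * exp (j * t)"
          "\<And>i. i \<in> {1..d} - {j} \<Longrightarrow> 2 * d\<^sup>2 * (\<bar>c i\<bar> * exp (i * t)) \<le> \<bar>c j\<bar> * exp (j * t)"
        then have "t \<in> dominant j" using True by (auto simp: dominant_iff)
        then show ?thesis using nodom \<open>j \<in> {1..d}\<close> by blast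
      qed (use d1 d2 in \<open>simp_all only: abs_ge_zero order.refl\<close>)
    qed
  qed
qed

text \<open>The three summands account for \<open>d\<close> dominant intervals, for \<open>d\<close>
  low windows of measure at most \<open>ln (2 * d)\<close>, and for at most \<open>d\<^sup>2\<close>
  tie windows of measure at most \<open>ln (2 * d\<^sup>2)\<close>. The bound depends on
  \<open>d\<close> only, not on the coefficients or on \<open>a\<close> and
  \<open>T\<close>.\<close>

lemma integral_cos_ge:
  assumes K: "\<bar>c 0\<bar> \<le> K * (\<Sum>j=1..d. \<bar>c j\<bar>)" "K \<le> exp a" "K \<ge> 0" and a: "0 \<le> a"
  shows "- (d * (4 + 4 * (real (d + 1) * d\<^sup>2)) + d * ln (2 * d) + d * (d * ln (2 * d\<^sup>2)))
    \<le> (LBINT t:{a..T}. cos (\<Sum>i\<le>d. c i * exp (real i * t)))"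
proof -
  let ?h = "\<lambda>t::real. \<Sum>i\<le>d. c i * exp (i * t)"
  have "real (d\<^sup>2) \<ge> 1" "real d \<ge> 1" using d by simp_all
  then have "2 * real (d\<^sup>2) \<ge> 1" "2 * real d \<ge> 1" by linarith+
  then have ln2: "ln (2 * real (d\<^sup>2)) \<ge> 0" "ln (2 * real d) \<ge> 0" by (simp_all only: ln_ge_zero)
  have low_j: "low j \<in> sets borel" "emeasure lborel (low j) < \<infinity>" "measure lborel (low j) \<le> ln (2 * d)"
    if "j \<in> {1..d}" for j
    unfolding low_window_def using measure_window[of "real j" "ln (2 * d)"] ln2 that by simp_all
  have tie_ji: "tie j i \<in> sets borel" "emeasure lborel (tie j i) < \<infinity>" "measure lborel (tie j i) \<le> ln (2 * d\<^sup>2)"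
    if "i \<noteq> j" for i j
  proof -
    have "\<bar>real i - real j\<bar> \<ge> 1" using that by (cases i j rule: linorder_cases) auto
    note this ln2(1)
    then show "tie j i \<in> sets borel" "emeasure lborel (tie j i) < \<infinity>" "measure lborel (tie j i) \<le> ln (2 * d\<^sup>2)"
      unfolding tie_window_def by - (rule measure_window; simp)+
  qed
  have cont: "continuous_on A (\<lambda>t. cos (?h t))" for A by (intro continuous_intros)
  have intab: "set_integrable lborel {x..y} (\<lambda>t. cos (?h t))" for x y
    by (rule borel_integrable_atLeastAtMost'[OF cont])
  have intd: "integrable lborel (\<lambda>t. indicator (dominant j) t * cos (?h t))" for j
    using intab dominant_interval[of j] unfolding set_integrable_def by auto
  have intl: "integrable lborel (indicator (low j) :: real \<Rightarrow> real)" if "j \<in> {1..d}" for j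
    using low_j[OF that] by (intro integrable_real_indicator) auto
  have intt: "integrable lborel (indicator (tie j i) :: real \<Rightarrow> real)" if "i \<noteq> j" for i j
    using tie_ji[OF that] by (intro integrable_real_indicator) auto
  let ?D = "\<lambda>t::real. \<Sum>j=1..d. indicator (dominant j) t * cos (?h t)"
  let ?L = "\<lambda>t::real. \<Sum>j=1..d. indicator (low j) t :: real"
  let ?V = "\<lambda>t::real. \<Sum>j=1..d. \<Sum>i\<in>{1..d} - {j}. indicator (tie j i) t :: real"
  have iD: "integrable lborel ?D" and iL: "integrable lborel ?L" and iV: "integrable lborel ?V"
    by (intro Bochner_Integration.integrable_sum intd intl intt; auto)+
  have "(LINT t|lborel. ?D t) = (\<Sum>j=1..d. LBINT t:dominant j. cos (?h t))"
    by (subst Bochner_Integration.integral_sum[OF intd]) (simp add: set_lebesgue_integral_def)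
  also have "\<dots> \<ge> (\<Sum>j=1..d. - (4 + 4 * (real (d + 1) * d\<^sup>2)))"
    using integral_dominant by (intro sum_mono) (smt (verit))
  also have "(\<Sum>j=1..d. - (4 + 4 * (real (d + 1) * d\<^sup>2))) = - (d * (4 + 4 * (real (d + 1) * d\<^sup>2)))"
    by (simp add: algebra_simps)
  finally have D: "- (d * (4 + 4 * (real (d + 1) * d\<^sup>2))) \<le> (LINT t|lborel. ?D t)" .
  have "(LINT t|lborel. ?L t) = (\<Sum>j=1..d. measure lborel (low j))"
    by (subst Bochner_Integration.integral_sum[OF intl]) auto
  also have "\<dots> \<le> (\<Sum>j=1..d. ln (2 * d))" by (intro sum_mono low_j)
  finally have L: "(LINT t|lborel. ?L t) \<le> d * ln (2 * d)" by simp
  have "(LINT t|lborel. ?V t) = (\<Sum>j=1..d. \<Sum>i\<in>{1..d} - {j}. measure lborel (tie j i))"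
  proof (subst Bochner_Integration.integral_sum)
    show "(\<Sum>j=1..d. LINT t|lborel. (\<Sum>i\<in>{1..d} - {j}. indicator (tie j i) t :: real)) =
      (\<Sum>j=1..d. \<Sum>i\<in>{1..d} - {j}. measure lborel (tie j i))"
    proof (rule sum.cong[OF refl])
      fix j assume "j \<in> {1..d}"
      have "(LINT t|lborel. (\<Sum>i\<in>{1..d} - {j}. indicator (tie j i) t :: real)) =
        (\<Sum>i\<in>{1..d} - {j}. LINT t|lborel. indicator (tie j i) t)"
        by (intro Bochner_Integration.integral_sum intt) auto
      then show "(LINT t|lborel. (\<Sum>i\<in>{1..d} - {j}. indicator (tie j i) t :: real)) =
        (\<Sum>i\<in>{1..d} - {j}. measure lborel (tie j i))" by simp
    qed
  qed (intro Bochner_Integration.integrable_sum intt; auto)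
  also have "\<dots> \<le> (\<Sum>j=1..d. \<Sum>i\<in>{1..d} - {j}. ln (2 * d\<^sup>2))" by (intro sum_mono tie_ji) auto
  also have "\<dots> \<le> (\<Sum>j=1..d. d * ln (2 * d\<^sup>2))"
    using ln2 by (intro sum_mono) (auto intro!: mult_right_mono simp: card_Diff_singleton)
  finally have V: "(LINT t|lborel. ?V t) \<le> d * (d * ln (2 * d\<^sup>2))" by simp
  have "(LINT t|lborel. ?D t) - (LINT t|lborel. ?L t) - (LINT t|lborel. ?V t) =
      (LINT t|lborel. ?D t - ?L t - ?V t)"
    using iD iL iV by simp
  also have "\<dots> \<le> (LINT t|lborel. indicator {a..T} t * cos (?h t))"
    using iD iL iV intab[of a T] cos_minorant[OF K a]
    by (intro integral_mono) (auto simp: set_integrable_def)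
  finally show ?thesis using D L V by (simp add: set_lebesgue_integral_def)
qed

end

section \<open>The real case\<close>

definition cos_kernel_coeff :: "nat \<Rightarrow> nat \<Rightarrow> real" where
  "cos_kernel_coeff n k = real ((2 * n) choose k) / 4 ^ n"

text \<open>Binomial expansion of \<open>(cis y + cis (- y)) ^ (2 * n)\<close>. The index is shifted
  by \<open>n\<close>, so the constant term is the one with \<open>k = n\<close>.\<close>

lemma cos_power_expansion:
  "complex_of_real (cos y ^ (2 * n)) = (\<Sum>k<2 * n + 1. cos_kernel_coeff n k * cis (2 * (real k - real n) * y))"
proof -
  have h: "complex_of_real (cos y) = (cis y + cis (- y)) / 2" by (simp add: complex_eq_iff)
  have "complex_of_real (cos y ^ (2 * n)) = (cis y + cis (- y)) ^ (2 * n) / 4 ^ n"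
    unfolding of_real_power h power_divide by (simp add: power_mult)
  also have "(cis y + cis (- y)) ^ (2 * n) = (\<Sum>k\<le>2 * n. of_nat ((2 * n) choose k) * cis y ^ k * cis (- y) ^ (2 * n - k))"
    by (rule binomial_ring)
  also have "\<dots> = (\<Sum>k\<le>2 * n. of_nat ((2 * n) choose k) * cis (2 * (real k - real n) * y))"
  proof (rule sum.cong[OF refl])
    fix k assume "k \<in> {..2 * n}"
    then have e: "real k * y + real (2 * n - k) * - y = 2 * (real k - real n) * y"
      by (simp add: of_nat_diff algebra_simps)
    have "cis y ^ k * cis (- y) ^ (2 * n - k) = cis (real k * y + real (2 * n - k) * - y)"
      by (simp only: Complex.DeMoivre cis_mult)
    then have "cis y ^ k * cis (- y) ^ (2 * n - k) = cis (2 * (real k - real n) * y)" by (simp only: e)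
    then show "of_nat ((2 * n) choose k) * cis y ^ k * cis (- y) ^ (2 * n - k) = of_nat ((2 * n) choose k) * cis (2 * (real k - real n) * y)"
      by (simp add: mult.assoc)
  qed
  finally show ?thesis
    by (simp add: cos_kernel_coeff_def sum_divide_distrib lessThan_Suc_atMost)
qed

lemma cos_power_expansion_real:
  "cos y ^ (2 * n) = (\<Sum>k<2 * n + 1. cos_kernel_coeff n k * cos (2 * (real k - real n) * y))"
proof -
  have "cos y ^ (2 * n) = Re (complex_of_real (cos y ^ (2 * n)))" by simp
  also have "\<dots> = (\<Sum>k<2 * n + 1. cos_kernel_coeff n k * cos (2 * (real k - real n) * y))"
    unfolding cos_power_expansion by simp
  finally show ?thesis .
qed

text \<open>Every term with \<open>k \<noteq> n\<close> completes a whole number of oscillations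
  over the interval, wherever it starts.\<close>

lemma integral_cos_power_period:
  assumes P: "P > 0"
  shows "((\<lambda>t. cos (pi * (t - y) / P) ^ (2 * n)) has_integral P * cos_kernel_coeff n n) {c..c + P}"
proof -
  have one: "((\<lambda>t. cos_kernel_coeff n k * cos (2 * (real k - real n) * (pi * (t - y) / P))) has_integral
      (if k = n then P * cos_kernel_coeff n n else 0)) {c..c + P}" for k
  proof (cases "k = n")
    case True
    have "((\<lambda>t. cos_kernel_coeff n n) has_integral (c + P - c) *\<^sub>R cos_kernel_coeff n n) {c..c + P}"
      using has_integral_const_real[of "cos_kernel_coeff n n" c "c + P"] P by simp
    then show ?thesis using True by simp
  next
    case False
    define \<omega> where "\<omega> = 2 * (real k - real n) * pi / P"
    have \<omega>: "\<omega> \<noteq> 0" using False P by (simp add: \<omega>_def)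
    let ?S = "\<lambda>t. cos_kernel_coeff n k * sin (\<omega> * (t - y)) / \<omega>"
    have "((\<lambda>t. cos_kernel_coeff n k * cos (\<omega> * (t - y))) has_integral (?S (c + P) - ?S c)) {c..c + P}"
      using P \<omega> by (intro fundamental_theorem_of_calculus)
        (auto intro!: derivative_eq_intros simp: has_real_derivative_iff_has_vector_derivative[symmetric])
    moreover have "sin (\<omega> * (c + P - y)) = sin (\<omega> * (c - y))"
    proof -
      have "\<omega> * (c + P - y) = \<omega> * (c - y) + 2 * pi * of_int (int k - int n)"
        using P by (simp add: \<omega>_def field_simps)
      then show ?thesis by (simp only: sin_add cos_int_2pin sin_int_2pin)
    qed
    moreover have "2 * (real k - real n) * (pi * (t - y) / P) = \<omega> * (t - y)" for t
      by (simp add: \<omega>_def)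
    ultimately show ?thesis using False by simp
  qed
  have "((\<lambda>t. \<Sum>k<2 * n + 1. cos_kernel_coeff n k * cos (2 * (real k - real n) * (pi * (t - y) / P))) has_integral
      (\<Sum>k<2 * n + 1. if k = n then P * cos_kernel_coeff n n else 0)) {c..c + P}"
    by (intro has_integral_sum one) simp
  moreover have "(\<Sum>k<2 * n + 1. if k = n then P * cos_kernel_coeff n n else 0) = P * cos_kernel_coeff n n"
    by (subst sum.delta) auto
  ultimately show ?thesis unfolding cos_power_expansion_real by (simp only:)
qed

lemma cos_kernel_coeff_ge: "n > 0 \<Longrightarrow> 1 / (2 * real n) \<le> cos_kernel_coeff n n"
  using central_binomial_lower_bound[of n] by (simp add: cos_kernel_coeff_def field_simps)

text \<open>Nonnegative, of period \<open>P\<close> in each coordinate, with peaks of height 1 on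
  the lattice \<open>P \<int>\<^sup>m\<close> and with nonnegative Fourier coefficients; the latter
  make the spectral weights nonnegative.\<close>

definition cos_kernel :: "real \<Rightarrow> nat \<Rightarrow> real ^ 'm::finite \<Rightarrow> real" where
  "cos_kernel P n x = (\<Prod>i\<in>UNIV. cos (pi * x $ i / P) ^ (2 * n))"

lemma cos_kernel_nonneg: "cos_kernel P n x \<ge> 0"
  unfolding cos_kernel_def by (intro prod_nonneg ballI) (simp add: power_mult)

lemma continuous_on_cos_kernel: "continuous_on A (cos_kernel P n)"
  unfolding cos_kernel_def[abs_def] divide_inverse by (intro continuous_intros)

text \<open>With the same shift as in one dimension, the index function constantly equal to
  \<open>n\<close> is the zero frequency.\<close>

definition cos_freq :: "real \<Rightarrow> nat \<Rightarrow> ('m \<Rightarrow> nat) \<Rightarrow> real ^ 'm::finite" where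
  "cos_freq P n F = (\<chi> i. 2 * pi * (real (F i) - real n) / P)"

lemma cos_kernel_expansion:
  "complex_of_real (cos_kernel P n x) =
     (\<Sum>F\<in>UNIV \<rightarrow>\<^sub>E {..<2 * n + 1}. complex_of_real (\<Prod>i\<in>UNIV. cos_kernel_coeff n (F i)) * cis (cos_freq P n F \<bullet> x))"
proof -
  have cis_sum: "cis (\<Sum>i\<in>A. g i) = (\<Prod>i\<in>A. cis (g i))" if "finite A" for A :: "'b set" and g
    using that by (induction A) (simp_all flip: cis_mult)
  have "complex_of_real (cos_kernel P n x) =
     (\<Prod>i\<in>UNIV. \<Sum>k<2 * n + 1. cos_kernel_coeff n k * cis (2 * (real k - real n) * (pi * x $ i / P)))"
    unfolding cos_kernel_def of_real_prod cos_power_expansion ..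
  also have "\<dots> = (\<Sum>F\<in>UNIV \<rightarrow>\<^sub>E {..<2 * n + 1}. \<Prod>i\<in>UNIV. complex_of_real (cos_kernel_coeff n (F i)) * cis (2 * (real (F i) - real n) * (pi * x $ i / P)))"
    by (rule prod_sum_PiE) auto
  also have "\<dots> = (\<Sum>F\<in>UNIV \<rightarrow>\<^sub>E {..<2 * n + 1}. complex_of_real (\<Prod>i\<in>UNIV. cos_kernel_coeff n (F i)) * cis (cos_freq P n F \<bullet> x))"
  proof (rule sum.cong[OF refl])
    fix F :: "'a \<Rightarrow> nat"
    have "cos_freq P n F \<bullet> x = (\<Sum>i\<in>UNIV. 2 * (real (F i) - real n) * (pi * x $ i / P))"
      by (simp add: inner_vec_def cos_freq_def mult_ac)
    then show "(\<Prod>i\<in>UNIV. complex_of_real (cos_kernel_coeff n (F i)) * cis (2 * (real (F i) - real n) * (pi * x $ i / P))) =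
       complex_of_real (\<Prod>i\<in>UNIV. cos_kernel_coeff n (F i)) * cis (cos_freq P n F \<bullet> x)"
      by (simp add: prod.distrib cis_sum)
  qed
  finally show ?thesis .
qed

lemma nn_integral_lborel_prod_cart:
  fixes g :: "'m::finite \<Rightarrow> real \<Rightarrow> real"
  assumes "\<And>i. g i \<in> borel_measurable borel" "\<And>i t. 0 \<le> g i t"
  shows "(\<integral>\<^sup>+x. ennreal (\<Prod>i\<in>UNIV. g i (x $ i)) \<partial>lborel) = (\<Prod>i\<in>UNIV. \<integral>\<^sup>+t. ennreal (g i t) \<partial>lborel)"
proof -
  \<comment> \<open>The product formula is indexed by basis vectors; \<open>h\<close> recovers the
    coordinate from the axis vector.\<close>
  define h where "h b = g (THE i. b = axis i (1::real))" for b :: "real ^ 'm"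
  have h: "h (axis i 1) = g i" for i
    unfolding h_def by (rule arg_cong[where f = g]) (auto simp: axis_eq_axis)
  have B: "(Basis :: (real ^ 'm) set) = range (\<lambda>i. axis i 1)" by (auto simp: Basis_vec_def)
  have inj: "inj (\<lambda>i. axis i (1::real) :: real ^ 'm)" by (auto simp: inj_def axis_eq_axis)
  have 1: "(\<Prod>b\<in>Basis. ennreal (h b (x \<bullet> b))) = ennreal (\<Prod>i\<in>UNIV. g i (x $ i))" for x :: "real ^ 'm"
    unfolding B by (simp add: prod.reindex[OF inj] h inner_axis prod_ennreal assms(2))
  have "(\<integral>\<^sup>+x. (\<Prod>b\<in>Basis. ennreal (h b (x \<bullet> b))) \<partial>(lborel :: (real ^ 'm) measure)) = (\<Prod>b\<in>Basis. \<integral>\<^sup>+t. ennreal (h b t) \<partial>lborel)"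
  proof (rule nn_integral_lborel_prod)
    fix b :: "real ^ 'm" assume "b \<in> Basis"
    show "(\<lambda>t. ennreal (h b t)) \<in> borel_measurable borel"
      unfolding h_def by (intro measurable_compose[OF assms(1) measurable_ennreal])
  qed simp
  then show ?thesis unfolding 1 unfolding B by (simp add: prod.reindex[OF inj] h)
qed

text \<open>Each coordinate of \<open>J\<close> runs through an interval of length
  \<open>2 * r \<le> P\<close>. Enlarging it to a full period gives a product of one-dimensional
  integrals whose values do not depend on the translation \<open>y\<close>.\<close>

lemma integral_cos_kernel_le:
  fixes y :: "real ^ 'm::finite"
  assumes P: "P > 0" "2 * r \<le> P" and J: "J \<in> sets borel" "\<And>x i. x \<in> J \<Longrightarrow> \<bar>x $ i\<bar> \<le> r"
  shows "(LINT x:J|lborel. cos_kernel P n (x - y)) \<le> (P * cos_kernel_coeff n n) ^ CARD('m)"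
proof -
  let ?g = "\<lambda>i t. indicator {-r..-r + P} t * cos (pi * (t - y $ i) / P) ^ (2 * n) :: real"
  have nn: "0 \<le> ?g i t" for i t by (simp add: power_mult)
  have c0: "0 \<le> P * cos_kernel_coeff n n" using P by (simp add: cos_kernel_coeff_def)
  have "(\<integral>\<^sup>+x. ennreal (indicator J x * cos_kernel P n (x - y)) \<partial>lborel) \<le> (\<integral>\<^sup>+x. ennreal (\<Prod>i\<in>UNIV. ?g i (x $ i)) \<partial>lborel)"
  proof (intro nn_integral_mono ennreal_leI)
    fix x :: "real ^ 'm"
    show "indicator J x * cos_kernel P n (x - y) \<le> (\<Prod>i\<in>UNIV. ?g i (x $ i))"
    proof (cases "x \<in> J")
      case True
      have "?g i (x $ i) = cos (pi * (x - y) $ i / P) ^ (2 * n)" for i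
        using J(2)[OF True, of i] P(2) by (auto simp: indicator_def abs_le_iff)
      then have "(\<Prod>i\<in>UNIV. ?g i (x $ i)) = cos_kernel P n (x - y)" unfolding cos_kernel_def by (intro prod.cong refl)
      then show ?thesis using True by simp
    next
      case False
      then show ?thesis using nn by (simp add: prod_nonneg)
    qed
  qed
  also have "\<dots> = (\<Prod>i\<in>UNIV. \<integral>\<^sup>+t. ennreal (?g i t) \<partial>lborel)"
    by (intro nn_integral_lborel_prod_cart nn) measurable
  also have "\<dots> = (\<Prod>i\<in>(UNIV::'m set). ennreal (P * cos_kernel_coeff n n))"
  proof (rule prod.cong[OF refl])
    fix i
    have "((\<lambda>t. cos (pi * (t - y $ i) / P) ^ (2 * n)) has_integral P * cos_kernel_coeff n n) {-r..-r + P}"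
      by (rule integral_cos_power_period[OF P(1)])
    from nn_integral_has_integral_lebesgue[OF _ this]
    show "(\<integral>\<^sup>+t. ennreal (?g i t) \<partial>lborel) = ennreal (P * cos_kernel_coeff n n)"
      by (simp add: power_mult)
  qed
  also have "\<dots> = ennreal ((P * cos_kernel_coeff n n) ^ CARD('m))"
    using c0 by (simp add: ennreal_power)
  finally have le: "(\<integral>\<^sup>+x. ennreal (indicator J x * cos_kernel P n (x - y)) \<partial>lborel) \<le> ennreal ((P * cos_kernel_coeff n n) ^ CARD('m))" .
  have "(LINT x:J|lborel. cos_kernel P n (x - y)) = enn2real (\<integral>\<^sup>+x. ennreal (indicator J x * cos_kernel P n (x - y)) \<partial>lborel)"
  proof -
    have m: "(\<lambda>x. cos_kernel P n (x - y)) \<in> borel_measurable borel"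
      by (intro borel_measurable_continuous_onI continuous_on_compose2[OF continuous_on_cos_kernel[of UNIV]] continuous_intros) auto
    show ?thesis unfolding set_lebesgue_integral_def real_scaleR_def
      using m J(1) by (intro integral_eq_nn_integral) (auto simp: cos_kernel_nonneg)
  qed
  also have "\<dots> \<le> (P * cos_kernel_coeff n n) ^ CARD('m)"
    using enn2real_mono[OF le] c0 by simp
  finally show ?thesis .
qed

text \<open>
  The constant coefficient of the kernel decays only polynomially in \<open>n\<close>, whereas the kernel itself
  decays exponentially away from the lattice \<open>P \<int>\<^sup>m\<close>.
\<close>

lemma cos_kernel_small:
  assumes P: "P > 0" and \<delta>: "\<delta> > 0"
  obtains n where "n > 0" "\<And>z :: real ^ 'm::finite. (\<And>i. \<bar>z $ i\<bar> \<le> P / 2) \<Longrightarrow> \<delta> \<le> norm z \<Longrightarrow>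
      cos_kernel P n z \<le> cos_kernel_coeff n n ^ CARD('m) / 2"
proof -
  \<comment> \<open>A vector of norm at least \<delta> has a coordinate of size at least
    \<open>\<delta> / CARD('m)\<close>. The cap \<open>P / 2\<close> keeps the angle where the
    cosine is nonnegative and decreasing.\<close>
  define \<delta>' where "\<delta>' = min (P / 2) (\<delta> / CARD('m))"
  have \<delta>': "\<delta>' > 0" "\<delta>' \<le> P / 2"
  proof -
    show "\<delta>' > 0" using P \<delta> by (simp add: \<delta>'_def)
    show "\<delta>' \<le> P / 2" unfolding \<delta>'_def by (rule min.cobounded1)
  qed
  define q where "q = (cos (pi * \<delta>' / P))\<^sup>2"
  have ang: "0 < pi * \<delta>' / P" "pi * \<delta>' / P \<le> pi / 2" using \<delta>' P by (simp_all add: pos_divide_le_eq)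
  have c0: "0 \<le> cos (pi * \<delta>' / P)" using ang by (intro cos_ge_zero) auto
  have "pi * \<delta>' / P \<le> pi" using ang pi_gt_zero by linarith
  then have "cos (pi * \<delta>' / P) < cos 0" by (rule cos_monotone_0_pi[OF order.refl ang(1)])
  then have q: "0 \<le> q" "q < 1" using c0 by (auto simp: q_def power_less_one_iff abs_square_less_1)
  \<comment> \<open>With this root, \<open>q ^ n = (s ^ n) ^ CARD('m)\<close> can be compared with
    the \<open>CARD('m)\<close>-th power of \<open>1 / (2 * n)\<close>, the lower bound for the
    constant coefficient; it remains to use that \<open>n * s ^ n\<close> tends to 0.\<close>
  define s where "s = root (CARD('m)) q"
  have s: "0 \<le> s" "s < 1" "s ^ CARD('m) = q"
    using q by (auto simp: s_def real_root_pow_pos2)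
  have "(\<lambda>n. of_nat n * s ^ n) \<longlonglongrightarrow> 0" using s by (intro powser_times_n_limit_0) simp
  then have "(\<lambda>n. real n * s ^ n) \<longlonglongrightarrow> 0" by simp
  then have "(\<lambda>n. 2 * (2 * (real n * s ^ n)) ^ CARD('m)) \<longlonglongrightarrow> 2 * (2 * 0) ^ CARD('m)" by (intro tendsto_intros)
  moreover have "2 * (2 * 0) ^ CARD('m) = (0::real)" by simp
  ultimately have "(\<lambda>n. 2 * (2 * (real n * s ^ n)) ^ CARD('m)) \<longlonglongrightarrow> 0" by (simp only:)
  then have "eventually (\<lambda>n. 2 * (2 * (real n * s ^ n)) ^ CARD('m) < 1) sequentially"
    by (rule order_tendstoD) simp
  then have ev: "eventually (\<lambda>n. n > 0 \<and> 2 * (2 * (real n * s ^ n)) ^ CARD('m) < 1) sequentially"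
    using eventually_gt_at_top[of 0] by eventually_elim simp
  obtain n where n: "n > 0" "2 * (2 * (real n * s ^ n)) ^ CARD('m) < 1"
    using eventually_happens'[OF sequentially_bot ev] by blast
  show ?thesis
  proof (rule that[OF n(1)])
    fix z :: "real ^ 'm" assume z: "\<And>i. \<bar>z $ i\<bar> \<le> P / 2" "\<delta> \<le> norm z"
    have "\<exists>i. \<delta>' \<le> \<bar>z $ i\<bar>"
    proof (rule ccontr)
      assume "\<not> ?thesis"
      then have "\<bar>z $ i\<bar> < \<delta>'" for i by (simp add: not_le)
      then have lt: "\<bar>z $ i\<bar> < \<delta> / CARD('m)" for i by (simp add: \<delta>'_def)
      have "norm z \<le> (\<Sum>i\<in>UNIV. \<bar>z $ i\<bar>)" by (rule norm_le_l1_cart)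
      also have "\<dots> < (\<Sum>i\<in>(UNIV :: 'm set). \<delta> / CARD('m))" using lt by (intro sum_strict_mono) auto
      finally show False using z(2) by simp
    qed
    then obtain i where i: "\<delta>' \<le> \<bar>z $ i\<bar>" by blast
    have le1: "cos (pi * z $ j / P) ^ (2 * n) \<le> 1" for j
    proof -
      have "(cos (pi * z $ j / P))\<^sup>2 \<le> 1" by (simp add: abs_square_le_1)
      then show ?thesis unfolding power_mult by (rule power_le_one[OF zero_le_power2])
    qed
    have "cos (pi * z $ i / P) = cos (pi * \<bar>z $ i\<bar> / P)" by (cases "z $ i \<ge> 0") (simp_all add: abs_if)
    also have "\<dots> \<le> cos (pi * \<delta>' / P)"
      using i z(1)[of i] \<delta>' P by (intro cos_monotone_0_pi_le) (auto simp: field_simps)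
    finally have "cos (pi * z $ i / P) \<le> cos (pi * \<delta>' / P)" .
    moreover have "0 \<le> cos (pi * z $ i / P)"
    proof (rule cos_ge_zero)
      have "\<bar>pi * z $ i / P\<bar> \<le> pi / 2"
        using z(1)[of i] P by (simp add: abs_mult field_simps)
      then show "- (pi / 2) \<le> pi * z $ i / P" "pi * z $ i / P \<le> pi / 2" by linarith+
    qed
    ultimately have "(cos (pi * z $ i / P))\<^sup>2 \<le> q" unfolding q_def by (intro power_mono) auto
    then have qi: "cos (pi * z $ i / P) ^ (2 * n) \<le> q ^ n" unfolding power_mult by (intro power_mono) auto
    have "cos_kernel P n z = cos (pi * z $ i / P) ^ (2 * n) * (\<Prod>j\<in>UNIV - {i}. cos (pi * z $ j / P) ^ (2 * n))"
      unfolding cos_kernel_def by (rule prod.remove) auto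
    also have "\<dots> \<le> q ^ n * 1"
    proof (intro mult_mono qi prod_le_1)
      show "0 \<le> (\<Prod>j\<in>UNIV - {i}. cos (pi * z $ j / P) ^ (2 * n))"
        by (intro prod_nonneg ballI) (simp add: power_mult)
    qed (use q le1 in \<open>simp_all add: zero_le_even_power\<close>)
    also have "\<dots> = (s ^ n) ^ CARD('m)" using s(3) by (simp add: power_mult[symmetric] mult.commute) (metis power_mult mult.commute)
    also have "\<dots> \<le> (1 / (2 * real n)) ^ CARD('m) / 2"
    proof -
      have "2 * ((s ^ n) * (2 * real n)) ^ CARD('m) \<le> 1" using n(2) by (simp add: mult_ac)
      then have "2 * ((s ^ n) ^ CARD('m) * (2 * real n) ^ CARD('m)) \<le> 1" by (simp add: power_mult_distrib mult_ac)
      then show ?thesis using n(1) by (simp add: power_divide field_simps)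
    qed
    also have "\<dots> \<le> cos_kernel_coeff n n ^ CARD('m) / 2"
      using cos_kernel_coeff_ge[OF n(1)] n(1) by (intro divide_right_mono power_mono) auto
    finally show "cos_kernel P n z \<le> cos_kernel_coeff n n ^ CARD('m) / 2" .
  qed
qed

text \<open>A periodic colouring by cells of side \<open>h\<close>, with cell indices taken modulo
  \<open>Q\<close>. Two points of one colour either share a cell and are closer than \<delta>, or
  their indices differ by at least \<open>Q\<close> in some coordinate and they are farther apart
  than \<rho>.\<close>

lemma real_independence_ratio_pos:
  fixes S :: "(real ^ 'm::finite) set"
  assumes \<delta>: "\<delta> > 0" and S: "\<And>v. v \<in> S \<Longrightarrow> \<delta> \<le> norm v" "\<And>v. v \<in> S \<Longrightarrow> norm v \<le> \<rho>"
  shows "0 < real_independence_ratio (cayley_graph S)"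
proof -
  define h where "h = \<delta> / CARD('m)"
  have h: "h > 0" using \<delta> by (simp add: h_def)
  \<comment> \<open>The absolute value covers a negative \<rho>, possible when \<open>S\<close> is
    empty; the successor makes up for the one cell lost in passing from index differences to
    distances.\<close>
  define Q where "Q = Suc (nat \<lceil>\<bar>\<rho>\<bar> / h\<rceil>)"
  have Q: "\<rho> \<le> (real Q - 1) * h"
  proof -
    have "\<bar>\<rho>\<bar> / h \<le> real Q - 1" by (simp add: Q_def) linarith
    then show ?thesis using h by (simp add: field_simps)
  qed
  define A :: "('m \<Rightarrow> nat) \<Rightarrow> (real ^ 'm) set" where "A F = {x. \<forall>i. \<lfloor>x $ i / h\<rfloor> mod int Q = int (F i)}" for F
  have "borel_independent (cayley_graph S) (A F)" for F
    unfolding borel_independent_def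
  proof (intro conjI ballI notI)
    have eq: "A F = (\<Inter>i. (\<lambda>x. \<lfloor>x $ i / h\<rfloor>) -` {k. k mod int Q = int (F i)} \<inter> space borel)" by (auto simp: A_def)
    have "(\<lambda>x :: real ^ 'm. \<lfloor>x $ i / h\<rfloor>) \<in> measurable borel (count_space UNIV)" for i
      by (intro measurable_compose[OF _ measurable_real_floor] borel_measurable_continuous_onI continuous_intros) (use h in auto)
    then show "A F \<in> sets borel" unfolding eq by (intro sets.countable_INT' measurable_sets) auto
    fix x y assume x: "x \<in> A F" and y: "y \<in> A F" and "(x, y) \<in> cayley_graph S"
    then have xy: "x - y \<in> S" by (simp add: cayley_graph_def)
    show False
    proof (cases "\<forall>i. \<lfloor>x $ i / h\<rfloor> = \<lfloor>y $ i / h\<rfloor>")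
      case True
      have lt: "\<bar>(x - y) $ i\<bar> < h" for i
      proof -
        have "\<bar>x $ i / h - y $ i / h\<bar> < 1" using True[rule_format, of i] by linarith
        then show ?thesis using h by (simp add: diff_divide_distrib[symmetric] abs_divide)
      qed
      have "norm (x - y) \<le> (\<Sum>i\<in>UNIV. \<bar>(x - y) $ i\<bar>)" by (rule norm_le_l1_cart)
      also have "\<dots> < (\<Sum>i\<in>(UNIV :: 'm set). h)" using lt by (intro sum_strict_mono) auto
      also have "\<dots> = \<delta>" by (simp add: h_def)
      finally show False using S(1)[OF xy] by simp
    next
      case False
      then obtain i where i: "\<lfloor>x $ i / h\<rfloor> \<noteq> \<lfloor>y $ i / h\<rfloor>" by blast
      have "\<lfloor>x $ i / h\<rfloor> mod int Q = \<lfloor>y $ i / h\<rfloor> mod int Q" using x y by (simp add: A_def)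
      then have "int Q dvd \<lfloor>x $ i / h\<rfloor> - \<lfloor>y $ i / h\<rfloor>" by (rule mod_eq_dvd_iff[THEN iffD1])
      then have "\<bar>int Q\<bar> \<le> \<bar>\<lfloor>x $ i / h\<rfloor> - \<lfloor>y $ i / h\<rfloor>\<bar>" using i by (intro dvd_imp_le_int) auto
      then have "real Q - 1 < \<bar>x $ i / h - y $ i / h\<bar>" by linarith
      then have "(real Q - 1) * h < \<bar>(x - y) $ i\<bar>" using h by (simp add: diff_divide_distrib[symmetric] abs_divide pos_less_divide_eq)
      also have "\<dots> \<le> norm (x - y)" by (rule component_le_norm_cart)
      finally show False using Q S(2)[OF xy] by linarith
    qed
  qed
  moreover have "(\<Union>F\<in>UNIV \<rightarrow>\<^sub>E {..<Q}. A F) = UNIV"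
  proof (intro equalityI subsetI UNIV_I)
    fix x :: "real ^ 'm"
    have "Q > 0" by (simp add: Q_def)
    then have "(\<lambda>i. nat (\<lfloor>x $ i / h\<rfloor> mod int Q)) \<in> UNIV \<rightarrow>\<^sub>E {..<Q}" by (auto simp: nat_less_iff)
    moreover have "x \<in> A (\<lambda>i. nat (\<lfloor>x $ i / h\<rfloor> mod int Q))" using \<open>Q > 0\<close> by (simp add: A_def)
    ultimately show "x \<in> (\<Union>F\<in>UNIV \<rightarrow>\<^sub>E {..<Q}. A F)" by (rule UN_I[where B = A])
  qed
  ultimately show ?thesis
    unfolding real_independence_ratio_def
  proof (intro independence_ratio_pos[where F = "UNIV \<rightarrow>\<^sub>E {..<Q}" and A = A] finite_residue_functions)
    show "eventually (\<lambda>r. {x :: real ^ 'm. norm x \<le> r} \<in> sets borel \<and>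
        emeasure lborel {x :: real ^ 'm. norm x \<le> r} < \<infinity> \<and> 0 < measure lborel {x :: real ^ 'm. norm x \<le> r}) at_top"
      using eventually_gt_at_top[of "0::real"]
    proof eventually_elim
      case (elim r)
      have eq: "{x :: real ^ 'm. norm x \<le> r} = cball 0 r" by (auto simp: dist_norm)
      show ?case unfolding eq using elim emeasure_bounded_finite[of "cball (0 :: real ^ 'm) r"] content_cball_pos[of r 0]
        by auto
    qed
  qed auto
qed

section \<open>The density bound over the reals\<close>

lemma measure_cube_le_cball:
  assumes "r > 0"
  shows "(2 * r / CARD('m)) ^ CARD('m) \<le> measure lborel {x :: real ^ 'm::finite. norm x \<le> r}"
proof -
  let ?u = "\<chi> i. r / CARD('m) :: real ^ 'm"
  have ne: "cbox (- ?u) ?u \<noteq> {}" using assms by (auto simp: interval_ne_empty_cart)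
  have "measure lborel (cbox (- ?u) ?u) = (\<Prod>i\<in>(UNIV :: 'm set). 2 * r / CARD('m))"
    by (subst content_cbox_cart[OF ne]) (simp add: field_simps)
  then have "(2 * r / CARD('m)) ^ CARD('m) = measure lborel (cbox (- ?u) ?u)" by simp
  also have "\<dots> \<le> measure lborel (cball (0 :: real ^ 'm) r)"
  proof (intro measure_mono_fmeasurable)
    show "cbox (- ?u) ?u \<subseteq> cball 0 r"
    proof
      fix x assume x: "x \<in> cbox (- ?u) ?u"
      have "norm x \<le> (\<Sum>i\<in>UNIV. \<bar>x $ i\<bar>)" by (rule norm_le_l1_cart)
      also have "\<dots> \<le> (\<Sum>i\<in>(UNIV :: 'm set). r / CARD('m))" using x by (intro sum_mono) (auto simp: mem_box_cart abs_le_iff minus_le_iff)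
      finally show "x \<in> cball 0 r" by simp
    qed
  qed (use emeasure_bounded_finite[OF bounded_cball[of "0 :: real ^ 'm" r]] in \<open>auto simp: fmeasurable_def\<close>)
  also have "cball (0 :: real ^ 'm) r = {x. norm x \<le> r}" by (auto simp: dist_norm)
  finally show ?thesis .
qed

lemma poly_exp_eq_sum:
  fixes t :: real
  assumes "Polynomial.degree p \<le> d"
  shows "poly p (exp t) = (\<Sum>i\<le>d. Polynomial.coeff p i * exp (real i * t))"
proof -
  have "poly p (exp t) = (\<Sum>i\<le>d. Polynomial.coeff p i * exp t ^ i)"
    unfolding poly_altdef using assms by (intro sum.mono_neutral_left) (auto simp: coeff_eq_0)
  then show ?thesis by (simp add: exp_of_nat_mult)
qed

text \<open>Let \<beta> be the constant Fourier coefficient of the kernel. The trivial weight is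
  \<open>\<beta> |J|\<^sup>2\<close>, the total weight at most \<open>\<beta> P\<^sup>m |J|\<close>,
  and the error along the curve at most \<open>\<beta> |J|\<^sup>2 / 2\<close>. Averaging gives
  \<open>\<beta> |J|\<^sup>2 (T - a) - C \<beta> P\<^sup>m |J| \<le> \<beta> |J|\<^sup>2 (T - a) /
  2\<close>. The exponent \<open>n\<close>, which depends on \<open>J\<close>, enters through
  \<beta> only and cancels.\<close>

lemma real_independent_bound:
  fixes f :: "'m::finite \<Rightarrow> real poly" and I :: "(real ^ 'm) set"
  assumes d: "d \<ge> 1" "\<And>i. Polynomial.degree (f i) \<le> d"
    and g: "\<And>\<theta>. Polynomial.coeff (dot_poly f \<theta>) 0 = (\<Sum>j=1..d. g j * Polynomial.coeff (dot_poly f \<theta>) j)"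
    and a: "a \<ge> 0" "(\<Sum>j=1..d. \<bar>g j\<bar>) \<le> exp a" "a < T"
    and nz: "\<And>s. exp a \<le> \<bar>s\<bar> \<Longrightarrow> poly_curve f s \<noteq> 0"
    and I: "borel_independent (cayley_graph (curve_set abs f (exp a) (exp T))) I"
    and r: "r > 0" "\<And>s. exp a \<le> \<bar>s\<bar> \<Longrightarrow> \<bar>s\<bar> \<le> exp T \<Longrightarrow> norm (poly_curve f s) \<le> r"
  defines "C \<equiv> real d * (4 + 4 * (real (d + 1) * (real d)\<^sup>2)) + real d * ln (2 * real d) +
    real d * (real d * ln (2 * (real d)\<^sup>2))"
  shows "measure lborel (I \<inter> {x. norm x \<le> r}) \<le>
    4 * C * (3 * CARD('m)) ^ CARD('m) / (T - a) * measure lborel {x :: real ^ 'm. norm x \<le> r}"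
proof -
  let ?M = "lborel :: (real ^ 'm) measure" and ?B = "{x :: real ^ 'm. norm x \<le> r}"
  have Beq: "?B = cball 0 r" by (auto simp: dist_norm)
  \<comment> \<open>The positive half \<open>s = exp t\<close> of the parameter range is enough for
    the upper bound; in this variable \<open>ds / |s|\<close> is Lebesgue measure.\<close>
  define D where "D = (\<lambda>t. poly_curve f (exp t)) ` {a..T}"
  have C0: "C \<ge> 0"
  proof -
    have "1 \<le> (real d)\<^sup>2" "1 \<le> real d" using d(1) by (simp_all add: one_le_power)
    then have "1 \<le> 2 * (real d)\<^sup>2" "1 \<le> 2 * real d" by linarith+
    then have "ln (2 * (real d)\<^sup>2) \<ge> 0" "ln (2 * real d) \<ge> 0" by (simp_all only: ln_ge_zero)
    then show ?thesis unfolding C_def by (intro add_nonneg_nonneg mult_nonneg_nonneg) auto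
  qed
  have contD: "continuous_on A (\<lambda>t. poly_curve f (exp t))" for A
    unfolding poly_curve_def by (intro continuous_on_vec_lambda continuous_intros)
  have compactD: "compact D" unfolding D_def by (intro compact_continuous_image contD compact_Icc)
  have Ib: "I \<in> sets borel" using I by (simp add: borel_independent_def)
  have Bb: "?B \<in> sets borel" "emeasure ?M ?B < \<infinity>" unfolding Beq
    using emeasure_bounded_finite[OF bounded_cball[of "0 :: real ^ 'm" r]] by simp_all
  have "emeasure ?M (I \<inter> ?B) \<le> emeasure ?M ?B" using Ib Bb by (intro emeasure_mono) auto
  then have IB: "I \<inter> ?B \<in> sets borel" "emeasure ?M (I \<inter> ?B) < \<infinity>" using Ib Bb by auto
  obtain J where J: "compact J" "J \<subseteq> I \<inter> ?B" "measure ?M (I \<inter> ?B) / 2 \<le> measure ?M J"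
    by (rule compact_subset_half_measure[OF sets_lborel IB])
  have Jb: "J \<in> sets ?M" using J(1) by (simp add: borel_compact)
  have Jf: "emeasure ?M J < \<infinity>" by (rule emeasure_bounded_finite[OF compact_imp_bounded[OF J(1)]])
  have Jr: "norm x \<le> r" if "x \<in> J" for x using that J(2) by blast
  have Dr: "norm v \<le> r" if "v \<in> D" for v
    using that unfolding D_def by (auto intro!: r(2))
  have "x - y + v \<noteq> 0" if xyv: "x \<in> J" "y \<in> J" "v \<in> D" for x y v
  proof
    assume "x - y + v = 0"
    then have v: "v = y - x" by (simp add: algebra_simps eq_neg_iff_add_eq_0)
    obtain t where t: "a \<le> t" "t \<le> T" "v = poly_curve f (exp t)" using xyv(3) by (auto simp: D_def)
    have "v \<in> curve_set abs f (exp a) (exp T)"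
      using t(1,2) nz[of "exp t"] unfolding curve_set_def t(3) by (intro CollectI conjI exI[of _ "exp t"]) auto
    then have "(y, x) \<in> cayley_graph (curve_set abs f (exp a) (exp T))" by (simp add: cayley_graph_def v)
    then show False using I xyv J(2) unfolding borel_independent_def by blast
  qed
  moreover define Z where "Z = (\<lambda>(x, v). x + v) ` ({x - y |x y. x \<in> J \<and> y \<in> J} \<times> D)"
  ultimately have "0 \<notin> Z" unfolding Z_def by force
  have "compact Z" unfolding Z_def case_prod_beta
    by (intro compact_continuous_image continuous_intros compact_Times compactD compact_differences J(1))
  then have "closed Z" by (rule compact_imp_closed)
  then have "open (- Z)" by (rule open_Compl)
  then obtain \<delta> where "\<delta> > 0" "ball 0 \<delta> \<subseteq> - Z" using \<open>0 \<notin> Z\<close> by (elim openE) auto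
  then have \<delta>: "\<delta> > 0" "ball 0 \<delta> \<inter> Z = {}" by auto
  have off: "\<delta> \<le> norm (x - y + v)" if "x \<in> J" "y \<in> J" "v \<in> D" for x y v
  proof -
    have "x - y + v \<in> Z" unfolding Z_def using that by (intro image_eqI[of _ _ "(x - y, v)"]) auto
    then have "x - y + v \<notin> ball 0 \<delta>" using \<delta>(2) by blast
    then show ?thesis by simp
  qed
  \<comment> \<open>The points \<open>x - y + v\<close> have norm at most \<open>3 * r\<close>, half
    of this period, so among the peaks of the kernel only the one at 0 could matter.\<close>
  define P where "P = 6 * r"
  have P: "P > 0" "2 * r \<le> P" using r by (auto simp: P_def)
  obtain n where n: "n > 0" "\<And>z :: real ^ 'm. (\<And>i. \<bar>z $ i\<bar> \<le> P / 2) \<Longrightarrow> \<delta> \<le> norm z \<Longrightarrow>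
      cos_kernel P n z \<le> cos_kernel_coeff n n ^ CARD('m) / 2"
    by (rule cos_kernel_small[OF P(1) \<delta>(1), where 'm='m]) blast
  define \<beta> where "\<beta> = cos_kernel_coeff n n ^ CARD('m)"
  have \<beta>: "\<beta> > 0" unfolding \<beta>_def cos_kernel_coeff_def by (intro zero_less_power divide_pos_pos) auto
  define \<Xi> where "\<Xi> = (UNIV \<rightarrow>\<^sub>E {..<2 * n + 1} :: ('m \<Rightarrow> nat) set)"
  define \<phi> where "\<phi> F x = cis (cos_freq P n F \<bullet> x)" for F and x :: "real ^ 'm"
  define w where "w F = (\<Prod>i\<in>UNIV. cos_kernel_coeff n (F i))" for F :: "'m \<Rightarrow> nat"
  have meas: "\<phi> F \<in> borel_measurable ?M" for F
  proof -
    have "continuous_on UNIV (\<phi> F)" unfolding \<phi>_def[abs_def] by (intro continuous_intros)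
    then show ?thesis using borel_measurable_continuous_onI by simp
  qed
  have add: "\<phi> F (x + y) = \<phi> F x * \<phi> F y" for F x y by (simp add: \<phi>_def inner_add_right cis_mult)
  have unit: "norm (\<phi> F x) = 1" for F x by (simp add: \<phi>_def)
  have w0: "w F \<ge> 0" for F unfolding w_def by (intro prod_nonneg) (simp add: cos_kernel_coeff_def)
  have freq0: "cos_freq P n (\<lambda>_. n) = (0 :: real ^ 'm)" by (simp add: cos_freq_def vec_eq_iff)
  have \<phi>0: "\<phi> (\<lambda>_. n) x = 1" for x by (simp add: \<phi>_def freq0)
  have K: "cos_kernel P n z = Re (\<Sum>F\<in>\<Xi>. complex_of_real (w F) * \<phi> F z)" for z
    using cos_kernel_expansion[of P n z] unfolding \<Xi>_def w_def \<phi>_def by (metis Re_complex_of_real)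
  have small: "cos_kernel P n (x - y + v) \<le> \<beta> / 2" if "x \<in> J" "y \<in> J" "v \<in> D" for x y v
    unfolding \<beta>_def
  proof (rule n(2)[OF _ off[OF that]])
    fix i
    have "\<bar>(x - y + v) $ i\<bar> \<le> norm (x - y + v)" by (rule component_le_norm_cart)
    also have "\<dots> \<le> norm (x - y) + norm v" by (rule norm_triangle_ineq)
    also have "\<dots> \<le> (norm x + norm y) + norm v" using norm_triangle_ineq4[of x y] by simp
    also have "\<dots> \<le> P / 2" using Jr[OF that(1)] Jr[OF that(2)] Dr[OF that(3)] by (simp add: P_def)
    finally show "\<bar>(x - y + v) $ i\<bar> \<le> P / 2" .
  qed
  have mass: "(LINT x:J|?M. cos_kernel P n (x - y)) \<le> (P * cos_kernel_coeff n n) ^ CARD('m)" if "y \<in> J" for y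
  proof (rule integral_cos_kernel_le[OF P])
    show "\<bar>x $ i\<bar> \<le> r" if "x \<in> J" for x i using Jr[OF that] component_le_norm_cart[of x i] by linarith
  qed (use Jb in simp)
  have nonneg: "\<beta> / 2 \<ge> 0" "(P * cos_kernel_coeff n n) ^ CARD('m) \<ge> 0"
    using \<beta> P by (simp_all add: cos_kernel_coeff_def)
  obtain b where b: "\<And>F. F \<in> \<Xi> \<Longrightarrow> b F \<ge> 0" "b (\<lambda>_. n) = w (\<lambda>_. n) * (measure ?M J)\<^sup>2"
    "sum b \<Xi> \<le> (P * cos_kernel_coeff n n) ^ CARD('m) * measure ?M J"
    "\<And>v. v \<in> D \<Longrightarrow> (\<Sum>F\<in>\<Xi>. b F * Re (\<phi> F v)) \<le> \<beta> / 2 * (measure ?M J)\<^sup>2"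
    by (rule spectral_weights[OF Jb Jf meas add unit w0 \<phi>0 K small mass nonneg]) blast+
  have wn: "w (\<lambda>_. n) = \<beta>" by (simp add: w_def \<beta>_def)
  define c where "c F t = cos (poly (dot_poly f (cos_freq P n F)) (exp t))" for F t
  have Re\<phi>: "Re (\<phi> F (poly_curve f (exp t))) = c F t" for F t
    by (simp add: \<phi>_def c_def poly_dot_poly poly_curve_def inner_vec_def)
  have cint: "set_integrable lborel {a..T} (c F)" for F
    unfolding c_def by (intro borel_integrable_atLeastAtMost' continuous_intros)
  have lower: "- C \<le> (LBINT t:{a..T}. c F t)" for F
  proof -
    have deg: "Polynomial.degree (dot_poly f (cos_freq P n F)) \<le> d"
      unfolding dot_poly_def using d(2) by (intro degree_sum_le) (auto intro: order_trans[OF degree_smult_le])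
    \<comment> \<open>The constant \<open>K\<close> of the cosine estimate becomes the sum of the
      \<open>\<bar>g j\<bar>\<close>, the same for every frequency; hence the lower limit imposed on
      \<open>a\<close> depends on \<open>f\<close> alone.\<close>
    have "\<bar>Polynomial.coeff (dot_poly f (cos_freq P n F)) 0\<bar> \<le>
        (\<Sum>j=1..d. \<bar>g j * Polynomial.coeff (dot_poly f (cos_freq P n F)) j\<bar>)"
      unfolding g by (rule sum_abs)
    also have "\<dots> \<le> (\<Sum>j=1..d. (\<Sum>j=1..d. \<bar>g j\<bar>) * \<bar>Polynomial.coeff (dot_poly f (cos_freq P n F)) j\<bar>)"
      unfolding abs_mult by (intro sum_mono mult_right_mono member_le_sum) auto
    finally have "\<bar>Polynomial.coeff (dot_poly f (cos_freq P n F)) 0\<bar> \<le>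
        (\<Sum>j=1..d. \<bar>g j\<bar>) * (\<Sum>j=1..d. \<bar>Polynomial.coeff (dot_poly f (cos_freq P n F)) j\<bar>)"
      by (simp add: sum_distrib_left)
    from integral_cos_ge[OF d(1) this a(2) _ a(1), of T]
    show ?thesis unfolding C_def c_def poly_exp_eq_sum[OF deg] by (simp add: sum_nonneg)
  qed
  have c0: "(LBINT t:{a..T}. c (\<lambda>_. n) t) = T - a"
  proof -
    have "c (\<lambda>_. n) t = 1" for t by (simp add: c_def freq0 poly_dot_poly)
    then show ?thesis using a(3) by (simp add: set_lebesgue_integral_def)
  qed
  have \<Xi>: "finite \<Xi>" "(\<lambda>_. n) \<in> \<Xi>" by (auto simp: \<Xi>_def)
  have "(\<Sum>F\<in>\<Xi>. b F * (LBINT t:{a..T}. c F t)) = (LBINT t:{a..T}. \<Sum>F\<in>\<Xi>. b F * c F t)"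
    using cint by (subst set_integral_sum) auto
  also have "\<dots> \<le> (LBINT t:{a..T}. \<beta> / 2 * (measure ?M J)\<^sup>2)"
  proof (rule set_integral_mono)
    show "set_integrable lborel {a..T} (\<lambda>t. \<Sum>F\<in>\<Xi>. b F * c F t)" using cint by (intro set_integrable_sum) auto
    show "set_integrable lborel {a..T} (\<lambda>t. \<beta> / 2 * (measure ?M J)\<^sup>2)"
      by (intro borel_integrable_atLeastAtMost' continuous_intros)
    fix t assume "t \<in> {a..T}"
    then have "poly_curve f (exp t) \<in> D" by (simp add: D_def)
    from b(4)[OF this] show "(\<Sum>F\<in>\<Xi>. b F * c F t) \<le> \<beta> / 2 * (measure ?M J)\<^sup>2" by (simp only: Re\<phi>)
  qed
  also have "\<dots> = \<beta> / 2 * (measure ?M J)\<^sup>2 * (T - a)" using a(3) by (simp add: set_lebesgue_integral_def)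
  finally have total: "(\<Sum>F\<in>\<Xi>. b F * (LBINT t:{a..T}. c F t)) \<le> \<beta> / 2 * (measure ?M J)\<^sup>2 * (T - a)" .
  have rest: "(\<Sum>F\<in>\<Xi> - {\<lambda>_. n}. b F * - C) \<le> (\<Sum>F\<in>\<Xi> - {\<lambda>_. n}. b F * (LBINT t:{a..T}. c F t))"
    using b(1) lower by (intro sum_mono mult_left_mono) auto
  have restC: "(\<Sum>F\<in>\<Xi> - {\<lambda>_. n}. b F * - C) = - (C * (\<Sum>F\<in>\<Xi> - {\<lambda>_. n}. b F))"
    by (simp add: sum_distrib_left mult.commute sum_negf)
  have "C * (\<Sum>F\<in>\<Xi> - {\<lambda>_. n}. b F) \<le> C * ((P * cos_kernel_coeff n n) ^ CARD('m) * measure ?M J)"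
  proof (rule mult_left_mono[OF _ C0])
    have "sum b \<Xi> = b (\<lambda>_. n) + (\<Sum>F\<in>\<Xi> - {\<lambda>_. n}. b F)" by (rule sum.remove[OF \<Xi>])
    then show "(\<Sum>F\<in>\<Xi> - {\<lambda>_. n}. b F) \<le> (P * cos_kernel_coeff n n) ^ CARD('m) * measure ?M J"
      using b(1)[OF \<Xi>(2)] b(3) by linarith
  qed
  then have "b (\<lambda>_. n) * (T - a) - C * ((P * cos_kernel_coeff n n) ^ CARD('m) * measure ?M J) \<le> \<beta> / 2 * (measure ?M J)\<^sup>2 * (T - a)"
    using total rest restC unfolding sum.remove[OF \<Xi>] c0 by linarith
  \<comment> \<open>Half of the main term absorbs the kernel error, which produces the factor
    2.\<close>
  then have "\<beta> * ((measure ?M J)\<^sup>2 * (T - a)) \<le> \<beta> * (2 * C * P ^ CARD('m) * measure ?M J)"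
    unfolding b(2) wn by (simp add: \<beta>_def power_mult_distrib algebra_simps)
  then have main: "(measure ?M J)\<^sup>2 * (T - a) \<le> 2 * C * P ^ CARD('m) * measure ?M J"
    using \<beta> by (simp only: mult_le_cancel_left_pos)
  have "measure ?M J * (T - a) \<le> 2 * C * P ^ CARD('m)"
  proof (cases "measure ?M J = 0")
    case True
    then show ?thesis using C0 P by simp
  next
    case False
    then have pos: "measure ?M J > 0" by (simp add: zero_less_measure_iff)
    have "(measure ?M J * (T - a)) * measure ?M J \<le> (2 * C * P ^ CARD('m)) * measure ?M J"
      using main by (simp only: power2_eq_square mult_ac)
    then show ?thesis using pos by (simp only: mult_le_cancel_right_pos)
  qed
  \<comment> \<open>\<open>6 * r\<close> is \<open>3 * CARD('m)\<close> times the side of a cube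
    contained in the ball.\<close>
  also have "P ^ CARD('m) = (3 * CARD('m)) ^ CARD('m) * (2 * r / CARD('m)) ^ CARD('m)"
  proof -
    have "P = real (3 * CARD('m)) * (2 * r / CARD('m))" by (simp add: P_def)
    then show ?thesis by (simp only: power_mult_distrib of_nat_power of_nat_mult)
  qed
  also have "2 * C * ((3 * CARD('m)) ^ CARD('m) * (2 * r / CARD('m)) ^ CARD('m)) \<le>
      2 * C * ((3 * CARD('m)) ^ CARD('m) * measure ?M ?B)"
    using C0 measure_cube_le_cball[OF r(1), where 'm='m] by (intro mult_left_mono) auto
  finally have "measure ?M J \<le> 2 * C * ((3 * CARD('m)) ^ CARD('m) * measure ?M ?B) / (T - a)"
    using a(3) by (simp add: pos_le_divide_eq)
  moreover have "2 * x \<le> 4 * C * Y / t * y" if "x \<le> 2 * C * (Y * y) / t" for x Y y t :: real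
  proof -
    have "2 * x \<le> 2 * (2 * C * (Y * y) / t)" using that by simp
    also have "\<dots> = 4 * C * Y / t * y" by simp
    finally show ?thesis .
  qed
  ultimately have "2 * measure ?M J \<le> 4 * C * (3 * CARD('m)) ^ CARD('m) / (T - a) * measure ?M ?B"
    by blast
  then show ?thesis using J(3) by linarith
qed

lemma real_curve_independence_ratio:
  fixes f :: "'m::finite \<Rightarrow> real poly"
  assumes indep: "lin_indep_family (case_option 1 f)"
  shows "\<exists>C>0. \<exists>a\<^sub>0\<ge>0. \<forall>a T :: real. a\<^sub>0 < a \<and> a < T \<longrightarrow>
     0 < real_independence_ratio (cayley_graph (curve_set abs f (exp a) (exp T))) \<and>
     real_independence_ratio (cayley_graph (curve_set abs f (exp a) (exp T))) \<le> ereal (C / (T - a))"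
proof -
  define d where "d = Max (insert 1 (range (\<lambda>i. Polynomial.degree (f i))))"
  have d: "d \<ge> 1" "\<And>i. Polynomial.degree (f i) \<le> d" unfolding d_def by (intro Max_ge; auto)+
  obtain g where g: "\<And>\<theta>. Polynomial.coeff (dot_poly f \<theta>) 0 = (\<Sum>j=1..d. g j * Polynomial.coeff (dot_poly f \<theta>) j)"
    using coeff_0_combination[OF indep d(2)] by blast
  define C where "C = real d * (4 + 4 * (real (d + 1) * (real d)\<^sup>2)) + real d * ln (2 * real d) +
    real d * (real d * ln (2 * (real d)\<^sup>2))"
  fix i0 :: 'm
  have fin: "finite {s. poly (f i0) s = 0}"
    by (intro poly_roots_finite lin_indep_with_const_nonzero[OF indep])
  \<comment> \<open>Beyond \<open>R\<close> the coordinate \<open>i0\<close> has no roots, so the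
    curve avoids 0, and the constant terms of the phases are under control; the entry 1 makes
    \<open>ln R\<close> nonnegative.\<close>
  define R where "R = Max (insert 1 (insert (\<Sum>j=1..d. \<bar>g j\<bar>) (abs ` {s. poly (f i0) s = 0})))"
  have R: "1 \<le> R" "(\<Sum>j=1..d. \<bar>g j\<bar>) \<le> R" "\<And>s. poly (f i0) s = 0 \<Longrightarrow> \<bar>s\<bar> \<le> R"
    unfolding R_def using fin by (intro Max_ge; auto)+
  define C' where "C' = \<bar>4 * C * (3 * CARD('m)) ^ CARD('m)\<bar> + 1"
  show ?thesis
  proof (intro exI conjI allI impI)
    show "0 < C'" by (simp add: C'_def)
    show "0 \<le> ln R" using R(1) by simp
    fix a T :: real assume aT: "ln R < a \<and> a < T"
    then have a: "a \<ge> 0" using R(1) by (smt (verit) ln_ge_zero)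
    have "exp (ln R) < exp a" using aT by simp
    then have Ra: "R < exp a" using R(1) by simp
    have nz: "poly_curve f s \<noteq> 0" if "exp a \<le> \<bar>s\<bar>" for s
    proof
      assume "poly_curve f s = 0"
      then have "poly (f i0) s = 0" by (simp add: poly_curve_def vec_eq_iff)
      then show False using R(3) Ra that by force
    qed
    let ?S = "curve_set abs f (exp a) (exp T)"
    \<comment> \<open>Both signs of the parameter occur here: the colouring that gives positivity
      has to avoid all of \<open>?S\<close>, whereas the averaging uses positive parameters
      only.\<close>
    define A where "A = {s. exp a \<le> \<bar>s\<bar> \<and> \<bar>s\<bar> \<le> exp T}"
    have "compact A"
    proof -
      have "A = cball 0 (exp T) - ball 0 (exp a)" by (auto simp: A_def)
      then show ?thesis by (simp add: compact_diff)
    qed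
    moreover have "continuous_on A (\<lambda>s. norm (poly_curve f s))"
      unfolding poly_curve_def by (intro continuous_on_norm continuous_on_vec_lambda continuous_intros)
    ultimately have cA: "compact ((\<lambda>s. norm (poly_curve f s)) ` A)" by (rule compact_continuous_image[rotated])
    have "exp T \<in> A" using aT by (simp add: A_def)
    then have ne: "(\<lambda>s. norm (poly_curve f s)) ` A \<noteq> {}" by blast
    obtain s0 where s0: "s0 \<in> A" "\<And>s. s \<in> A \<Longrightarrow> norm (poly_curve f s0) \<le> norm (poly_curve f s)"
      using compact_attains_inf[OF cA ne] by blast
    obtain s1 where s1: "s1 \<in> A" "\<And>s. s \<in> A \<Longrightarrow> norm (poly_curve f s) \<le> norm (poly_curve f s1)"
      using compact_attains_sup[OF cA ne] by blast
    have pos: "norm (poly_curve f s0) > 0" using nz s0(1) by (simp add: A_def)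
    have S: "norm (poly_curve f s0) \<le> norm v" "norm v \<le> norm (poly_curve f s1)" if vS: "v \<in> ?S" for v
    proof -
      obtain s where "s \<in> A" "norm v = norm (poly_curve f s)"
        using vS by (auto simp: curve_set_def A_def)
      then show "norm (poly_curve f s0) \<le> norm v" "norm v \<le> norm (poly_curve f s1)" using s0(2) s1(2) by simp_all
    qed
    show "0 < real_independence_ratio (cayley_graph ?S)"
      by (rule real_independence_ratio_pos[OF pos S])
    show "real_independence_ratio (cayley_graph ?S) \<le> ereal (C' / (T - a))"
      unfolding real_independence_ratio_def
    proof (intro independence_ratio_le upper_density_le)
      fix I assume I: "borel_independent (cayley_graph ?S) I"
      show "eventually (\<lambda>r. 0 < measure lborel {x :: real ^ 'm. norm x \<le> r} \<and>
          measure lborel (I \<inter> {x. norm x \<le> r}) \<le> C' / (T - a) * measure lborel {x :: real ^ 'm. norm x \<le> r}) at_top"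
        using eventually_gt_at_top[of 0] eventually_ge_at_top[of "norm (poly_curve f s1)"]
      proof eventually_elim
        case (elim r)
        have "0 < (2 * r / CARD('m)) ^ CARD('m)" using elim by simp
        also note measure_cube_le_cball[OF elim(1), where 'm='m]
        finally have posB: "0 < measure lborel {x :: real ^ 'm. norm x \<le> r}" .
        have "norm (poly_curve f s) \<le> r" if "exp a \<le> \<bar>s\<bar>" "\<bar>s\<bar> \<le> exp T" for s
          using s1(2)[of s] that elim(2) by (simp add: A_def)
        moreover have "(\<Sum>j=1..d. \<bar>g j\<bar>) \<le> exp a" using R(2) Ra by linarith
        ultimately have "measure lborel (I \<inter> {x. norm x \<le> r}) \<le>
            4 * C * (3 * CARD('m)) ^ CARD('m) / (T - a) * measure lborel {x :: real ^ 'm. norm x \<le> r}"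
          unfolding C_def using aT by (intro real_independent_bound[OF d g a _ _ nz I elim(1)]) auto
        also have "\<dots> \<le> C' / (T - a) * measure lborel {x :: real ^ 'm. norm x \<le> r}"
          using aT unfolding C'_def by (intro mult_right_mono divide_right_mono) (auto simp: abs_if)
        finally show ?case using posB by blast
      qed
    qed
  qed
qed

section \<open>The field of \<open>p\<close>-adic numbers: characters and topology\<close>

lemma CARD_padic_gt_1: "real CARD('p::prime_card) > 1"
  using prime_gt_1_nat[OF prime_card[where 'a='p]] by simp

lemma padic_abs_0 [simp]: "padic_abs (0 :: 'p::prime_card padic) = 0"
  by (simp add: padic_abs_eq_0_iff)

lemma padic_abs_1 [simp]: "padic_abs (1 :: 'p::prime_card padic) = 1"
  using padic_abs_of_rat[of 1, where 'p='p] rat_padic_abs_1[OF prime_card[where 'a='p]] by simp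

lemma padic_abs_pos: "x \<noteq> 0 \<Longrightarrow> padic_abs (x :: 'p::prime_card padic) > 0"
  using padic_abs_nonneg[of x] padic_abs_eq_0_iff[of x] by linarith

lemma padic_abs_CARD: "padic_abs (of_nat CARD('p) :: 'p::prime_card padic) = 1 / real CARD('p)"
  using padic_abs_of_rat[of "of_nat CARD('p)", where 'p='p] rat_padic_abs_prime[OF prime_card[where 'a='p]]
  by simp

lemma padic_abs_power: "padic_abs (x ^ n :: 'p::prime_card padic) = padic_abs x ^ n"
  by (induction n) (simp_all add: padic_abs_mult)

lemma padic_abs_inverse: "padic_abs (inverse x :: 'p::prime_card padic) = inverse (padic_abs x)"
proof (cases "x = 0")
  case False
  then show ?thesis using padic_abs_mult[of x "inverse x"] padic_abs_pos[of x]
    by (simp add: field_simps)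
qed simp

lemma padic_abs_divide: "padic_abs (x / y :: 'p::prime_card padic) = padic_abs x / padic_abs y"
  by (simp add: divide_inverse padic_abs_mult padic_abs_inverse)

lemma padic_abs_power_int: "padic_abs (x powi n :: 'p::prime_card padic) = padic_abs x powi n"
  by (auto simp: power_int_def padic_abs_power padic_abs_inverse)

lemma padic_abs_diff_le: "padic_abs (x - y :: 'p::prime_card padic) \<le> max (padic_abs x) (padic_abs y)"
  using padic_abs_ultrametric[of x "- y"] by (simp add: padic_abs_minus)

lemma padic_abs_add_eq:
  assumes "padic_abs y < padic_abs (x :: 'p::prime_card padic)"
  shows "padic_abs (x + y) = padic_abs x"
  using padic_abs_ultrametric[of x y] padic_abs_diff_le[of "x + y" y] assms by simp

lemma padic_abs_sum_le:
  assumes "\<And>i. i \<in> A \<Longrightarrow> padic_abs (g i :: 'p::prime_card padic) \<le> B" "B \<ge> 0"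
  shows "padic_abs (sum g A) \<le> B"
  using assms(1)
proof (induction A rule: infinite_finite_induct)
  case (insert x F)
  then show ?case using padic_abs_ultrametric[of "g x" "sum g F"] by fastforce
qed (use assms(2) in simp_all)

lemma padic_abs_of_int_le_1: "padic_abs (of_int a :: 'p::prime_card padic) \<le> 1"
  using padic_abs_of_rat[of "of_int a", where 'p='p] rat_padic_abs_of_int_le_1[OF prime_card[where 'a='p], of a]
  by simp

lemma padic_abs_of_nat_le_1: "padic_abs (of_nat a :: 'p::prime_card padic) \<le> 1"
  using padic_abs_of_int_le_1[of "int a"] by simp

lemma padic_abs_of_int_le_iff:
  "padic_abs (of_int a :: 'p::prime_card padic) \<le> 1 / real CARD('p) ^ k \<longleftrightarrow> int CARD('p) ^ k dvd a"
proof (cases "a = 0")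
  case True
  then show ?thesis by simp
next
  case False
  let ?p = "CARD('p)"
  note p = prime_card[where 'a='p]
  have "padic_abs (of_int a :: 'p padic) = rat_padic_abs ?p (of_int a)"
    using padic_abs_of_rat[of "of_int a", where 'p='p] by simp
  also have "\<dots> = 1 / real ?p ^ multiplicity (int ?p) a"
    using rat_padic_abs_Fract[OF p False, of 1] by (simp add: Fract_of_int_eq[symmetric] flip: of_int_rat)
  also have "\<dots> \<le> 1 / real ?p ^ k \<longleftrightarrow> k \<le> multiplicity (int ?p) a"
    using CARD_padic_gt_1[where 'p='p] by (simp add: field_simps)
  also have "\<dots> \<longleftrightarrow> int ?p ^ k dvd a"
    using False p by (subst power_dvd_iff_le_multiplicity) (auto simp: not_prime_unit)
  finally show ?thesis .
qed

lemma padic_abs_of_nat_ge: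
  assumes "j > 0"
  shows "1 / real j \<le> padic_abs (of_nat j :: 'p::prime_card padic)"
proof -
  let ?p = "CARD('p)"
  note p = prime_card[where 'a='p]
  have "padic_abs (of_nat j :: 'p padic) = rat_padic_abs ?p (of_int (int j))"
    using padic_abs_of_rat[of "of_nat j", where 'p='p] by simp
  also have "\<dots> = 1 / real ?p ^ multiplicity (int ?p) (int j)"
    using assms rat_padic_abs_Fract[OF p, of "int j" 1] by (simp add: Fract_of_int_eq[symmetric] flip: of_int_rat)
  finally have eq: "padic_abs (of_nat j :: 'p padic) = 1 / real ?p ^ multiplicity (int ?p) (int j)" .
  have "int ?p ^ multiplicity (int ?p) (int j) dvd int j" by (rule multiplicity_dvd)
  then have "int ?p ^ multiplicity (int ?p) (int j) \<le> int j" using assms by (intro zdvd_imp_le) auto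
  then have "real_of_int (int ?p ^ multiplicity (int ?p) (int j)) \<le> real_of_int (int j)"
    by (simp only: of_int_le_iff)
  then show ?thesis
    unfolding eq using CARD_padic_gt_1[where 'p='p] assms by (intro divide_left_mono) auto
qed

lemma padic_abs_of_int_not_dvd:
  assumes "\<not> int CARD('p) dvd a"
  shows "padic_abs (of_int a :: 'p::prime_card padic) = 1"
  using padic_abs_of_rat[of "of_int a", where 'p='p]
    rat_padic_abs_of_int_not_dvd[OF prime_card[where 'a='p] assms] by simp

text \<open>A rational whose distance from \<open>x\<close> is less than \<open>padic_abs x\<close>
  has the same absolute value as \<open>x\<close>, so completion does not enlarge the value
  group.\<close>

lemma padic_abs_value:
  assumes "x \<noteq> (0 :: 'p::prime_card padic)"
  obtains k :: int where "padic_abs x = real CARD('p) powi k"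
proof -
  obtain q where q: "padic_abs (x - of_rat q) < padic_abs x"
    using rat_dense_padic[OF padic_abs_pos[OF assms]] .
  have "padic_abs (of_rat q :: 'p padic) = padic_abs x"
    using padic_abs_add_eq[of "of_rat q - x" x] q padic_abs_minus_commute[of x] by simp
  then have *: "padic_abs x = rat_padic_abs CARD('p) q" by (simp add: padic_abs_of_rat)
  then have "q \<noteq> 0" using padic_abs_pos[OF assms] by auto
  moreover obtain n d where "quotient_of q = (n, d)" by (cases "quotient_of q")
  ultimately have "rat_padic_abs CARD('p) q =
      real CARD('p) ^ multiplicity (int CARD('p)) d / real CARD('p) ^ multiplicity (int CARD('p)) n"
    by (simp add: rat_padic_abs_def)
  then have "padic_abs x = real CARD('p) powi (int (multiplicity (int CARD('p)) d) - int (multiplicity (int CARD('p)) n))"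
    using * CARD_padic_gt_1[where 'p='p] by (simp add: power_int_diff)
  then show ?thesis by (rule that)
qed

text \<open>Taylor estimates free of combinatorial factors, because sums are bounded by maxima.
  Horner's scheme passes the bounds from \<open>q\<close> to \<open>pCons a q\<close>; the three are
  proved together, since the later ones use the earlier ones.\<close>

lemma poly_padic_expansion:
  fixes q :: "'p::prime_card padic poly"
  assumes "\<And>i. padic_abs (Polynomial.coeff q i) \<le> \<beta>" "padic_abs u \<le> 1" "padic_abs h \<le> 1"
  shows "padic_abs (poly q u) \<le> \<beta>"
    and "padic_abs (poly q (u + h) - poly q u) \<le> \<beta> * padic_abs h"
    and "padic_abs (poly q (u + h) - poly q u - h * poly (pderiv q) u) \<le> \<beta> * (padic_abs h)\<^sup>2"
proof -
  have \<beta>: "\<beta> \<ge> 0" using assms(1)[of 0] padic_abs_nonneg[of "Polynomial.coeff q 0"] by linarith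
  have uh: "padic_abs (u + h) \<le> 1" using padic_abs_ultrametric[of u h] assms by linarith
  have "padic_abs (poly q u) \<le> \<beta> \<and> padic_abs (poly q (u + h) - poly q u) \<le> \<beta> * padic_abs h \<and>
      padic_abs (poly q (u + h) - poly q u - h * poly (pderiv q) u) \<le> \<beta> * (padic_abs h)\<^sup>2"
    using assms(1)
  proof (induction q rule: pCons_induct)
    case 0
    then show ?case using \<beta> by (simp add: padic_abs_nonneg)
  next
    case (pCons a q)
    have a: "padic_abs a \<le> \<beta>" using pCons.prems[of 0] by simp
    have "padic_abs (Polynomial.coeff q i) \<le> \<beta>" for i using pCons.prems[of "Suc i"] by simp
    then have IH: "padic_abs (poly q u) \<le> \<beta>" "padic_abs (poly q (u + h) - poly q u) \<le> \<beta> * padic_abs h"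
      "padic_abs (poly q (u + h) - poly q u - h * poly (pderiv q) u) \<le> \<beta> * (padic_abs h)\<^sup>2"
      using pCons.IH by blast+
    note n = padic_abs_nonneg
    have u1: "padic_abs (u * z) \<le> B" if "padic_abs z \<le> B" for z B
      using mult_mono[OF assms(2) that] n[of z] by (simp add: padic_abs_mult)
    have h1: "padic_abs (h * z) \<le> B * padic_abs h" if "padic_abs z \<le> B" for z B
      using mult_left_mono[OF that n[of h]] by (simp add: padic_abs_mult mult.commute)
    have pm: "padic_abs (x + y) \<le> B" if "padic_abs x \<le> B" "padic_abs y \<le> B" for x y :: "'p padic" and B
      using padic_abs_ultrametric[of x y] that by linarith
    have 1: "padic_abs (poly (pCons a q) u) \<le> \<beta>"
      using padic_abs_ultrametric[of a "u * poly q u"] a u1[OF IH(1)] by simp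
    have e2: "poly (pCons a q) (u + h) - poly (pCons a q) u =
        u * (poly q (u + h) - poly q u) + h * (poly q (u + h) - poly q u + poly q u)"
      by (simp add: algebra_simps)
    have "\<beta> * padic_abs h \<le> \<beta>" using \<beta> assms(3) by (simp add: mult_left_le)
    then have f: "padic_abs (poly q (u + h) - poly q u + poly q u) \<le> \<beta>"
      using padic_abs_ultrametric[of "poly q (u + h) - poly q u" "poly q u"] IH by linarith
    have 2: "padic_abs (poly (pCons a q) (u + h) - poly (pCons a q) u) \<le> \<beta> * padic_abs h"
      unfolding e2 by (rule pm[OF u1[OF IH(2)] h1[OF f]])
    have e3: "poly (pCons a q) (u + h) - poly (pCons a q) u - h * poly (pderiv (pCons a q)) u =
        u * (poly q (u + h) - poly q u - h * poly (pderiv q) u) + h * (poly q (u + h) - poly q u)"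
      by (simp add: pderiv_pCons algebra_simps)
    have 3: "padic_abs (poly (pCons a q) (u + h) - poly (pCons a q) u - h * poly (pderiv (pCons a q)) u)
        \<le> \<beta> * (padic_abs h)\<^sup>2"
      unfolding e3 using pm[OF u1[OF IH(3)]] h1[OF IH(2)]
      by (simp add: power2_eq_square mult.assoc)
    show ?case using 1 2 3 by blast
  qed
  then show "padic_abs (poly q u) \<le> \<beta>"
    and "padic_abs (poly q (u + h) - poly q u) \<le> \<beta> * padic_abs h"
    and "padic_abs (poly q (u + h) - poly q u - h * poly (pderiv q) u) \<le> \<beta> * (padic_abs h)\<^sup>2"
    by blast+
qed

lemma continuous_on_poly_padic: "continuous_on A (poly (q :: 'p::prime_card padic poly))"
proof -
  have add: "continuous_on A (\<lambda>x. f x + g x)" if cf: "continuous_on A f" and cg: "continuous_on A g" for f g :: "'p padic \<Rightarrow> 'p padic"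
    unfolding continuous_on_iff
  proof (intro ballI allI impI)
    fix x e assume x: "x \<in> A" and e: "(e::real) > 0"
    obtain d1 where d1: "d1 > 0" "\<And>y. y \<in> A \<Longrightarrow> dist y x < d1 \<Longrightarrow> dist (f y) (f x) < e"
      using bspec[OF cf[unfolded continuous_on_iff] x, rule_format, OF e] by blast
    obtain d2 where d2: "d2 > 0" "\<And>y. y \<in> A \<Longrightarrow> dist y x < d2 \<Longrightarrow> dist (g y) (g x) < e"
      using bspec[OF cg[unfolded continuous_on_iff] x, rule_format, OF e] by blast
    have "dist (f y + g y) (f x + g x) < e" if "y \<in> A" "dist y x < min d1 d2" for y
      using d1(2)[of y] d2(2)[of y] that padic_abs_ultrametric[of "f y - f x" "g y - g x"]
      unfolding dist_padic_def by (simp add: algebra_simps)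
    then show "\<exists>d>0. \<forall>y\<in>A. dist y x < d \<longrightarrow> dist (f y + g y) (f x + g x) < e"
      using d1(1) d2(1) by (intro exI[of _ "min d1 d2"]) auto
  qed
  show ?thesis
  proof (induction q rule: pCons_induct)
    case (pCons a q)
    have "continuous_on A (\<lambda>x. x * poly q x)"
      unfolding continuous_on_iff
    proof (intro ballI allI impI)
      fix x e assume x: "x \<in> A" and e: "(e::real) > 0"
      define B where "B = max 1 (padic_abs (poly q x))"
      define C where "C = max 1 (padic_abs x)"
      have BC: "B > 0" "C > 0" by (auto simp: B_def C_def)
      obtain d where d: "d > 0" "\<And>y. y \<in> A \<Longrightarrow> dist y x < d \<Longrightarrow> dist (poly q y) (poly q x) < e / C"
        using bspec[OF pCons.IH[unfolded continuous_on_iff] x, rule_format, OF divide_pos_pos[OF e BC(2)]] by blast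
      have "dist (y * poly q y) (x * poly q x) < e" if y: "y \<in> A" "dist y x < min 1 (min d (e / B))" for y
      proof -
        have yx: "padic_abs (y - x) < 1" "padic_abs (y - x) < e / B" using y(2) by (auto simp: dist_padic_def)
        have yC: "padic_abs y \<le> C"
          using padic_abs_ultrametric[of "y - x" x] yx(1) by (simp add: C_def)
        have "padic_abs (y * (poly q y - poly q x)) \<le> C * padic_abs (poly q y - poly q x)"
          unfolding padic_abs_mult by (intro mult_right_mono yC padic_abs_nonneg)
        also have "\<dots> < e" using d(2)[of y] y BC by (simp add: dist_padic_def field_simps)
        finally have 1: "padic_abs (y * (poly q y - poly q x)) < e" .
        have "padic_abs ((y - x) * poly q x) \<le> padic_abs (y - x) * B"
          unfolding padic_abs_mult by (intro mult_left_mono padic_abs_nonneg) (simp add: B_def)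
        also have "\<dots> < e" using yx(2) BC by (simp add: field_simps)
        finally have 2: "padic_abs ((y - x) * poly q x) < e" .
        have "y * poly q y - x * poly q x = y * (poly q y - poly q x) + (y - x) * poly q x"
          by (simp add: algebra_simps)
        then show ?thesis
          using 1 2 padic_abs_ultrametric[of "y * (poly q y - poly q x)" "(y - x) * poly q x"]
          by (simp add: dist_padic_def)
      qed
      then show "\<exists>d>0. \<forall>y\<in>A. dist y x < d \<longrightarrow> dist (y * poly q y) (x * poly q x) < e"
        using d(1) e BC by (intro exI[of _ "min 1 (min d (e / B))"]) auto
    qed
    then show ?case using add[OF continuous_on_const, of "\<lambda>x. x * poly q x" a] by simp
  qed simp
qed

section \<open>The additive character\<close>

lemma digit_rev_denominator:
  assumes "prime p"
  shows "\<exists>a n. digit_rev p u = of_int a / of_nat p ^ n"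
proof (induction u rule: less_induct)
  case (less u)
  show ?case
  proof (cases "u = 0")
    case True
    then show ?thesis by (intro exI[of _ 0]) (simp add: digit_rev.simps)
  next
    case False
    then have "u div p < u" using prime_gt_1_nat[OF assms] by simp
    then obtain a n where an: "digit_rev p (u div p) = of_int a / of_nat p ^ n" using less by blast
    have "digit_rev p u = of_int (int (u mod p) * int p ^ Suc n + a) / of_nat p ^ Suc n"
      using prime_gt_0_nat[OF assms] digit_rev_rec[OF assms, of u] an by (simp add: field_simps)
    then show ?thesis by blast
  qed
qed

text \<open>A representative of \<open>x\<close> modulo \<open>\<int>\<^sub>p\<close> in
  \<open>\<int>[1/p]\<close>. The choice is immaterial, since two representatives differ by an
  integer, by \<open>rat_integral_of_padic\<close>.\<close>

definition padic_frac :: "'p::prime_card padic \<Rightarrow> rat" where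
  "padic_frac x = (SOME q. (\<exists>a n. q = of_int a / of_nat CARD('p) ^ n) \<and> padic_abs (x - of_rat q) \<le> 1)"

lemma padic_frac:
  shows "\<exists>a n. padic_frac (x :: 'p::prime_card padic) = of_int a / of_nat CARD('p) ^ n"
    and "padic_abs (x - of_rat (padic_frac x)) \<le> 1"
proof -
  note p = prime_card[where 'a='p]
  obtain r where r: "padic_abs (x - of_rat r) < 1" using rat_dense_padic[of 1 x] by auto
  obtain u where u: "rat_padic_abs CARD('p) (r - digit_rev CARD('p) u) \<le> 1 / real CARD('p)"
    using digit_rev_dense[OF p] by blast
  have "padic_abs (of_rat r - of_rat (digit_rev CARD('p) u) :: 'p padic) \<le> 1"
  proof -
    have "padic_abs (of_rat r - of_rat (digit_rev CARD('p) u) :: 'p padic) \<le> 1 / real CARD('p)"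
      using u by (simp add: padic_abs_of_rat flip: of_rat_diff)
    also have "\<dots> \<le> 1" using CARD_padic_gt_1[where 'p='p] by simp
    finally show ?thesis .
  qed
  then have "padic_abs ((x - of_rat r) + (of_rat r - of_rat (digit_rev CARD('p) u))) \<le> 1"
    using r padic_abs_ultrametric[of "x - of_rat r" "of_rat r - of_rat (digit_rev CARD('p) u)"] by linarith
  then have "padic_abs (x - of_rat (digit_rev CARD('p) u)) \<le> 1" by simp
  then have "(\<exists>a n. digit_rev CARD('p) u = of_int a / of_nat CARD('p) ^ n) \<and> padic_abs (x - of_rat (digit_rev CARD('p) u)) \<le> 1"
    using digit_rev_denominator[OF p] by blast
  from someI[where P = "\<lambda>q. (\<exists>a n. q = of_int a / of_nat CARD('p) ^ n) \<and> padic_abs (x - of_rat q) \<le> 1", OF this]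
  show "\<exists>a n. padic_frac x = of_int a / of_nat CARD('p) ^ n" "padic_abs (x - of_rat (padic_frac x)) \<le> 1"
    by (auto simp: padic_frac_def)
qed

text \<open>Clearing the denominator \<open>p ^ n\<close> shows that \<open>p ^ n\<close> divides
  the numerator. This is the source of both the additivity and the kernel of
  \<open>padic_char\<close>.\<close>

lemma rat_integral_of_padic:
  assumes "q = of_int a / of_nat CARD('p) ^ n" "padic_abs (of_rat q :: 'p::prime_card padic) \<le> 1"
  shows "q \<in> \<int>"
proof -
  have p0: "real CARD('p) > 0" "CARD('p) > 0" using CARD_padic_gt_1[where 'p='p] by auto
  have "(of_int a :: 'p padic) = of_rat (q * of_nat CARD('p) ^ n)" using assms(1) p0 by simp
  also have "\<dots> = of_rat q * of_nat CARD('p) ^ n" by (simp add: of_rat_mult of_rat_power)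
  finally have "padic_abs (of_int a :: 'p padic) = padic_abs (of_rat q :: 'p padic) * (1 / real CARD('p)) ^ n"
    by (simp only: padic_abs_mult padic_abs_power padic_abs_CARD)
  also have "\<dots> \<le> 1 * (1 / real CARD('p)) ^ n" by (intro mult_right_mono assms) simp
  finally have "padic_abs (of_int a :: 'p padic) \<le> 1 / real CARD('p) ^ n" by (simp add: power_one_over)
  then obtain b where "a = int CARD('p) ^ n * b" unfolding padic_abs_of_int_le_iff by (elim dvdE)
  then have "q = of_int b" using assms(1) p0 by simp
  then show ?thesis by simp
qed

text \<open>The standard additive character of \<open>\<rat>\<^sub>p\<close>, trivial exactly on
  \<open>\<int>\<^sub>p\<close>.\<close>

definition padic_char :: "'p::prime_card padic \<Rightarrow> complex" where
  "padic_char x = cis (2 * pi * of_rat (padic_frac x))"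

lemma cis_2pi_eq_1_iff: "cis (2 * pi * r) = 1 \<longleftrightarrow> r \<in> \<int>"
proof
  assume "cis (2 * pi * r) = 1"
  then have "cos (2 * pi * r) = 1" by (metis cis.sel(1) one_complex.sel(1))
  then obtain n :: int where "2 * pi * r = n * 2 * pi" using cos_one_2pi_int by auto
  then have "r = n" by simp
  then show "r \<in> \<int>" by simp
qed (auto simp: cis_multiple_2pi elim: Ints_cases)

lemma norm_padic_char [simp]: "norm (padic_char x) = 1"
  by (simp add: padic_char_def)

lemma padic_char_eq_1_iff: "padic_char (x :: 'p::prime_card padic) = 1 \<longleftrightarrow> padic_abs x \<le> 1"
proof -
  let ?q = "padic_frac x"
  obtain a n where an: "?q = of_int a / of_nat CARD('p) ^ n" using padic_frac(1) by blast
  have "(of_rat ?q :: real) \<in> \<int> \<longleftrightarrow> ?q \<in> \<int>"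
  proof
    assume "(of_rat ?q :: real) \<in> \<int>"
    then obtain k where "(of_rat ?q :: real) = of_int k" by (elim Ints_cases)
    also have "(of_int k :: real) = of_rat (of_int k)" by simp
    finally have "?q = of_int k" by (simp only: of_rat_eq_iff)
    then show "?q \<in> \<int>" by simp
  qed (auto elim!: Ints_cases)
  then have "padic_char x = 1 \<longleftrightarrow> ?q \<in> \<int>" by (simp add: padic_char_def cis_2pi_eq_1_iff)
  also have "\<dots> \<longleftrightarrow> padic_abs (of_rat ?q :: 'p padic) \<le> 1"
    using rat_integral_of_padic[OF an] padic_abs_of_int_le_1 by (auto elim!: Ints_cases)
  also have "\<dots> \<longleftrightarrow> padic_abs x \<le> 1"
    using padic_abs_diff_le_iff[of x "of_rat ?q" 1 0] padic_frac(2)[of x] by (simp add: padic_abs_minus)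
  finally show ?thesis .
qed

text \<open>The additivity defect of \<open>padic_frac\<close> has a power of \<open>p\<close> as
  denominator and is a p-adic integer; hence it is an integer, which the exponential does not
  see.\<close>

lemma padic_char_add: "padic_char (x + y :: 'p::prime_card padic) = padic_char x * padic_char y"
proof -
  let ?r = "padic_frac (x + y) - padic_frac x - padic_frac y"
  obtain a b c k l m where 1: "padic_frac (x + y) = of_int a / of_nat CARD('p) ^ k"
      "padic_frac x = of_int b / of_nat CARD('p) ^ l" "padic_frac y = of_int c / of_nat CARD('p) ^ m"
    using padic_frac(1) by meson
  let ?p = "of_nat CARD('p) :: rat"
  have "?p \<noteq> 0" using CARD_padic_gt_1[where 'p='p] by simp
  then have "?r = of_int (a * int CARD('p) ^ (l + m) - b * int CARD('p) ^ (k + m) - c * int CARD('p) ^ (k + l)) /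
      of_nat CARD('p) ^ (k + l + m)"
    unfolding 1 by (simp add: power_add diff_divide_distrib)
  moreover have "padic_abs (of_rat ?r :: 'p padic) \<le> 1"
  proof -
    have e: "(of_rat ?r :: 'p padic) = ((x - of_rat (padic_frac x)) + (y - of_rat (padic_frac y))) -
        (x + y - of_rat (padic_frac (x + y)))"
      by (simp add: of_rat_diff)
    show ?thesis unfolding e
      using padic_frac(2)[of x] padic_frac(2)[of y] padic_frac(2)[of "x + y"]
        padic_abs_diff_le[of "(x - of_rat (padic_frac x)) + (y - of_rat (padic_frac y))" "x + y - of_rat (padic_frac (x + y))"]
        padic_abs_ultrametric[of "x - of_rat (padic_frac x)" "y - of_rat (padic_frac y)"] by linarith
  qed
  ultimately have "?r \<in> \<int>" by (rule rat_integral_of_padic)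
  then obtain n where "padic_frac (x + y) = of_int n + (padic_frac x + padic_frac y)"
    by (elim Ints_cases) (simp add: algebra_simps)
  then have "2 * pi * of_rat (padic_frac (x + y)) =
      2 * pi * of_int n + (2 * pi * of_rat (padic_frac x) + 2 * pi * of_rat (padic_frac y))"
    by (simp add: of_rat_add algebra_simps)
  then show ?thesis
    unfolding padic_char_def by (simp only: cis_mult[symmetric]) (simp add: cis_2pi_eq_1_iff)
qed

lemma padic_char_0 [simp]: "padic_char 0 = 1"
  by (simp add: padic_char_eq_1_iff)

lemma padic_char_of_nat_mult: "padic_char (of_nat n * x) = padic_char x ^ n"
  by (induction n) (simp_all add: padic_char_add distrib_right)

text \<open>A geometric series whose ratio \<open>padic_char x\<close> is an \<open>n\<close>-th
  root of unity by the hypothesis.\<close>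

lemma padic_char_sum:
  assumes "padic_abs (of_nat n * x :: 'p::prime_card padic) \<le> 1"
  shows "(\<Sum>j<n. padic_char (of_nat j * x)) = (if padic_abs x \<le> 1 then of_nat n else 0)"
proof (cases "padic_char x = 1")
  case True
  then show ?thesis by (simp add: padic_char_of_nat_mult flip: padic_char_eq_1_iff)
next
  case False
  have "padic_char x ^ n = 1" using assms by (simp add: padic_char_eq_1_iff flip: padic_char_of_nat_mult)
  then show ?thesis
    using False by (simp add: padic_char_of_nat_mult sum_gp_strict padic_char_eq_1_iff)
qed

lemma padic_char_cong:
  assumes "padic_abs (x - y) \<le> 1"
  shows "padic_char x = padic_char (y :: 'p::prime_card padic)"
  using padic_char_add[of "x - y" y] assms by (simp flip: padic_char_eq_1_iff)

section \<open>Digit expansions, compactness and countable bases\<close>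

lemma padic_integer_digits:
  assumes "padic_abs (y :: 'p::prime_card padic) \<le> 1"
  shows "\<exists>j<CARD('p) ^ k. padic_abs (y - of_nat j) \<le> 1 / real CARD('p) ^ k"
  using assms
proof (induction k arbitrary: y)
  case 0
  then show ?case by (intro exI[of _ 0]) simp
next
  case (Suc k)
  note p = prime_card[where 'a='p]
  let ?p = "CARD('p)"
  have p1: "real ?p > 1" by (rule CARD_padic_gt_1)
  obtain r where r: "padic_abs (y - of_rat r) < 1 / real ?p" using rat_dense_padic[of "1 / real ?p" y] p1 by auto
  have "1 / real ?p \<le> 1" using p1 by simp
  then have "padic_abs (of_rat r :: 'p padic) \<le> 1"
    using padic_abs_diff_le[of y "y - of_rat r", unfolded diff_diff_eq2 add_diff_cancel_left'] r Suc.prems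
    by linarith
  then obtain d where d: "d < ?p" "rat_padic_abs ?p (r - of_nat d) \<le> 1 / real ?p"
    using rat_padic_abs_digit[OF p] unfolding padic_abs_of_rat by blast
  have "padic_abs (of_rat r - of_nat d :: 'p padic) \<le> 1 / real ?p"
    using d(2) padic_abs_of_rat[of "r - of_nat d", where 'p='p] by (simp add: of_rat_diff)
  then have yd: "padic_abs (y - of_nat d) \<le> 1 / real ?p"
    using r padic_abs_ultrametric[of "y - of_rat r" "of_rat r - of_nat d"] by simp
  define z where "z = (y - of_nat d) / of_nat ?p"
  have z: "y - of_nat d = of_nat ?p * z" by (simp add: z_def)
  have "padic_abs z \<le> 1"
    using yd p1 by (simp add: z_def padic_abs_divide padic_abs_CARD field_simps)
  then obtain j where j: "j < ?p ^ k" "padic_abs (z - of_nat j) \<le> 1 / real ?p ^ k" using Suc.IH by blast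
  have "y - of_nat (d + ?p * j) = of_nat ?p * (z - of_nat j)" using z by (simp add: algebra_simps)
  then have "padic_abs (y - of_nat (d + ?p * j)) = 1 / real ?p * padic_abs (z - of_nat j)"
    by (simp only: padic_abs_mult padic_abs_CARD)
  also have "\<dots> \<le> 1 / real ?p * (1 / real ?p ^ k)" using j by (intro mult_left_mono) auto
  finally have "padic_abs (y - of_nat (d + ?p * j)) \<le> 1 / real ?p ^ Suc k" by simp
  moreover have "d + ?p * j < ?p ^ Suc k"
  proof -
    have "d + ?p * j < ?p * (j + 1)" using d by simp
    also have "\<dots> \<le> ?p * ?p ^ k" using j by (intro mult_left_mono) auto
    finally show ?thesis by simp
  qed
  ultimately show ?case by blast
qed

lemma padic_ball_digits:
  assumes "padic_abs (y :: 'p::prime_card padic) \<le> real CARD('p) ^ N"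
  shows "\<exists>j<CARD('p) ^ (N + k). padic_abs (y - of_nat j / of_nat CARD('p) ^ N) \<le> 1 / real CARD('p) ^ k"
proof -
  let ?p = "CARD('p)"
  have p1: "real ?p > 1" by (rule CARD_padic_gt_1)
  have "padic_abs (y * of_nat ?p ^ N) \<le> 1"
    using assms p1 by (simp add: padic_abs_mult padic_abs_power padic_abs_CARD power_one_over field_simps)
  then obtain j where j: "j < ?p ^ (N + k)" "padic_abs (y * of_nat ?p ^ N - of_nat j) \<le> 1 / real ?p ^ (N + k)"
    using padic_integer_digits by blast
  have "y - of_nat j / of_nat ?p ^ N = (y * of_nat ?p ^ N - of_nat j) / of_nat ?p ^ N"
    by (simp add: field_simps)
  then have "padic_abs (y - of_nat j / of_nat ?p ^ N) = padic_abs (y * of_nat ?p ^ N - of_nat j) * real ?p ^ N"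
    by (simp add: padic_abs_divide padic_abs_power padic_abs_CARD power_one_over)
  also have "\<dots> \<le> 1 / real ?p ^ (N + k) * real ?p ^ N" by (intro mult_right_mono j) simp
  also have "\<dots> = 1 / real ?p ^ k" using p1 by (simp add: power_add)
  finally show ?thesis using j(1) by blast
qed

text \<open>Digit expansions of bounded length are finite in number and form a net of any prescribed
  mesh, so bounded sets are totally bounded; closed ones are complete.\<close>

lemma compact_padic_closed_subset:
  assumes "closed S" "\<And>x. x \<in> S \<Longrightarrow> padic_abs (x :: 'p::prime_card padic) \<le> real CARD('p) ^ N"
  shows "compact S"
proof -
  let ?p = "CARD('p)"
  have p1: "real ?p > 1" by (rule CARD_padic_gt_1)
  have "\<exists>k. finite k \<and> S \<subseteq> (\<Union>x\<in>k. ball x e)" if e: "e > 0" for e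
  proof -
    obtain k where k: "(1 / real ?p) ^ k < e" using real_arch_pow_inv[OF e, of "1 / real ?p"] p1 by auto
    show ?thesis
    proof (intro exI conjI subsetI)
      show "finite ((\<lambda>j. of_nat j / of_nat ?p ^ N :: 'p padic) ` {..<?p ^ (N + k)})" by simp
      fix x assume "x \<in> S"
      then obtain j where j: "j < ?p ^ (N + k)" "padic_abs (x - of_nat j / of_nat ?p ^ N) \<le> 1 / real ?p ^ k"
        using padic_ball_digits assms(2) by blast
      then have "x \<in> ball (of_nat j / of_nat ?p ^ N) e"
        using k by (simp add: dist_commute dist_padic_def power_one_over)
      then show "x \<in> (\<Union>x\<in>(\<lambda>j. of_nat j / of_nat ?p ^ N :: 'p padic) ` {..<?p ^ (N + k)}. ball x e)"
        using j(1) by blast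
    qed
  qed
  moreover have "complete S" using assms(1) by (simp add: complete_eq_closed)
  ultimately show ?thesis unfolding compact_eq_totally_bounded by blast
qed

lemma continuous_on_padic_abs: "continuous_on A (padic_abs :: 'p::prime_card padic \<Rightarrow> real)"
proof -
  have "continuous_on A (\<lambda>x :: 'p padic. dist x 0)" by (intro continuous_intros)
  then show ?thesis by (simp add: dist_padic_def)
qed

lemma compact_padic_annulus: "compact {x :: 'p::prime_card padic. lo \<le> padic_abs x \<and> padic_abs x \<le> hi}"
proof -
  obtain N where "hi < real CARD('p) ^ N" using real_arch_pow[OF CARD_padic_gt_1] by blast
  moreover have "closed {x :: 'p padic. lo \<le> padic_abs x \<and> padic_abs x \<le> hi}"
    by (intro closed_Collect_conj closed_Collect_le continuous_on_const continuous_on_padic_abs)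
  ultimately show ?thesis by (intro compact_padic_closed_subset[of _ N]) auto
qed

text \<open>Second countability of \<open>'p padic ^ 'm\<close> enters through the inner regularity
  behind \<open>compact_subset_half_measure\<close>.\<close>

instance vec :: ("{metric_space, second_countable_topology}", finite) second_countable_topology
proof
  obtain B :: "'a set set" where B: "countable B" "topological_basis B"
    using ex_countable_basis by blast
  define D where "D = (\<lambda>A. {y :: ('a, 'b) vec. \<forall>i. y $ i \<in> A i}) ` (UNIV \<rightarrow>\<^sub>E B)"
  have "countable D" unfolding D_def using B(1) by (intro countable_image countable_PiE) auto
  moreover have "topological_basis D"
  proof (rule topological_basisI)
    fix S assume "S \<in> D"
    then obtain A where AB: "A \<in> UNIV \<rightarrow>\<^sub>E B" and S: "S = {y. \<forall>i. y $ i \<in> A i}"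
      unfolding D_def by blast
    have A: "A i \<in> B" for i using AB by auto
    have "open (A i)" for i using topological_basis_open[OF B(2) A] .
    then show "open S" unfolding open_vec_def S by (intro ballI exI[of _ A]) auto
  next
    fix S :: "('a, 'b) vec set" and x assume S: "open S" "x \<in> S"
    then obtain A where A: "\<And>i. open (A i)" "\<And>i. x $ i \<in> A i" "\<And>y. (\<forall>i. y $ i \<in> A i) \<Longrightarrow> y \<in> S"
      unfolding open_vec_def by meson
    have "\<exists>b. b \<in> B \<and> x $ i \<in> b \<and> b \<subseteq> A i" for i
      using topological_basisE[OF B(2) A(1,2)] by metis
    then obtain b where b: "\<And>i. b i \<in> B" "\<And>i. x $ i \<in> b i" "\<And>i. b i \<subseteq> A i" by metis
    show "\<exists>B'\<in>D. x \<in> B' \<and> B' \<subseteq> S"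
    proof (intro bexI conjI)
      show "{y. \<forall>i. y $ i \<in> b i} \<in> D" unfolding D_def using b(1) by (intro imageI) auto
      show "{y. \<forall>i. y $ i \<in> b i} \<subseteq> S" using b(3) A(3) by blast
    qed (use b in auto)
  qed
  ultimately show "\<exists>B::('a, 'b) vec set set. countable B \<and> open = generate_topology B"
    using topological_basis_imp_subbasis by blast
qed

instance padic :: (prime_card) second_countable_topology
proof
  define D where "D = (\<lambda>(q, n). ball (of_rat q :: 'a padic) (1 / real (Suc n))) ` UNIV"
  have "countable D" unfolding D_def by (intro countable_image) auto
  moreover have "topological_basis D"
  proof (rule topological_basisI)
    fix S assume "S \<in> D"
    then show "open S" by (auto simp: D_def)
  next
    fix S :: "'a padic set" and x assume "open S" "x \<in> S"
    then obtain e where e: "e > 0" "ball x e \<subseteq> S" by (rule openE)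
    obtain n where n: "1 / real (Suc n) < e / 2" using nat_approx_posE[of "e / 2"] e(1) by (metis half_gt_zero)
    obtain q where q: "padic_abs (x - of_rat q) < 1 / real (Suc n)" using rat_dense_padic[of "1 / real (Suc n)" x] by auto
    have "ball (of_rat q :: 'a padic) (1 / real (Suc n)) \<subseteq> ball x e"
    proof
      fix y :: "'a padic" assume "y \<in> ball (of_rat q) (1 / real (Suc n))"
      then have "dist (of_rat q) y < 1 / real (Suc n)" "dist x (of_rat q) < 1 / real (Suc n)"
        using q by (auto simp: dist_padic_def)
      then show "y \<in> ball x e" using dist_triangle[of x y "of_rat q"] n by simp
    qed
    moreover have "x \<in> ball (of_rat q) (1 / real (Suc n))"
      using q by (simp add: dist_padic_def padic_abs_minus_commute)
    moreover have "ball (of_rat q :: 'a padic) (1 / real (Suc n)) \<in> D"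
      unfolding D_def by (intro image_eqI[of _ _ "(q, n)"]) auto
    ultimately show "\<exists>B'\<in>D. x \<in> B' \<and> B' \<subseteq> S" using e(2) by blast
  qed
  ultimately show "\<exists>B::'a padic set set. countable B \<and> open = generate_topology B"
    using topological_basis_imp_subbasis by blast
qed

lemma tendsto_padic_iff: "(X \<longlongrightarrow> (x :: 'p::prime_card padic)) F \<longleftrightarrow> ((\<lambda>n. padic_abs (X n - x)) \<longlongrightarrow> 0) F"
  by (subst tendsto_dist_iff) (simp add: dist_padic_def)

text \<open>If every polydisc around 0 were met, a convergent subsequence of the triples would have
  a limit with \<open>x - y + v = 0\<close>. With \<open>J = {0}\<close> this also separates the
  curve itself from 0.\<close>

lemma compact_differences_avoid_polydisc:
  fixes J D :: "('p::prime_card padic ^ 'm::finite) set"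
  assumes "compact J" "compact D" "\<And>x y v. x \<in> J \<Longrightarrow> y \<in> J \<Longrightarrow> v \<in> D \<Longrightarrow> x - y + v \<noteq> 0"
  obtains n where "\<And>x y v. x \<in> J \<Longrightarrow> y \<in> J \<Longrightarrow> v \<in> D \<Longrightarrow> x - y + v \<notin> padic_polydisc 0 n"
proof (rule ccontr)
  assume "\<not> thesis"
  then have "\<forall>n. \<exists>z. fst z \<in> J \<and> fst (snd z) \<in> J \<and> snd (snd z) \<in> D \<and>
      fst z - fst (snd z) + snd (snd z) \<in> padic_polydisc 0 n"
    using that by (metis fst_conv snd_conv)
  then obtain z where z: "\<And>n. fst (z n) \<in> J" "\<And>n. fst (snd (z n)) \<in> J" "\<And>n. snd (snd (z n)) \<in> D"
     "\<And>n. fst (z n) - fst (snd (z n)) + snd (snd (z n)) \<in> padic_polydisc 0 n" by metis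
  have "compact (J \<times> J \<times> D)" using assms by (intro compact_Times)
  moreover have "\<forall>n. z n \<in> J \<times> J \<times> D" using z by (simp add: mem_Times_iff)
  ultimately obtain l r where l: "l \<in> J \<times> J \<times> D" "strict_mono (r :: nat \<Rightarrow> nat)" "(z \<circ> r) \<longlonglongrightarrow> l"
    unfolding compact_def by blast
  obtain x y v where xyv: "l = (x, y, v)" by (cases l)
  let ?w = "\<lambda>n. fst (z (r n)) - fst (snd (z (r n))) + snd (snd (z (r n)))"
  have "x - y + v = 0"
  proof (subst vec_eq_iff, intro allI)
    fix i
    have c1: "(\<lambda>n. fst (z (r n)) $ i) \<longlonglongrightarrow> x $ i"
      using tendsto_vec_nth[OF tendsto_fst[OF l(3)], of i] by (simp add: xyv o_def)
    have c2: "(\<lambda>n. fst (snd (z (r n))) $ i) \<longlonglongrightarrow> y $ i"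
      using tendsto_vec_nth[OF tendsto_fst[OF tendsto_snd[OF l(3)]], of i] by (simp add: xyv o_def)
    have c3: "(\<lambda>n. snd (snd (z (r n))) $ i) \<longlonglongrightarrow> v $ i"
      using tendsto_vec_nth[OF tendsto_snd[OF tendsto_snd[OF l(3)]], of i] by (simp add: xyv o_def)
    \<comment> \<open>In each coordinate the limit differs from the small quantity
      \<open>?w n\<close> by the three approximation errors.\<close>
    let ?g = "\<lambda>n. padic_abs (fst (z (r n)) $ i - x $ i) + padic_abs (fst (snd (z (r n))) $ i - y $ i) +
        padic_abs (snd (snd (z (r n))) $ i - v $ i) + 1 / real CARD('p) ^ n"
    have "(\<lambda>n. (1 / real CARD('p)) ^ n) \<longlonglongrightarrow> 0"
      using CARD_padic_gt_1[where 'p='p] by (intro LIMSEQ_power_zero) simp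
    then have "?g \<longlonglongrightarrow> 0 + 0 + 0 + 0"
      using c1 c2 c3 unfolding tendsto_padic_iff by (intro tendsto_add) (simp_all add: power_one_over)
    moreover have "padic_abs ((x - y + v) $ i) \<le> ?g n" for n
    proof -
      have "n \<le> r n" using l(2) by (rule seq_suble)
      then have "?w n \<in> padic_polydisc 0 n" using z(4)[of "r n"] padic_polydisc_mono by blast
      then have w: "padic_abs (?w n $ i) \<le> 1 / real CARD('p) ^ n" by (simp add: padic_polydisc_def)
      let ?a = "fst (z (r n)) $ i - x $ i" and ?b = "fst (snd (z (r n))) $ i - y $ i" and ?c = "snd (snd (z (r n))) $ i - v $ i"
      have e: "(x - y + v) $ i = ?w n $ i + ((?b - ?a) - ?c)" by simp
      have n0: "padic_abs ?a \<ge> 0" "padic_abs ?b \<ge> 0" "padic_abs ?c \<ge> 0" "1 / real CARD('p) ^ n \<ge> 0"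
        using padic_abs_nonneg by auto
      show ?thesis unfolding e
        using w n0 padic_abs_ultrametric[of "?w n $ i" "(?b - ?a) - ?c"] padic_abs_diff_le[of "?b - ?a" ?c]
          padic_abs_diff_le[of ?b ?a] by linarith
    qed
    ultimately have "padic_abs ((x - y + v) $ i) \<le> 0 + 0 + 0 + 0"
      by (intro tendsto_lowerbound[of ?g]) auto
    then show "(x - y + v) $ i = 0 $ i" using padic_abs_pos[of "(x - y + v) $ i"] by (cases "(x - y + v) $ i = 0") auto
  qed
  then show False using assms(3) l(1) unfolding xyv by blast
qed

section \<open>The \<open>p\<close>-adic case\<close>

definition unit_residues :: "nat \<Rightarrow> nat \<Rightarrow> nat set" where
  "unit_residues p H = {u. u < p ^ H \<and> \<not> p dvd u}"

lemma finite_unit_residues [simp]: "finite (unit_residues p H)"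
  by (rule finite_subset[of _ "{..<p ^ H}"]) (auto simp: unit_residues_def)

lemma card_unit_residues_pos:
  assumes "p > 1" "H \<ge> 1"
  shows "card (unit_residues p H) > 0"
proof -
  have "1 < p ^ H" using assms by (intro one_less_power) auto
  then have "1 \<in> unit_residues p H" using assms by (simp add: unit_residues_def)
  then show ?thesis by (auto simp: card_gt_0_iff)
qed

lemma sum_periodic_shift:
  fixes g :: "nat \<Rightarrow> 'a::ab_group_add"
  assumes "\<And>u. g (u + N) = g u"
  shows "(\<Sum>u<N. g (u + s)) = (\<Sum>u<N. g u)"
proof (induction s)
  case (Suc s)
  have "(\<Sum>u<Suc N. g (u + s)) = g s + (\<Sum>u<N. g (u + Suc s))"
    by (simp add: sum.lessThan_Suc_shift del: sum.lessThan_Suc)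
  moreover have "(\<Sum>u<Suc N. g (u + s)) = (\<Sum>u<N. g (u + s)) + g s"
    using assms[of s] by (simp add: add.commute)
  ultimately show ?case using Suc by simp
qed simp

text \<open>Adding a multiple of \<open>p\<close> does not affect divisibility by \<open>p\<close>,
  and \<open>H \<ge> 1\<close> makes this condition periodic modulo \<open>p ^ H\<close>; so the
  shift merely permutes the residues.\<close>

lemma sum_unit_residues_shift:
  fixes \<phi> :: "nat \<Rightarrow> 'a::ab_group_add"
  assumes "H \<ge> 1" "\<And>u. \<phi> (u + p ^ H) = \<phi> u"
  shows "(\<Sum>u\<in>unit_residues p H. \<phi> (u + p * s)) = (\<Sum>u\<in>unit_residues p H. \<phi> u)"
proof -
  let ?g = "\<lambda>u. if p dvd u then 0 else \<phi> u"
  have eq: "(\<Sum>u\<in>unit_residues p H. f u) = (\<Sum>u<p ^ H. if p dvd u then 0 else f u)" for f :: "nat \<Rightarrow> 'a"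
    by (rule sum.mono_neutral_cong_left) (auto simp: unit_residues_def)
  have "p dvd p ^ H" using assms(1) by (simp add: dvd_power)
  then have "?g (u + p ^ H) = ?g u" for u using assms(2) by (simp add: dvd_add_left_iff)
  from sum_periodic_shift[of ?g, OF this, of "p * s"] show ?thesis by (simp add: eq dvd_add_left_iff)
qed

text \<open>
  Translating \<open>u\<close> by \<open>p\<^sup>h w\<close>, where \<open>|P'(u)| = p\<^bsup>h+1\<^esup>\<close>, multiplies the character by a nontrivial
  \<open>p\<close>-th root of unity to the power \<open>w\<close>.
\<close>

lemma padic_shell_sum_eq_0:
  fixes P :: "'p::prime_card padic poly"
  assumes j: "j \<ge> 1"
    and dom: "\<And>i. i \<noteq> j \<Longrightarrow> padic_abs (Polynomial.coeff P i) < padic_abs (of_nat j :: 'p padic) * padic_abs (Polynomial.coeff P j)"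
    and large: "(real CARD('p))\<^sup>2 \<le> (padic_abs (of_nat j :: 'p padic))\<^sup>2 * padic_abs (Polynomial.coeff P j)"
    and H: "H \<ge> 1" "padic_abs (Polynomial.coeff P j) \<le> real CARD('p) ^ H"
  shows "(\<Sum>u\<in>unit_residues CARD('p) H. padic_char (poly P (of_nat u))) = 0"
proof -
  let ?p = "CARD('p)" and ?U = "unit_residues CARD('p) H"
  let ?c = "\<lambda>i. padic_abs (Polynomial.coeff P i)" and ?j = "padic_abs (of_nat j :: 'p padic)"
  note n = padic_abs_nonneg and p1 = CARD_padic_gt_1[where 'p='p]
  have j1: "?j \<le> 1" by (rule padic_abs_of_nat_le_1)
  have "?c j \<noteq> 0" using large p1 by auto
  then have cj: "?c j > 0" using n[of "Polynomial.coeff P j"] by linarith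
  have "?j \<noteq> 0" using large p1 by auto
  then have j0: "?j > 0" using n[of "of_nat j :: 'p padic"] by linarith
  have jc: "?j * ?c j \<le> ?c j" using j1 cj by simp
  have coeff_le: "?c i \<le> ?c j" for i
    using dom[of i] jc by (cases "i = j") auto
  have jcp: "(real ?p)\<^sup>2 \<le> ?j * ?c j"
  proof -
    have "?j\<^sup>2 * ?c j \<le> ?j * ?c j" using j1 j0 cj by (simp add: power2_eq_square)
    then show ?thesis using large by linarith
  qed
  have "of_nat j * Polynomial.coeff P j \<noteq> 0" using \<open>?c j \<noteq> 0\<close> j by auto
  then obtain M where M: "?j * ?c j = real ?p powi M"
    using padic_abs_value[of "of_nat j * Polynomial.coeff P j"] by (auto simp: padic_abs_mult)
  have "real ?p powi 2 \<le> real ?p powi M" using jcp M by simp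
  then have "M \<ge> 2" using p1 by (meson leI not_le power_int_strict_increasing)
  \<comment> \<open>With this exponent the product of \<open>p ^ h\<close> and the derivative has
    absolute value exactly \<open>p\<close>. Since \<open>M \<ge> 2\<close>,
    \<open>h \<ge> 1\<close>, so translations by \<open>p ^ h * w\<close> keep units units.\<close>
  define h where "h = nat (M - 1)"
  have h1: "h \<ge> 1" and hM: "M = int h + 1" using \<open>M \<ge> 2\<close> by (auto simp: h_def)
  have jch: "?j * ?c j = real ?p ^ h * real ?p"
    unfolding M hM using p1 by (simp add: power_int_add)
  have abs_ph: "padic_abs (of_nat (?p ^ h) :: 'p padic) = 1 / real ?p ^ h"
    by (simp add: padic_abs_power padic_abs_CARD power_one_over)
  have deriv: "padic_abs (poly (pderiv P) (of_nat u)) = ?j * ?c j" if u: "u \<in> ?U" for u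
  proof -
    let ?u = "of_nat u :: 'p padic"
    have u1: "padic_abs ?u = 1"
      using padic_abs_of_int_not_dvd[of "int u", where 'p='p] u by (simp add: unit_residues_def)
    have deg: "Polynomial.degree (pderiv P) < Suc (max (Polynomial.degree P) j)" by (simp add: degree_pderiv)
    have "poly (pderiv P) ?u = (\<Sum>i<Suc (max (Polynomial.degree P) j). Polynomial.coeff (pderiv P) i * ?u ^ i)"
      unfolding poly_altdef using deg
      by (intro sum.mono_neutral_left) (auto simp: coeff_eq_0)
    also have "\<dots> = Polynomial.coeff (pderiv P) (j - 1) * ?u ^ (j - 1) +
        (\<Sum>i\<in>{..<Suc (max (Polynomial.degree P) j)} - {j - 1}. Polynomial.coeff (pderiv P) i * ?u ^ i)"
      by (intro sum.remove) auto
    finally have eq: "poly (pderiv P) ?u = of_nat j * Polynomial.coeff P j * ?u ^ (j - 1) +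
        (\<Sum>i\<in>{..<Suc (max (Polynomial.degree P) j)} - {j - 1}. Polynomial.coeff (pderiv P) i * ?u ^ i)"
      using j by (simp add: coeff_pderiv)
    have lead: "padic_abs (of_nat j * Polynomial.coeff P j * ?u ^ (j - 1)) = ?j * ?c j"
      by (simp add: padic_abs_mult padic_abs_power u1)
    \<comment> \<open>A maximum over finitely many indices combines the strict inequalities into one
      strict bound, as the equality case of the ultrametric inequality demands.\<close>
    define B where "B = Max (insert 0 ((\<lambda>i. ?c (Suc i)) ` ({..<Suc (max (Polynomial.degree P) j)} - {j - 1})))"
    have B0: "B \<ge> 0" unfolding B_def by (rule Max_ge) auto
    have "?c (Suc i) < ?j * ?c j" if "i \<noteq> j - 1" for i
      by (rule dom) (use that j in linarith)
    then have BJ: "B < ?j * ?c j" unfolding B_def using j0 cj by (subst Max_less_iff) auto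
    have "padic_abs (\<Sum>i\<in>{..<Suc (max (Polynomial.degree P) j)} - {j - 1}. Polynomial.coeff (pderiv P) i * ?u ^ i) \<le> B"
    proof (rule padic_abs_sum_le[OF _ B0])
      fix i assume i: "i \<in> {..<Suc (max (Polynomial.degree P) j)} - {j - 1}"
      have "padic_abs (Polynomial.coeff (pderiv P) i * ?u ^ i) = padic_abs (of_nat (Suc i) :: 'p padic) * ?c (Suc i)"
        by (simp only: coeff_pderiv padic_abs_mult padic_abs_power u1) simp
      also have "\<dots> \<le> 1 * ?c (Suc i)" by (intro mult_right_mono padic_abs_of_nat_le_1 n)
      also have "\<dots> \<le> B" unfolding B_def mult_1 using i by (intro Max_ge) auto
      finally show "padic_abs (Polynomial.coeff (pderiv P) i * ?u ^ i) \<le> B" .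
    qed
    then have "padic_abs (\<Sum>i\<in>{..<Suc (max (Polynomial.degree P) j)} - {j - 1}. Polynomial.coeff (pderiv P) i * ?u ^ i)
        < padic_abs (of_nat j * Polynomial.coeff P j * ?u ^ (j - 1))" using BJ unfolding lead by linarith
    then show ?thesis unfolding eq by (rule trans[OF padic_abs_add_eq lead])
  qed
  have shift: "padic_char (poly P (of_nat (u + ?p ^ h * w))) =
      padic_char (poly P (of_nat u)) * padic_char (of_nat w * (of_nat (?p ^ h) * poly (pderiv P) (of_nat u)))" for u w
  proof -
    let ?h = "of_nat (?p ^ h * w) :: 'p padic"
    have hle: "padic_abs ?h \<le> 1 / real ?p ^ h"
      using abs_ph padic_abs_of_nat_le_1[of w, where 'p='p] p1
      by (simp add: padic_abs_mult divide_right_mono)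
    have "padic_abs (poly P (of_nat u + ?h) - poly P (of_nat u) - ?h * poly (pderiv P) (of_nat u)) \<le> ?c j * (padic_abs ?h)\<^sup>2"
      by (intro poly_padic_expansion(3) coeff_le padic_abs_of_nat_le_1)
    also have "\<dots> \<le> ?c j * (1 / real ?p ^ h)\<^sup>2" using hle cj n by (intro mult_left_mono power_mono) auto
    also have "\<dots> \<le> 1"
    proof -
      \<comment> \<open>Here the square in \<open>large\<close> is used: it makes the quadratic
        Taylor remainder a p-adic integer, invisible to the character.\<close>
      have "(real ?p)\<^sup>2 * ?c j \<le> ?j\<^sup>2 * ?c j * ?c j" using large cj by (intro mult_right_mono) auto
      also have "\<dots> = (?j * ?c j)\<^sup>2" by (simp add: power2_eq_square)
      also have "\<dots> = (real ?p)\<^sup>2 * (real ?p ^ h)\<^sup>2" unfolding jch by (simp add: power_mult_distrib mult.commute)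
      finally have "?c j \<le> (real ?p ^ h)\<^sup>2" using p1 by simp
      then show ?thesis using p1 by (simp add: power_one_over field_simps)
    qed
    finally have "padic_abs (poly P (of_nat u + ?h) - (poly P (of_nat u) + ?h * poly (pderiv P) (of_nat u))) \<le> 1"
      by (simp add: diff_diff_eq)
    then have "padic_char (poly P (of_nat u + ?h)) = padic_char (poly P (of_nat u) + ?h * poly (pderiv P) (of_nat u))"
      by (rule padic_char_cong)
    then show ?thesis by (simp add: padic_char_add mult_ac)
  qed
  have period: "padic_char (poly P (of_nat (u + ?p ^ H))) = padic_char (poly P (of_nat u))" for u
  proof -
    have "padic_abs (poly P (of_nat u + of_nat (?p ^ H)) - poly P (of_nat u)) \<le> ?c j * padic_abs (of_nat (?p ^ H) :: 'p padic)"
      by (intro poly_padic_expansion(2) coeff_le padic_abs_of_nat_le_1)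
    also have "\<dots> = ?c j / real ?p ^ H" by (simp add: padic_abs_power padic_abs_CARD power_one_over)
    also have "\<dots> \<le> 1" using H(2) p1 by (simp add: field_simps)
    finally show ?thesis by (intro padic_char_cong) simp
  qed
  let ?S = "\<Sum>u\<in>?U. padic_char (poly P (of_nat u))"
  obtain h' where h': "h = Suc h'" using h1 by (cases h) auto
  have "of_nat ?p * ?S = (\<Sum>w<?p. ?S)" by simp
  also have "\<dots> = (\<Sum>w<?p. \<Sum>u\<in>?U. padic_char (poly P (of_nat (u + ?p * (?p ^ h' * w)))))"
    by (intro sum.cong refl sum_unit_residues_shift[symmetric, where \<phi> = "\<lambda>u. padic_char (poly P (of_nat u))"] H(1) period)
  also have "\<dots> = (\<Sum>w<?p. \<Sum>u\<in>?U. padic_char (poly P (of_nat (u + ?p ^ h * w))))"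
    by (simp only: h' power_Suc mult.assoc)
  also have "\<dots> = (\<Sum>u\<in>?U. padic_char (poly P (of_nat u)) *
      (\<Sum>w<?p. padic_char (of_nat w * (of_nat (?p ^ h) * poly (pderiv P) (of_nat u)))))"
    unfolding shift by (subst sum.swap) (simp add: sum_distrib_left)
  also have "\<dots> = 0"
  proof (rule sum.neutral, rule ballI)
    fix u assume u: "u \<in> ?U"
    let ?\<theta> = "of_nat (?p ^ h) * poly (pderiv P) (of_nat u) :: 'p padic"
    have \<theta>: "padic_abs ?\<theta> = real ?p"
      using p1 by (simp only: padic_abs_mult abs_ph deriv[OF u] jch) simp
    then have "padic_abs (of_nat ?p * ?\<theta>) \<le> 1" using p1 by (simp only: padic_abs_mult[of "of_nat ?p"] padic_abs_CARD) simp
    then have "(\<Sum>w<?p. padic_char (of_nat w * ?\<theta>)) = 0" using padic_char_sum[of ?p ?\<theta>] \<theta> p1 by simp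
    then show "padic_char (poly P (of_nat u)) * (\<Sum>w<?p. padic_char (of_nat w * ?\<theta>)) = 0" by simp
  qed
  finally show ?thesis using p1 by simp
qed

lemma power_int_eq_exp:
  assumes "x > 0"
  shows "x powi k = exp (of_int k * ln x)" "(x powi k) ^ i = exp (real i * (of_int k * ln x))"
proof -
  show "x powi k = exp (of_int k * ln x)"
    using assms by (simp add: powr_real_of_int'[symmetric] powr_def)
  then show "(x powi k) ^ i = exp (real i * (of_int k * ln x))" by (simp only: exp_of_nat_mult)
qed

text \<open>A finite substitute for the mean of the character over the shell of radius
  \<open>p ^ k\<close>: the sample points \<open>u / p ^ k\<close> lie on this shell, and
  \<open>H\<close> is the resolution.\<close>

definition padic_shell_mean :: "'p::prime_card padic poly \<Rightarrow> nat \<Rightarrow> int \<Rightarrow> real" where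
  "padic_shell_mean P H k =
     Re (\<Sum>u\<in>unit_residues CARD('p) H. padic_char (poly P (of_nat u / of_nat CARD('p) powi k)))
       / card (unit_residues CARD('p) H)"

text \<open>The thresholds: if the coefficients are at most 1, the character is exactly 1;
  \<open>p\<^sup>2 d\<^sup>2\<close> with \<open>|j| \<ge> 1 / d\<close> meets the size condition
  for a vanishing sum; the factor \<open>2 * d\<close> beats, strictly, the loss \<open>|j|\<close>
  in the derivative. The resolution \<open>H0\<close> must follow the size of the leading
  coefficient, so it is not uniform in the phase.\<close>

lemma padic_shell_mean_ge:
  fixes P :: "'p::prime_card padic poly"
  assumes d: "d \<ge> 1" "Polynomial.degree P \<le> d"
    and c0: "padic_abs (Polynomial.coeff P 0) \<le> K * (\<Sum>j=1..d. padic_abs (Polynomial.coeff P j))"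
    and K: "K \<ge> 0" "2 * K * (real d)\<^sup>2 \<le> real CARD('p) powi k" and k: "k \<ge> 0"
  defines "\<gamma> \<equiv> \<lambda>j. padic_abs (Polynomial.coeff P j)" and "q \<equiv> ln (real CARD('p))"
  obtains H0 where "H0 \<ge> 1" "\<And>H. H \<ge> H0 \<Longrightarrow> padic_shell_mean P H k \<ge>
     - (\<Sum>j=1..d. indicator (low_window \<gamma> 1 ((real CARD('p))\<^sup>2 * (real d)\<^sup>2) j) (of_int k * q)) -
     (\<Sum>j=1..d. \<Sum>i\<in>{1..d} - {j}. indicator (tie_window \<gamma> (2 * real d) j i) (of_int k * q))"
proof -
  let ?p = "CARD('p)"
  let ?L = "\<lambda>j. indicator (low_window \<gamma> 1 ((real ?p)\<^sup>2 * (real d)\<^sup>2) j) (of_int k * q) :: real"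
  let ?V = "\<lambda>j i. indicator (tie_window \<gamma> (2 * real d) j i) (of_int k * q) :: real"
  note p1 = CARD_padic_gt_1[where 'p='p] and n = padic_abs_nonneg
  \<comment> \<open>Rescaling moves the shell to the units and multiplies the size of the
    \<open>i\<close>-th coefficient by \<open>exp (i * t)\<close> with \<open>t = k * ln p\<close>,
    which brings the real trichotomy into play.\<close>
  define Q where "Q = pcompose P [:0, inverse (of_nat ?p powi k):]"
  have polyQ: "poly Q u = poly P (u / of_nat ?p powi k)" for u
    by (simp add: Q_def poly_pcompose divide_inverse)
  have mean: "padic_shell_mean P H k = Re (\<Sum>u\<in>unit_residues ?p H. padic_char (poly Q (of_nat u))) / card (unit_residues ?p H)" for H
    by (simp add: padic_shell_mean_def polyQ)
  have card: "card (unit_residues ?p H) > 0" if "H \<ge> 1" for H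
    using card_unit_residues_pos[OF _ that, of ?p] p1 by simp
  have mean_ge: "padic_shell_mean P H k \<ge> -1" if "H \<ge> 1" for H
  proof -
    have "- Re (\<Sum>u\<in>unit_residues ?p H. padic_char (poly Q (of_nat u))) \<le>
        norm (\<Sum>u\<in>unit_residues ?p H. padic_char (poly Q (of_nat u)))"
      using abs_Re_le_cmod by (smt (verit))
    also have "\<dots> \<le> (\<Sum>u\<in>unit_residues ?p H. norm (padic_char (poly Q (of_nat u))))" by (rule norm_sum)
    also have "\<dots> = card (unit_residues ?p H)" by simp
    finally show ?thesis unfolding mean using card[OF that] by (simp add: field_simps)
  qed
  have coeff: "padic_abs (Polynomial.coeff Q i) = \<gamma> i * exp (real i * (of_int k * q))" for i
  proof -
    have "padic_abs (inverse (of_nat ?p powi k) :: 'p padic) = real ?p powi k"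
      by (simp add: padic_abs_inverse padic_abs_power_int padic_abs_CARD power_int_divide_distrib)
    then have "padic_abs (Polynomial.coeff Q i) = (real ?p powi k) ^ i * \<gamma> i"
      by (simp add: Q_def coeff_pcompose_linear padic_abs_mult padic_abs_power \<gamma>_def)
    then show ?thesis using p1 power_int_eq_exp(2)[of "real ?p" k i] by (simp add: q_def)
  qed
  have \<gamma>0: "\<gamma> i \<ge> 0" for i by (simp add: \<gamma>_def n)
  have degQ: "Polynomial.coeff Q i = 0" if "i > d" for i
    using that d by (simp add: Q_def coeff_pcompose_linear coeff_eq_0)
  have coeff_ge: "\<gamma> i * real ?p powi k \<le> padic_abs (Polynomial.coeff Q i)" if "i \<ge> 1" for i
  proof -
    have "1 * (of_int k * q) \<le> i * (of_int k * q)" using that k p1 by (intro mult_right_mono) (auto simp: q_def)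
    then have "real ?p powi k \<le> exp (i * (of_int k * q))" using p1 by (simp add: power_int_eq_exp(1) q_def)
    then show ?thesis unfolding coeff by (intro mult_left_mono \<gamma>0)
  qed
  \<comment> \<open>\<open>dominant_term_cases\<close> speaks of the coefficients 1 to
    \<open>d\<close> only. This bound lets the constant coefficient be treated as one that is
    dominated with the same factor \<open>2 * d\<close>.\<close>
  have coeff0: "2 * real d * padic_abs (Polynomial.coeff Q 0) \<le> m"
    if m: "\<And>i. i \<in> {1..d} \<Longrightarrow> padic_abs (Polynomial.coeff Q i) \<le> m" for m
  proof -
    have m0: "m \<ge> 0" using m[of 1] d n[of "Polynomial.coeff Q 1"] by simp
    have "padic_abs (Polynomial.coeff Q 0) * real ?p powi k \<le> (K * (\<Sum>j=1..d. \<gamma> j)) * real ?p powi k"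
      using c0 p1 unfolding coeff by (intro mult_right_mono) (simp_all add: \<gamma>_def)
    also have "\<dots> = K * (\<Sum>j=1..d. \<gamma> j * real ?p powi k)" by (simp add: sum_distrib_right mult.assoc)
    also have "\<dots> \<le> K * (\<Sum>j=1..d. m)"
      using coeff_ge m K by (intro mult_left_mono sum_mono) (auto intro: order_trans)
    finally have "2 * d * (padic_abs (Polynomial.coeff Q 0) * real ?p powi k) \<le> 2 * d * (K * (d * m))"
      by (intro mult_left_mono) auto
    also have "\<dots> = (2 * K * (real d)\<^sup>2) * m" by (simp add: power2_eq_square)
    also have "\<dots> \<le> real ?p powi k * m" using K(2) m0 by (rule mult_right_mono)
    finally have "(2 * real d * padic_abs (Polynomial.coeff Q 0)) * real ?p powi k \<le> m * real ?p powi k"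
      by (simp add: mult_ac)
    moreover have "real ?p powi k > 0" using p1 by simp
    ultimately show ?thesis by (simp only: mult_le_cancel_right_pos)
  qed
  have L0: "?L j \<ge> 0" and V0: "?V j i \<ge> 0" for i j by simp_all
  have SL0: "(\<Sum>j=1..d. ?L j) \<ge> 0" and SV0: "(\<Sum>j=1..d. \<Sum>i\<in>{1..d} - {j}. ?V j i) \<ge> 0"
    by (intro sum_nonneg L0 V0)+
  have one_le: "1 \<le> (real ?p)\<^sup>2 * (real d)\<^sup>2" "1 \<le> 2 * real d"
  proof -
    have "1 \<le> real ?p * real d" using mult_mono[of 1 "real ?p" 1 "real d"] p1 d(1) by simp
    then show "1 \<le> (real ?p)\<^sup>2 * (real d)\<^sup>2" by (simp add: one_le_power flip: power_mult_distrib)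
  qed (use d in simp)
  show ?thesis
  proof (rule dominant_term_cases[OF d(1) \<gamma>0 zero_less_one one_le, where t = "of_int k * q"])
    assume small: "\<And>j. j \<in> {1..d} \<Longrightarrow> \<gamma> j * exp (real j * (of_int k * q)) < 1"
    have "padic_abs (Polynomial.coeff Q i) \<le> 1" for i
    proof -
      consider "i = 0" | "i \<in> {1..d}" | "i > d" by force
      then show ?thesis
      proof cases
        case 1
        have "1 * padic_abs (Polynomial.coeff Q 0) \<le> 2 * real d * padic_abs (Polynomial.coeff Q 0)"
          using one_le n by (intro mult_right_mono) auto
        then show ?thesis using coeff0[of 1] small 1 unfolding coeff by (force intro: less_imp_le)
      qed (use small degQ in \<open>auto simp: coeff intro: less_imp_le\<close>)
    qed
    then have "padic_abs (poly Q (of_nat u)) \<le> 1" for u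
      by (intro poly_padic_expansion(1)[where h = 0] padic_abs_of_nat_le_1) simp_all
    then have "padic_char (poly Q (of_nat u)) = 1" for u by (simp add: padic_char_eq_1_iff)
    then have m0: "padic_shell_mean P H k \<ge> 0" for H by (simp add: mean)
    show ?thesis
    proof (rule that[of "1"])
      fix H :: nat assume "1 \<le> H"
      then show "- (\<Sum>j=1..d. ?L j) - (\<Sum>j=1..d. \<Sum>i\<in>{1..d} - {j}. ?V j i) \<le> padic_shell_mean P H k"
        using m0[of H] SL0 SV0 by linarith
    qed simp
  next
    fix j assume j: "j \<in> {1..d}" "of_int k * q \<in> low_window \<gamma> 1 ((real ?p)\<^sup>2 * (real d)\<^sup>2) j"
    have l1: "1 \<le> (\<Sum>j=1..d. ?L j)" using j member_le_sum[of j "{1..d}" ?L] by auto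
    show ?thesis
    proof (rule that[of "1"])
      fix H :: nat assume "1 \<le> H"
      then show "- (\<Sum>j=1..d. ?L j) - (\<Sum>j=1..d. \<Sum>i\<in>{1..d} - {j}. ?V j i) \<le> padic_shell_mean P H k"
        using l1 mean_ge[of H] SV0 by linarith
    qed simp
  next
    fix j i assume j: "j \<in> {1..d}" "i \<in> {1..d} - {j}" "of_int k * q \<in> tie_window \<gamma> (2 * real d) j i"
    have "1 \<le> (\<Sum>i\<in>{1..d} - {j}. ?V j i)" using j member_le_sum[of i "{1..d} - {j}" "?V j"] by auto
    also have "\<dots> \<le> (\<Sum>j=1..d. \<Sum>i\<in>{1..d} - {j}. ?V j i)"
      using j by (intro member_le_sum[of j "{1..d}" "\<lambda>j. \<Sum>i\<in>{1..d} - {j}. ?V j i"] sum_nonneg) auto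
    finally have v1: "1 \<le> (\<Sum>j=1..d. \<Sum>i\<in>{1..d} - {j}. ?V j i)" .
    show ?thesis
    proof (rule that[of "1"])
      fix H :: nat assume "1 \<le> H"
      then show "- (\<Sum>j=1..d. ?L j) - (\<Sum>j=1..d. \<Sum>i\<in>{1..d} - {j}. ?V j i) \<le> padic_shell_mean P H k"
        using v1 mean_ge[of H] SL0 by linarith
    qed simp
  next
    fix j assume j: "j \<in> {1..d}" "(real ?p)\<^sup>2 * (real d)\<^sup>2 \<le> \<gamma> j * exp (real j * (of_int k * q))"
      and dom: "\<And>i. i \<in> {1..d} - {j} \<Longrightarrow> 2 * real d * (\<gamma> i * exp (real i * (of_int k * q))) \<le> \<gamma> j * exp (real j * (of_int k * q))"
    let ?j = "padic_abs (of_nat j :: 'p padic)" and ?b = "\<lambda>i. padic_abs (Polynomial.coeff Q i)"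
    have bj: "(real ?p)\<^sup>2 * (real d)\<^sup>2 \<le> ?b j" using j(2) by (simp add: coeff)
    then have bj0: "?b j > 0" using one_le by linarith
    have d0: "real d > 0" using d by simp
    have jd: "1 / real d \<le> ?j"
    proof -
      have "1 / real d \<le> 1 / real j" using j(1) by (intro divide_left_mono) auto
      then show ?thesis using padic_abs_of_nat_ge[of j, where 'p='p] j(1) by simp
    qed
    have le: "2 * real d * ?b i \<le> ?b j" if "i \<noteq> j" for i
    proof -
      consider "i = 0" | "i \<in> {1..d} - {j}" | "i > d" using \<open>i \<noteq> j\<close> by force
      then show ?thesis
      proof cases
        case 1
        have "?b i \<le> ?b j" if i: "i \<in> {1..d}" for i
        proof (cases "i = j")
          case False
          have "1 * ?b i \<le> 2 * real d * ?b i" using one_le n by (intro mult_right_mono) auto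
          then show ?thesis using dom[of i] i False by (simp add: coeff)
        qed simp
        then show ?thesis using coeff0[of "?b j"] 1 by simp
      next
        case 2
        then show ?thesis using dom by (simp add: coeff)
      next
        case 3
        then show ?thesis using degQ bj0 by simp
      qed
    qed
    obtain H1 where H1: "?b j < real ?p ^ H1" using real_arch_pow[OF p1] by blast
    have m0: "padic_shell_mean P H k = 0" if H: "H \<ge> max 1 H1" for H
    proof -
      have "(\<Sum>u\<in>unit_residues ?p H. padic_char (poly Q (of_nat u))) = 0"
      proof (rule padic_shell_sum_eq_0[of j])
        show "?b i < ?j * ?b j" if "i \<noteq> j" for i
        proof -
          have "?b i \<le> ?b j / (2 * real d)" using le[OF that] d0 by (simp add: field_simps)
          also have "\<dots> < ?b j / d" using bj0 d0 by (simp add: field_simps)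
          also have "\<dots> \<le> ?j * ?b j" using mult_right_mono[OF jd, of "?b j"] bj0 by simp
          finally show ?thesis .
        qed
        have "(real ?p)\<^sup>2 = (1 / real d)\<^sup>2 * ((real ?p)\<^sup>2 * (real d)\<^sup>2)" using d0 by (simp add: field_simps)
        also have "\<dots> \<le> ?j\<^sup>2 * ?b j" using jd bj d0 n by (intro mult_mono power_mono) auto
        finally show "(real ?p)\<^sup>2 \<le> ?j\<^sup>2 * ?b j" .
        show "?b j \<le> real ?p ^ H"
        proof -
          have "real ?p ^ H1 \<le> real ?p ^ H" using p1 H by (intro power_increasing) auto
          then show ?thesis using H1 by linarith
        qed
      qed (use j H in auto)
      then show ?thesis by (simp add: mean)
    qed
    show ?thesis
    proof (rule that[of "max 1 H1"])
      fix H :: nat assume "max 1 H1 \<le> H"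
      then show "- (\<Sum>j=1..d. ?L j) - (\<Sum>j=1..d. \<Sum>i\<in>{1..d} - {j}. ?V j i) \<le> padic_shell_mean P H k"
        using m0[of H] SL0 SV0 by linarith
    qed simp
  qed
qed

text \<open>Each window contains a bounded number of multiples of \<open>q\<close>, so the shells
  that contribute negatively are bounded in number, whatever \<open>a\<close> and \<open>T\<close>
  are.\<close>

lemma padic_shell_means_sum_ge:
  fixes P :: "'p::prime_card padic poly"
  assumes d: "d \<ge> 1" "Polynomial.degree P \<le> d"
    and c0: "padic_abs (Polynomial.coeff P 0) \<le> K * (\<Sum>j=1..d. padic_abs (Polynomial.coeff P j))"
    and K: "K \<ge> 0" "2 * K * (real d)\<^sup>2 \<le> real CARD('p) powi a" and a: "a \<ge> 0"
  defines "q \<equiv> ln (real CARD('p))"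
  obtains H0 where "H0 \<ge> 1" "\<And>H. H \<ge> H0 \<Longrightarrow> (\<Sum>k=a..T. padic_shell_mean P H k) \<ge>
     - (d * (ln ((real CARD('p))\<^sup>2 * (real d)\<^sup>2) / q + 1) + d * (d * (ln (2 * real d) / q + 1)))"
proof -
  let ?p = "CARD('p)"
  define \<gamma> where "\<gamma> j = padic_abs (Polynomial.coeff P j)" for j
  let ?l = "(real ?p)\<^sup>2 * (real d)\<^sup>2"
  let ?L = "\<lambda>j. low_window \<gamma> 1 ?l j" and ?V = "\<lambda>j i. tie_window \<gamma> (2 * real d) j i"
  let ?pen = "\<lambda>k::int. (\<Sum>j=1..d. indicator (?L j) (of_int k * q)) + (\<Sum>j=1..d. \<Sum>i\<in>{1..d} - {j}. indicator (?V j i) (of_int k * q)) :: real"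
  note p1 = CARD_padic_gt_1[where 'p='p]
  have q: "q > 0" using p1 by (simp add: q_def)
  define pen where "pen k = ?pen k" for k
  have "\<forall>k\<in>{a..T}. \<exists>H0. H0 \<ge> 1 \<and> (\<forall>H\<ge>H0. padic_shell_mean P H k \<ge> - pen k)"
  proof
    fix k assume k: "k \<in> {a..T}"
    have "real ?p powi a \<le> real ?p powi k" using k p1 by (intro power_int_increasing) auto
    then have K': "2 * K * (real d)\<^sup>2 \<le> real ?p powi k" using K(2) by linarith
    obtain H0 where H0: "H0 \<ge> 1" "\<And>H. H \<ge> H0 \<Longrightarrow> padic_shell_mean P H k \<ge>
        - (\<Sum>j=1..d. indicator (?L j) (of_int k * q)) - (\<Sum>j=1..d. \<Sum>i\<in>{1..d} - {j}. indicator (?V j i) (of_int k * q))"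
      using padic_shell_mean_ge[OF d c0 K(1) K'] k a unfolding \<gamma>_def[abs_def] q_def by auto
    then show "\<exists>H0. H0 \<ge> 1 \<and> (\<forall>H\<ge>H0. padic_shell_mean P H k \<ge> - pen k)"
      by (intro exI[of _ H0]) (simp add: pen_def algebra_simps)
  qed
  from bchoice[OF this] obtain h where
    h: "\<forall>k\<in>{a..T}. h k \<ge> 1 \<and> (\<forall>H\<ge>h k. padic_shell_mean P H k \<ge> - pen k)" by blast
  \<comment> \<open>A single resolution that serves the finitely many shells.\<close>
  define H0 where "H0 = Max (insert 1 (h ` {a..T}))"
  have H0: "H0 \<ge> 1" "\<And>k. k \<in> {a..T} \<Longrightarrow> h k \<le> H0" unfolding H0_def by (intro Max_ge; auto)+
  have count: "(\<Sum>k=a..T. indicator (window \<sigma> u l) (of_int k * q) :: real) \<le> l / q + 1"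
    if "\<bar>\<sigma>\<bar> \<ge> 1" "l \<ge> 0" for \<sigma> u l
  proof -
    note cw = card_window[OF that q, of u]
    have "(\<Sum>k=a..T. indicator (window \<sigma> u l) (of_int k * q) :: real) =
        card {k \<in> {a..T}. of_int k * q \<in> window \<sigma> u l}"
      by (simp add: indicator_def sum.If_cases Int_def)
    also have "\<dots> \<le> card {k::int. of_int k * q \<in> window \<sigma> u l}"
      by (intro of_nat_mono card_mono cw(1)) auto
    also have "\<dots> \<le> l / q + 1" by (rule cw(2))
    finally show ?thesis .
  qed
  have one_le: "1 \<le> ?l" "1 \<le> 2 * real d"
  proof -
    have "1 \<le> real ?p * real d" using mult_mono[of 1 "real ?p" 1 "real d"] p1 d(1) by simp
    then show "1 \<le> ?l" by (simp add: one_le_power flip: power_mult_distrib)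
  qed (use d in simp)
  have L: "(\<Sum>k=a..T. indicator (?L j) (of_int k * q) :: real) \<le> ln ?l / q + 1" if "j \<in> {1..d}" for j
    unfolding low_window_def using count[of "real j" "ln (?l / 1)"] that one_le by simp
  have V: "(\<Sum>k=a..T. indicator (?V j i) (of_int k * q) :: real) \<le> ln (2 * real d) / q + 1" if "i \<noteq> j" for i j
  proof -
    have "\<bar>real i - real j\<bar> \<ge> 1" using that by (cases i j rule: linorder_cases) auto
    then show ?thesis unfolding tie_window_def using count[of "real i - real j" "ln (2 * real d)"] one_le by simp
  qed
  have "(\<Sum>k=a..T. ?pen k) = (\<Sum>j=1..d. \<Sum>k=a..T. indicator (?L j) (of_int k * q)) +
      (\<Sum>j=1..d. \<Sum>i\<in>{1..d} - {j}. \<Sum>k=a..T. indicator (?V j i) (of_int k * q))"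
    by (simp only: sum.distrib sum.swap[of _ "{a..T}"])
  also have "\<dots> \<le> (\<Sum>j=1..d. ln ?l / q + 1) + (\<Sum>j=1..d. \<Sum>i\<in>{1..d} - {j}. ln (2 * real d) / q + 1)"
    by (intro add_mono sum_mono L V) auto
  also have "\<dots> \<le> (\<Sum>j=1..d. ln ?l / q + 1) + (\<Sum>j=1..d. d * (ln (2 * real d) / q + 1))"
  proof (intro add_mono sum_mono order.refl)
    fix j
    have "(\<Sum>i\<in>{1..d} - {j}. ln (2 * real d) / q + 1) = card ({1..d} - {j}) * (ln (2 * real d) / q + 1)" by simp
    also have "\<dots> \<le> d * (ln (2 * real d) / q + 1)"
      using q one_le card_mono[of "{1..d}" "{1..d} - {j}"] by (intro mult_right_mono) auto
    finally show "(\<Sum>i\<in>{1..d} - {j}. ln (2 * real d) / q + 1) \<le> d * (ln (2 * real d) / q + 1)" .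
  qed
  also have "\<dots> = d * (ln ?l / q + 1) + d * (d * (ln (2 * real d) / q + 1))" by simp
  finally have pen: "(\<Sum>k=a..T. ?pen k) \<le> d * (ln ?l / q + 1) + d * (d * (ln (2 * real d) / q + 1))" .
  show ?thesis
  proof (rule that[OF H0(1)])
    fix H :: nat assume "H0 \<le> H"
    then have "(\<Sum>k=a..T. - pen k) \<le> (\<Sum>k=a..T. padic_shell_mean P H k)"
      using H0(2) h by (intro sum_mono) (meson order_trans)
    then show "(\<Sum>k=a..T. padic_shell_mean P H k) \<ge> - (d * (ln ?l / q + 1) + d * (d * (ln (2 * real d) / q + 1)))"
      using pen unfolding sum_negf pen_def by linarith
  qed
qed

section \<open>Haar measure of balls and polydiscs\<close>

lemma sets_padic_haar [simp]: "sets (padic_haar :: ('p::prime_card padic ^ 'm::finite) measure) = sets borel"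
proof -
  have "padic_haar_measure (padic_haar :: ('p padic ^ 'm) measure)" by (rule padic_haar)
  then show ?thesis unfolding padic_haar_measure_def by (rule conjunct1)
qed

lemma space_padic_haar [simp]: "space (padic_haar :: ('p::prime_card padic ^ 'm::finite) measure) = UNIV"
  using sets_eq_imp_space_eq[OF sets_padic_haar] by simp

lemma emeasure_padic_polydisc_0: "emeasure padic_haar (padic_polydisc (c :: 'p::prime_card padic ^ 'm::finite) n) =
    emeasure padic_haar (padic_polydisc (0 :: 'p padic ^ 'm) n)"
proof -
  have haar: "padic_haar_measure (padic_haar :: ('p padic ^ 'm) measure)" by (rule padic_haar)
  have eq: "padic_polydisc c n = (+) c ` padic_polydisc 0 n"
  proof (intro equalityI subsetI)
    fix y assume "y \<in> padic_polydisc c n"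
    then show "y \<in> (+) c ` padic_polydisc 0 n"
      by (intro image_eqI[of _ _ "y - c"]) (auto simp: padic_polydisc_def)
  qed (auto simp: padic_polydisc_def)
  have "padic_polydisc (0 :: 'p padic ^ 'm) n \<in> sets borel" by (intro borel_open open_padic_polydisc)
  then show ?thesis unfolding eq using haar unfolding padic_haar_measure_def by blast
qed

text \<open>A ball for the supremum norm; by the ultrametric inequality it is a subgroup.\<close>

definition padic_ball :: "nat \<Rightarrow> ('p::prime_card padic ^ 'm::finite) set" where
  "padic_ball N = {x. \<forall>i. padic_abs (x $ i) \<le> real CARD('p) ^ N}"

lemma padic_ball_add: "x \<in> padic_ball N \<Longrightarrow> y \<in> padic_ball N \<Longrightarrow> x + y \<in> padic_ball N"
  unfolding padic_ball_def mem_Collect_eq vector_add_component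
  by (intro allI order_trans[OF padic_abs_ultrametric] max.boundedI; blast)

lemma padic_ball_diff: "x \<in> padic_ball N \<Longrightarrow> y \<in> padic_ball N \<Longrightarrow> x - y \<in> padic_ball N"
  unfolding padic_ball_def mem_Collect_eq vector_minus_component
  by (intro allI order_trans[OF padic_abs_diff_le] max.boundedI; blast)

lemma padic_ball_eq_polydiscs:
  "(padic_ball N :: ('p::prime_card padic ^ 'm::finite) set) =
     (\<Union>F\<in>UNIV \<rightarrow>\<^sub>E {..<CARD('p) ^ (N + n)}. padic_polydisc (\<chi> i. of_nat (F i) / of_nat CARD('p) ^ N) n)"
proof (intro equalityI subsetI)
  let ?p = "CARD('p)"
  note p1 = CARD_padic_gt_1[where 'p='p]
  fix x :: "'p padic ^ 'm"
  {
    assume "x \<in> padic_ball N"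
    then have "\<forall>i. \<exists>j<?p ^ (N + n). padic_abs (x $ i - of_nat j / of_nat ?p ^ N) \<le> 1 / real ?p ^ n"
      unfolding padic_ball_def using padic_ball_digits by blast
    then obtain F where "\<And>i. F i < ?p ^ (N + n)" "\<And>i. padic_abs (x $ i - of_nat (F i) / of_nat ?p ^ N) \<le> 1 / real ?p ^ n"
      by metis
    then show "x \<in> (\<Union>F\<in>UNIV \<rightarrow>\<^sub>E {..<?p ^ (N + n)}. padic_polydisc (\<chi> i. of_nat (F i) / of_nat ?p ^ N) n)"
      by (intro UN_I[of F]) (auto simp: padic_polydisc_def)
  next
    assume "x \<in> (\<Union>F\<in>UNIV \<rightarrow>\<^sub>E {..<?p ^ (N + n)}. padic_polydisc (\<chi> i. of_nat (F i) / of_nat ?p ^ N) n)"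
    then obtain F :: "'m \<Rightarrow> nat" where F: "\<And>i. padic_abs (x $ i - of_nat (F i) / of_nat ?p ^ N) \<le> 1 / real ?p ^ n"
      by (auto simp: padic_polydisc_def)
    have "padic_abs (x $ i) \<le> real ?p ^ N" for i
    proof -
      have "padic_abs (of_nat (F i) / of_nat ?p ^ N :: 'p padic) = padic_abs (of_nat (F i) :: 'p padic) * real ?p ^ N"
        by (simp add: padic_abs_divide padic_abs_power padic_abs_CARD power_one_over)
      also have "\<dots> \<le> 1 * real ?p ^ N" by (intro mult_right_mono padic_abs_of_nat_le_1) simp
      finally have 1: "padic_abs (of_nat (F i) / of_nat ?p ^ N :: 'p padic) \<le> real ?p ^ N" by simp
      have "1 / real ?p ^ n \<le> 1" "1 \<le> real ?p ^ N" using p1 by (simp_all add: one_le_power)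
      then have "padic_abs (x $ i - of_nat (F i) / of_nat ?p ^ N) \<le> real ?p ^ N" using F[of i] by linarith
      then show ?thesis
        using 1 padic_abs_ultrametric[of "x $ i - of_nat (F i) / of_nat ?p ^ N" "of_nat (F i) / of_nat ?p ^ N"] by simp
    qed
    then show "x \<in> padic_ball N" by (simp add: padic_ball_def)
  }
qed

text \<open>Two of these polydiscs that meet coincide, which forces \<open>F i\<close> and
  \<open>G i\<close> to agree modulo \<open>p ^ (N + n)\<close>; both are below this
  modulus.\<close>

lemma disjoint_padic_polydiscs:
  "disjoint_family_on (\<lambda>F. padic_polydisc ((\<chi> i. of_nat (F i) / of_nat CARD('p) ^ N) :: 'p::prime_card padic ^ 'm::finite) n)
     (UNIV \<rightarrow>\<^sub>E {..<CARD('p) ^ (N + n)})"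
  unfolding disjoint_family_on_def
proof (intro ballI impI, rule ccontr)
  let ?p = "CARD('p)"
  note p1 = CARD_padic_gt_1[where 'p='p]
  let ?c = "\<lambda>F. (\<chi> i. of_nat (F i) / of_nat CARD('p) ^ N) :: 'p padic ^ 'm"
  fix F G assume FG: "F \<in> UNIV \<rightarrow>\<^sub>E {..<?p ^ (N + n)}" "G \<in> UNIV \<rightarrow>\<^sub>E {..<?p ^ (N + n)}" "F \<noteq> G"
    and ne: "padic_polydisc (?c F) n \<inter> padic_polydisc (?c G) n \<noteq> {}"
  then obtain z where z: "z \<in> padic_polydisc (?c F) n" "z \<in> padic_polydisc (?c G) n" by blast
  have "?c F \<in> padic_polydisc (?c G) n"
    using padic_polydisc_eqI[OF z(1)] padic_polydisc_eqI[OF z(2)] centre_in_padic_polydisc by metis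
  then have le: "padic_abs (of_nat (F i) / of_nat ?p ^ N - of_nat (G i) / of_nat ?p ^ N :: 'p padic) \<le> 1 / real ?p ^ n" for i
    by (simp add: padic_polydisc_def)
  have "F i = G i" for i
  proof -
    have eq: "of_nat (F i) / of_nat ?p ^ N - of_nat (G i) / of_nat ?p ^ N =
        (of_int (int (F i) - int (G i)) :: 'p padic) / of_nat ?p ^ N"
      by (simp add: diff_divide_distrib)
    have "padic_abs (of_int (int (F i) - int (G i)) :: 'p padic) * real ?p ^ N \<le> 1 / real ?p ^ n"
      using le[of i] unfolding eq by (simp add: padic_abs_divide padic_abs_power padic_abs_CARD power_one_over)
    then have "padic_abs (of_int (int (F i) - int (G i)) :: 'p padic) \<le> 1 / real ?p ^ (N + n)"
      using p1 by (simp add: field_simps power_add)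
    then have dvd: "int ?p ^ (N + n) dvd int (F i) - int (G i)" unfolding padic_abs_of_int_le_iff .
    have "F i < ?p ^ (N + n)" "G i < ?p ^ (N + n)" using FG by auto
    then have "int (F i) < int (?p ^ (N + n))" "int (G i) < int (?p ^ (N + n))" by (simp_all only: of_nat_less_iff)
    then have lt: "\<bar>int (F i) - int (G i)\<bar> < int ?p ^ (N + n)" unfolding of_nat_power by linarith
    have "int (F i) - int (G i) = 0"
    proof (rule ccontr)
      assume "int (F i) - int (G i) \<noteq> 0"
      from dvd_imp_le_int[OF this dvd] show False using lt by simp
    qed
    then show ?thesis by simp
  qed
  then show False using FG(3) by blast
qed

lemma borel_padic_polydisc [simp]: "padic_polydisc (c :: 'p::prime_card padic ^ 'm::finite) n \<in> sets borel"
  by (intro borel_open open_padic_polydisc)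

lemma borel_padic_ball [simp]: "(padic_ball N :: ('p::prime_card padic ^ 'm::finite) set) \<in> sets borel"
  unfolding padic_ball_eq_polydiscs[of N 0] by (intro sets.finite_UN) auto

text \<open>The depth \<open>n\<close> is free: \<open>n = 0\<close> connects the ball with the
  normalisation of the measure, while the depth of the kernel identifies the mass of the kernel with
  the measure of the ball.\<close>

lemma emeasure_padic_ball:
  "emeasure padic_haar (padic_ball N :: ('p::prime_card padic ^ 'm::finite) set) =
     of_nat (card (UNIV \<rightarrow>\<^sub>E {..<CARD('p) ^ (N + n)} :: ('m \<Rightarrow> nat) set)) *
     emeasure padic_haar (padic_polydisc (0 :: 'p padic ^ 'm) n)"
proof -
  have "emeasure padic_haar (padic_ball N :: ('p padic ^ 'm) set) =
     (\<Sum>F\<in>UNIV \<rightarrow>\<^sub>E {..<CARD('p) ^ (N + n)}. emeasure padic_haar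
        (padic_polydisc ((\<chi> i. of_nat (F i) / of_nat CARD('p) ^ N) :: 'p padic ^ 'm) n))"
    unfolding padic_ball_eq_polydiscs[of N n]
    by (intro sum_emeasure[symmetric] disjoint_padic_polydiscs finite_residue_functions) auto
  also have "\<dots> = (\<Sum>F\<in>(UNIV \<rightarrow>\<^sub>E {..<CARD('p) ^ (N + n)} :: ('m \<Rightarrow> nat) set). emeasure padic_haar (padic_polydisc (0 :: 'p padic ^ 'm) n))"
    by (intro sum.cong refl emeasure_padic_polydisc_0)
  finally show ?thesis by simp
qed

lemma emeasure_unit_polydisc: "emeasure padic_haar (padic_polydisc (0 :: 'p::prime_card padic ^ 'm::finite) 0) = 1"
proof -
  have "padic_haar_measure (padic_haar :: ('p padic ^ 'm) measure)" by (rule padic_haar)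
  then show ?thesis unfolding padic_haar_measure_def padic_polydisc_def by simp
qed

lemma emeasure_padic_ball_finite: "emeasure padic_haar (padic_ball N :: ('p::prime_card padic ^ 'm::finite) set) < \<infinity>"
  unfolding emeasure_padic_ball[of N 0] emeasure_unit_polydisc
  by (simp add: ennreal_of_nat_eq_real_of_nat)

lemma measure_padic_ball_pos: "measure padic_haar (padic_ball N :: ('p::prime_card padic ^ 'm::finite) set) > 0"
proof -
  have "(\<lambda>_. 0) \<in> (UNIV \<rightarrow>\<^sub>E {..<CARD('p) ^ (N + 0)} :: ('m \<Rightarrow> nat) set)"
    using CARD_padic_gt_1[where 'p='p] by auto
  then have "card (UNIV \<rightarrow>\<^sub>E {..<CARD('p) ^ (N + 0)} :: ('m \<Rightarrow> nat) set) > 0"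
    using card_gt_0_iff finite_residue_functions by blast
  then show ?thesis
    unfolding measure_def emeasure_padic_ball[of N 0] emeasure_unit_polydisc
    by (simp add: ennreal_of_nat_eq_real_of_nat)
qed

section \<open>Characters of vectors and their orthogonality\<close>

lemma continuous_on_padic_char: "continuous_on A (padic_char :: 'p::prime_card padic \<Rightarrow> complex)"
  unfolding continuous_on_iff
proof (intro ballI allI impI)
  fix x :: "'p padic" and e :: real assume "e > 0"
  have "dist (padic_char y) (padic_char x) < e" if "dist y x < 1" for y
  proof -
    have "padic_char y = padic_char x" using that by (intro padic_char_cong) (simp add: dist_padic_def)
    then show ?thesis using \<open>e > 0\<close> by simp
  qed
  then show "\<exists>d>0. \<forall>y\<in>A. dist y x < d \<longrightarrow> dist (padic_char y) (padic_char x) < e"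
    by (intro exI[of _ 1] conjI ballI impI) simp_all
qed

text \<open>The value of \<open>padic_char\<close> at the dot product of \<theta> and
  \<open>x\<close>, written as a product so that sums over boxes of frequencies factor into
  coordinates.\<close>

definition padic_vec_char :: "'p::prime_card padic ^ 'm::finite \<Rightarrow> 'p padic ^ 'm \<Rightarrow> complex" where
  "padic_vec_char \<theta> x = (\<Prod>i\<in>UNIV. padic_char (\<theta> $ i * x $ i))"

lemma padic_vec_char_add: "padic_vec_char \<theta> (x + y) = padic_vec_char \<theta> x * padic_vec_char \<theta> y"
  unfolding padic_vec_char_def vector_add_component distrib_left padic_char_add prod.distrib ..

lemma norm_padic_vec_char: "norm (padic_vec_char \<theta> x) = 1"
  unfolding padic_vec_char_def by (subst prod_norm[symmetric]) (simp only: norm_padic_char prod.neutral_const)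

lemma continuous_on_padic_vec_char: "continuous_on A (padic_vec_char (\<theta> :: 'p::prime_card padic ^ 'm::finite))"
proof -
  have "continuous_on A (\<lambda>x. padic_char (poly [:0, \<theta> $ i:] (x $ i)))" for i
    by (intro continuous_on_compose2[OF continuous_on_padic_char] continuous_on_compose2[OF continuous_on_poly_padic]
        continuous_on_component continuous_on_id) auto
  then have "continuous_on A (\<lambda>x. \<Prod>i\<in>UNIV. padic_char (\<theta> $ i * x $ i))"
    by (intro continuous_on_prod) (simp add: mult.commute)
  then show ?thesis by (simp add: padic_vec_char_def[abs_def])
qed

lemma padic_vec_char_poly_curve:
  "padic_vec_char \<theta> (poly_curve f s) = padic_char (poly (dot_poly f \<theta>) s)"
proof -
  have "padic_char (\<Sum>i\<in>A. g i) = (\<Prod>i\<in>A. padic_char (g i))" if "finite A" for A :: "'b set" and g :: "'b \<Rightarrow> 'a padic"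
    using that by (induction A) (simp_all add: padic_char_add)
  then show ?thesis by (simp add: padic_vec_char_def poly_curve_def poly_dot_poly)
qed

text \<open>Orthogonality on the finite quotient of the ball by the polydisc, which has
  \<open>p ^ (N + n)\<close> elements per coordinate. So within the ball the kernel is a multiple of
  an indicator and has no tail.\<close>

lemma sum_padic_vec_char:
  assumes z: "z \<in> padic_ball N"
  shows "(\<Sum>F\<in>UNIV \<rightarrow>\<^sub>E {..<CARD('p) ^ (N + n)}. padic_vec_char (\<chi> i. of_nat (F i) / of_nat CARD('p) ^ n) z) =
    (if z \<in> padic_polydisc (0 :: 'p::prime_card padic ^ 'm::finite) n
     then of_nat (card (UNIV \<rightarrow>\<^sub>E {..<CARD('p) ^ (N + n)} :: ('m \<Rightarrow> nat) set)) else 0)"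
proof -
  let ?p = "CARD('p)"
  note p1 = CARD_padic_gt_1[where 'p='p]
  have abs_le: "padic_abs (y / of_nat ?p ^ n) \<le> 1 \<longleftrightarrow> padic_abs y \<le> 1 / real ?p ^ n" for y :: "'p padic"
    using p1 by (simp add: padic_abs_divide padic_abs_power padic_abs_CARD power_one_over field_simps)
  have "(\<Sum>F\<in>UNIV \<rightarrow>\<^sub>E {..<?p ^ (N + n)}. padic_vec_char (\<chi> i. of_nat (F i) / of_nat ?p ^ n) z) =
      (\<Sum>F\<in>UNIV \<rightarrow>\<^sub>E {..<?p ^ (N + n)}. \<Prod>i\<in>UNIV. padic_char (of_nat (F i) * (z $ i / of_nat ?p ^ n)))"
    by (simp add: padic_vec_char_def)
  also have "\<dots> = (\<Prod>i\<in>UNIV. \<Sum>j<?p ^ (N + n). padic_char (of_nat j * (z $ i / of_nat ?p ^ n)))"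
    by (rule prod_sum_PiE[symmetric]) auto
  also have "\<dots> = (\<Prod>i\<in>(UNIV :: 'm set). if padic_abs (z $ i) \<le> 1 / real ?p ^ n then of_nat (?p ^ (N + n)) else 0)"
  proof (rule prod.cong[OF refl])
    fix i
    have "padic_abs (of_nat (?p ^ (N + n)) * (z $ i / of_nat ?p ^ n)) = (1 / real ?p ^ N) * padic_abs (z $ i)"
      using p1 by (simp add: padic_abs_mult padic_abs_divide padic_abs_power padic_abs_CARD power_one_over power_add field_simps)
    also have "\<dots> \<le> (1 / real ?p ^ N) * real ?p ^ N"
      using z by (intro mult_left_mono) (auto simp: padic_ball_def)
    also have "\<dots> = 1" using p1 by simp
    finally show "(\<Sum>j<?p ^ (N + n). padic_char (of_nat j * (z $ i / of_nat ?p ^ n))) =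
        (if padic_abs (z $ i) \<le> 1 / real ?p ^ n then of_nat (?p ^ (N + n)) else 0)"
      by (simp only: padic_char_sum abs_le)
  qed
  also have "\<dots> = (if z \<in> padic_polydisc 0 n then of_nat ((?p ^ (N + n)) ^ CARD('m)) else 0)"
    by (auto simp: padic_polydisc_def prod_zero_iff)
  also have "(?p ^ (N + n)) ^ CARD('m) = card (UNIV \<rightarrow>\<^sub>E {..<?p ^ (N + n)} :: ('m \<Rightarrow> nat) set)"
    by (simp add: card_PiE)
  finally show ?thesis .
qed

text \<open>The kernel vanishes on \<open>J - J + D\<close>, and its integral over a translate of
  \<open>J\<close> is at most the measure of the ball \<open>G\<close>. Averaging over the shells
  gives \<open>|J|\<^sup>2 (T - a + 1) \<le> C |G| |J|\<close>; the factor 2 in the conclusion comes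
  from passing to the compact set \<open>J\<close>.\<close>

lemma padic_independent_bound:
  fixes f :: "'m::finite \<Rightarrow> 'p::prime_card padic poly" and I :: "('p padic ^ 'm) set"
  assumes d: "d \<ge> 1" "\<And>i. Polynomial.degree (f i) \<le> d"
    and g: "\<And>\<theta>. Polynomial.coeff (dot_poly f \<theta>) 0 = (\<Sum>j=1..d. g j * Polynomial.coeff (dot_poly f \<theta>) j)"
    and a: "a \<ge> 0" "2 * (\<Sum>j=1..d. padic_abs (g j)) * (real d)\<^sup>2 \<le> real CARD('p) powi a" "a < T"
    and nz: "\<And>s. real CARD('p) powi a \<le> padic_abs s \<Longrightarrow> poly_curve f s \<noteq> 0"
    and I: "borel_independent (cayley_graph (curve_set padic_abs f (real CARD('p) powi a) (real CARD('p) powi T))) I"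
    and N: "\<And>s. padic_abs s \<le> real CARD('p) powi T \<Longrightarrow> poly_curve f s \<in> padic_ball N"
  defines "q \<equiv> ln (real CARD('p))"
  defines "C \<equiv> d * (ln ((real CARD('p))\<^sup>2 * (real d)\<^sup>2) / q + 1) + d * (d * (ln (2 * real d) / q + 1))"
  shows "measure padic_haar (I \<inter> padic_ball N) \<le> 2 * C / of_int (T - a) * measure padic_haar (padic_ball N :: ('p padic ^ 'm) set)"
proof -
  let ?p = "CARD('p)" and ?M = "padic_haar :: ('p padic ^ 'm) measure"
  let ?G = "padic_ball N :: ('p padic ^ 'm) set"
  note p1 = CARD_padic_gt_1[where 'p='p]
  define D where "D = poly_curve f ` {s. real ?p powi a \<le> padic_abs s \<and> padic_abs s \<le> real ?p powi T}"
  have C0: "C \<ge> 0"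
  proof -
    have "1 \<le> real ?p * real d" using mult_mono[of 1 "real ?p" 1 "real d"] p1 d(1) by simp
    then have "1 \<le> (real ?p)\<^sup>2 * (real d)\<^sup>2" "1 \<le> 2 * real d"
      using d by (simp_all add: one_le_power flip: power_mult_distrib)
    then show ?thesis unfolding C_def q_def using p1 by (intro add_nonneg_nonneg mult_nonneg_nonneg divide_nonneg_nonneg ln_ge_zero) auto
  qed
  have compactD: "compact D"
    unfolding D_def
  proof (intro compact_continuous_image compact_padic_annulus)
    show "continuous_on {s. real ?p powi a \<le> padic_abs s \<and> padic_abs s \<le> real ?p powi T} (poly_curve f)"
      unfolding poly_curve_def[abs_def] by (intro continuous_on_vec_lambda continuous_on_poly_padic)
  qed
  have Ib: "I \<in> sets borel" using I by (simp add: borel_independent_def)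
  have IG: "I \<inter> ?G \<in> sets borel" "emeasure ?M (I \<inter> ?G) < \<infinity>"
    using Ib emeasure_mono[of "I \<inter> ?G" ?G ?M] emeasure_padic_ball_finite[of N, where 'p='p and 'm='m]
    by (auto simp: le_less_trans)
  obtain J where J: "compact J" "J \<subseteq> I \<inter> ?G" "measure ?M (I \<inter> ?G) / 2 \<le> measure ?M J"
    using compact_subset_half_measure[OF sets_padic_haar IG] by blast
  have Jb: "J \<in> sets ?M" using J(1) by (simp add: borel_compact)
  have "emeasure ?M J \<le> emeasure ?M (I \<inter> ?G)" using J(2) IG(1) by (intro emeasure_mono) auto
  then have Jf: "emeasure ?M J < \<infinity>" using IG(2) by simp
  \<comment> \<open>Orthogonality holds inside the ball only; as the ball is a subgroup,
    \<open>x - y + v\<close> stays there.\<close>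
  have DG: "D \<subseteq> ?G" unfolding D_def using N by blast
  have "x - y + v \<noteq> 0" if xyv: "x \<in> J" "y \<in> J" "v \<in> D" for x y v
  proof
    assume "x - y + v = 0"
    then have v: "v = y - x" by (simp add: algebra_simps eq_neg_iff_add_eq_0)
    obtain s where s: "real ?p powi a \<le> padic_abs s" "padic_abs s \<le> real ?p powi T" "v = poly_curve f s"
      using xyv(3) by (auto simp: D_def)
    have "v \<in> curve_set padic_abs f (real ?p powi a) (real ?p powi T)"
      using s(1,2) nz[OF s(1)] unfolding curve_set_def s(3) by (intro CollectI conjI exI[of _ s]) auto
    then have "(y, x) \<in> cayley_graph (curve_set padic_abs f (real ?p powi a) (real ?p powi T))"
      by (simp add: cayley_graph_def v)
    then show False using I xyv J(2) unfolding borel_independent_def by blast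
  qed
  then obtain n where n: "\<And>x y v. x \<in> J \<Longrightarrow> y \<in> J \<Longrightarrow> v \<in> D \<Longrightarrow> x - y + v \<notin> padic_polydisc 0 n"
    using compact_differences_avoid_polydisc[OF J(1) compactD] by blast
  define \<Xi> where "\<Xi> = (UNIV \<rightarrow>\<^sub>E {..<?p ^ (N + n)} :: ('m \<Rightarrow> nat) set)"
  define \<theta> :: "('m \<Rightarrow> nat) \<Rightarrow> 'p padic ^ 'm" where "\<theta> F = (\<chi> i. of_nat (F i) / of_nat ?p ^ n)" for F
  define K where "K z = Re (\<Sum>F\<in>\<Xi>. 1 * padic_vec_char (\<theta> F) z)" for z
  have K: "K z = (if z \<in> padic_polydisc 0 n then card \<Xi> else 0)" if "z \<in> ?G" for z
    using sum_padic_vec_char[OF that, of n] by (simp add: K_def \<theta>_def \<Xi>_def)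
  have JG: "x - y \<in> ?G" if "x \<in> J" "y \<in> J" for x y using that J(2) by (intro padic_ball_diff) auto
  have meas: "padic_vec_char (\<theta> F) \<in> borel_measurable ?M" for F
    using borel_measurable_continuous_onI[OF continuous_on_padic_vec_char]
    by (simp add: measurable_def)
  have z: "padic_vec_char (\<theta> (\<lambda>_. 0)) x = 1" for x by (simp add: \<theta>_def padic_vec_char_def)
  have Kz: "K z = Re (\<Sum>F\<in>\<Xi>. complex_of_real 1 * padic_vec_char (\<theta> F) z)" for z by (simp add: K_def)
  have small: "K (x - y + v) \<le> 0" if "x \<in> J" "y \<in> J" "v \<in> D" for x y v
  proof -
    have "x - y + v \<in> ?G" using JG that DG by (intro padic_ball_add) auto
    then show ?thesis using K n[OF that] by simp
  qed
  have mass: "(LINT x:J|?M. K (x - y)) \<le> measure ?M ?G" if y: "y \<in> J" for y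
  proof -
    have disc: "x - y \<in> padic_polydisc 0 n \<longleftrightarrow> x \<in> padic_polydisc y n" for x
      by (simp add: padic_polydisc_def)
    have "(LINT x:J|?M. K (x - y)) = (LINT x|?M. real (card \<Xi>) * indicator (J \<inter> padic_polydisc y n) x)"
      unfolding set_lebesgue_integral_def using K[OF JG[OF _ y]]
      by (intro Bochner_Integration.integral_cong refl) (auto simp: indicator_def disc)
    also have "\<dots> = real (card \<Xi>) * measure ?M (J \<inter> padic_polydisc y n)" by simp
    also have "\<dots> \<le> real (card \<Xi>) * measure ?M (padic_polydisc 0 n)"
    proof (intro mult_left_mono)
      have fin: "emeasure ?M (padic_polydisc 0 n) \<noteq> \<infinity>"
      proof -
        have "emeasure ?M (padic_polydisc 0 n) \<le> emeasure ?M (padic_polydisc 0 0)"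
          by (intro emeasure_mono padic_polydisc_mono) auto
        then show ?thesis by (auto simp: emeasure_unit_polydisc top_unique)
      qed
      have "measure ?M (J \<inter> padic_polydisc y n) \<le> measure ?M (padic_polydisc y n)"
        using fin Jb by (intro measure_mono_fmeasurable fmeasurableI) (auto simp: emeasure_padic_polydisc_0[of y] less_top)
      then show "measure ?M (J \<inter> padic_polydisc y n) \<le> measure ?M (padic_polydisc 0 n)"
        by (simp add: measure_def emeasure_padic_polydisc_0[of y])
    qed simp
    also have "\<dots> = measure ?M ?G"
      by (simp add: measure_def emeasure_padic_ball[of N n] \<Xi>_def enn2real_mult ennreal_of_nat_eq_real_of_nat)
    finally show ?thesis .
  qed
  obtain b where b: "\<And>F. F \<in> \<Xi> \<Longrightarrow> b F \<ge> 0" "b (\<lambda>_. 0) = 1 * (measure ?M J)\<^sup>2"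
    "sum b \<Xi> \<le> measure ?M ?G * measure ?M J"
    "\<And>v. v \<in> D \<Longrightarrow> (\<Sum>F\<in>\<Xi>. b F * Re (padic_vec_char (\<theta> F) v)) \<le> 0 * (measure ?M J)\<^sup>2"
    by (rule spectral_weights[OF Jb Jf meas padic_vec_char_add norm_padic_vec_char zero_le_one z Kz small mass order.refl measure_nonneg])
      blast+
  have means: "\<exists>H0\<ge>1. \<forall>H\<ge>H0. (\<Sum>k=a..T. padic_shell_mean (dot_poly f (\<theta> F)) H k) \<ge> - C" for F
  proof -
    have deg: "Polynomial.degree (dot_poly f (\<theta> F)) \<le> d"
      unfolding dot_poly_def using d(2) by (intro degree_sum_le) (auto intro: order_trans[OF degree_smult_le])
    have "padic_abs (Polynomial.coeff (dot_poly f (\<theta> F)) 0) \<le>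
        (\<Sum>j=1..d. padic_abs (g j)) * (\<Sum>j=1..d. padic_abs (Polynomial.coeff (dot_poly f (\<theta> F)) j))"
      unfolding g
    proof (rule padic_abs_sum_le)
      fix j assume j: "j \<in> {1..d}"
      have "padic_abs (g j) \<le> (\<Sum>j=1..d. padic_abs (g j))"
        "padic_abs (Polynomial.coeff (dot_poly f (\<theta> F)) j) \<le> (\<Sum>j=1..d. padic_abs (Polynomial.coeff (dot_poly f (\<theta> F)) j))"
        using j by (intro member_le_sum; auto simp: padic_abs_nonneg)+
      then show "padic_abs (g j * Polynomial.coeff (dot_poly f (\<theta> F)) j) \<le>
          (\<Sum>j=1..d. padic_abs (g j)) * (\<Sum>j=1..d. padic_abs (Polynomial.coeff (dot_poly f (\<theta> F)) j))"
        unfolding padic_abs_mult by (intro mult_mono padic_abs_nonneg sum_nonneg)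
    qed (intro mult_nonneg_nonneg sum_nonneg padic_abs_nonneg)
    from padic_shell_means_sum_ge[OF d(1) deg this _ a(2) a(1), of T]
    show ?thesis unfolding C_def q_def
      by (metis (no_types, lifting) padic_abs_nonneg sum_nonneg)
  qed
  then obtain h where h: "\<And>F. h F \<ge> 1" "\<And>F H. H \<ge> h F \<Longrightarrow> (\<Sum>k=a..T. padic_shell_mean (dot_poly f (\<theta> F)) H k) \<ge> - C"
    by metis
  have \<Xi>: "finite \<Xi>" "(\<lambda>_. 0) \<in> \<Xi>" using p1 by (auto simp: \<Xi>_def)
  \<comment> \<open>All frequencies must be sampled at the same points, so that the inequality along
    the curve can be summed; this is possible because there are finitely many.\<close>
  define H where "H = Max (insert 1 (h ` \<Xi>))"
  have H: "H \<ge> 1" "\<And>F. F \<in> \<Xi> \<Longrightarrow> h F \<le> H" unfolding H_def using \<Xi>(1) by (intro Max_ge; auto)+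
  let ?U = "unit_residues ?p H"
  have cU: "card ?U > 0" using card_unit_residues_pos[of ?p H] H(1) p1 by simp
  have "(\<Sum>F\<in>\<Xi>. b F * (\<Sum>k=a..T. padic_shell_mean (dot_poly f (\<theta> F)) H k)) =
      (\<Sum>k=a..T. (\<Sum>u\<in>?U. \<Sum>F\<in>\<Xi>. b F * Re (padic_vec_char (\<theta> F) (poly_curve f (of_nat u / of_nat ?p powi k)))) / card ?U)"
    unfolding padic_shell_mean_def padic_vec_char_poly_curve
    by (simp add: sum_distrib_left sum_divide_distrib sum.swap[of _ \<Xi>] mult_ac)
  also have "\<dots> \<le> (\<Sum>k=a..T. (\<Sum>u\<in>?U. 0) / card ?U)"
  proof (intro sum_mono divide_right_mono)
    fix k u assume k: "k \<in> {a..T}" and u: "u \<in> ?U"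
    have "padic_abs (of_nat u :: 'p padic) = 1"
      using padic_abs_of_int_not_dvd[of "int u", where 'p='p] u by (simp add: unit_residues_def)
    then have "padic_abs (of_nat u / of_nat ?p powi k :: 'p padic) = real ?p powi k"
      by (simp add: padic_abs_divide padic_abs_power_int padic_abs_CARD power_int_divide_distrib)
    moreover have "real ?p powi a \<le> real ?p powi k" "real ?p powi k \<le> real ?p powi T"
      using k p1 by (auto intro!: power_int_increasing)
    ultimately have "poly_curve f (of_nat u / of_nat ?p powi k) \<in> D" unfolding D_def by (intro imageI) simp
    from b(4)[OF this] show "(\<Sum>F\<in>\<Xi>. b F * Re (padic_vec_char (\<theta> F) (poly_curve f (of_nat u / of_nat ?p powi k)))) \<le> 0" by simp
  qed simp
  finally have total: "(\<Sum>F\<in>\<Xi>. b F * (\<Sum>k=a..T. padic_shell_mean (dot_poly f (\<theta> F)) H k)) \<le> 0" by simp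
  \<comment> \<open>There are \<open>T - a + 1\<close> shells from \<open>a\<close> to
    \<open>T\<close>; the surplus 1 is given away at the end.\<close>
  have zero: "(\<Sum>k=a..T. padic_shell_mean (dot_poly f (\<theta> (\<lambda>_. 0))) H k) = of_int (T - a + 1)"
  proof -
    have "\<theta> (\<lambda>_. 0) = 0" by (simp add: \<theta>_def vec_eq_iff)
    then have "dot_poly f (\<theta> (\<lambda>_. 0)) = 0" by (simp add: dot_poly_def)
    moreover have "?U \<noteq> {}" using cU by auto
    ultimately show ?thesis using a(3) by (simp add: padic_shell_mean_def)
  qed
  have "(\<Sum>F\<in>\<Xi> - {\<lambda>_. 0}. b F * - C) \<le> (\<Sum>F\<in>\<Xi> - {\<lambda>_. 0}. b F * (\<Sum>k=a..T. padic_shell_mean (dot_poly f (\<theta> F)) H k))"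
    using b(1) h(2) H(2) by (intro sum_mono mult_left_mono) auto
  then have "(measure ?M J)\<^sup>2 * of_int (T - a + 1) + (\<Sum>F\<in>\<Xi> - {\<lambda>_. 0}. b F * - C) \<le> 0"
    using total unfolding sum.remove[OF \<Xi>] zero b(2) by simp
  moreover have "(\<Sum>F\<in>\<Xi> - {\<lambda>_. 0}. b F * - C) = - (C * (\<Sum>F\<in>\<Xi> - {\<lambda>_. 0}. b F))"
    by (simp add: sum_distrib_left mult.commute sum_negf)
  moreover have "C * (\<Sum>F\<in>\<Xi> - {\<lambda>_. 0}. b F) \<le> C * (measure ?M ?G * measure ?M J)"
  proof (rule mult_left_mono[OF _ C0])
    have "sum b \<Xi> = b (\<lambda>_. 0) + (\<Sum>F\<in>\<Xi> - {\<lambda>_. 0}. b F)" by (rule sum.remove[OF \<Xi>])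
    then show "(\<Sum>F\<in>\<Xi> - {\<lambda>_. 0}. b F) \<le> measure ?M ?G * measure ?M J"
      using b(1)[OF \<Xi>(2)] b(3) by linarith
  qed
  ultimately have main: "(measure ?M J)\<^sup>2 * of_int (T - a + 1) \<le> C * measure ?M ?G * measure ?M J" by (simp add: mult_ac)
  have "measure ?M J * of_int (T - a) \<le> C * measure ?M ?G"
  proof (cases "measure ?M J = 0")
    case True
    then show ?thesis using C0 by simp
  next
    case False
    then have pos: "measure ?M J > 0" by (simp add: zero_less_measure_iff)
    have "measure ?M J * of_int (T - a + 1) \<le> C * measure ?M ?G"
      using main pos by (simp add: power2_eq_square mult_ac)
    then show ?thesis using pos by (simp add: algebra_simps)
  qed
  then have "measure ?M J \<le> C / of_int (T - a) * measure ?M ?G"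
    using a(3) by (simp add: field_simps)
  then have "2 * measure ?M J \<le> 2 * C / of_int (T - a) * measure ?M ?G" by simp
  then show ?thesis using J(3) by linarith
qed

section \<open>Balls of real radius, colourings and the final bound\<close>

lemma padic_sup_norm_le_iff: "padic_sup_norm (x :: 'p::prime_card padic ^ 'm::finite) \<le> r \<longleftrightarrow> (\<forall>i. padic_abs (x $ i) \<le> r)"
  unfolding padic_sup_norm_def by (subst Max_le_iff) auto

text \<open>Nonzero absolute values are powers of \<open>p\<close>, so lowering the radius
  \<open>r\<close> to the largest power of \<open>p\<close> not exceeding it does not change the
  ball.\<close>

lemma padic_sup_norm_ball:
  assumes r: "real CARD('p) ^ N0 \<le> r"
  obtains N where "N \<ge> N0" "{x :: 'p::prime_card padic ^ 'm::finite. padic_sup_norm x \<le> r} = padic_ball N"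
proof -
  let ?p = "CARD('p)"
  note p1 = CARD_padic_gt_1[where 'p='p]
  obtain M where M: "r < real ?p ^ M" using real_arch_pow[OF p1] by blast
  define N where "N = (LEAST M. r < real ?p ^ Suc M)"
  have "r < real ?p ^ Suc M"
  proof -
    have "real ?p ^ M \<le> real ?p ^ Suc M" using p1 by (intro power_increasing) auto
    then show ?thesis using M by linarith
  qed
  then have N1: "r < real ?p ^ Suc N" unfolding N_def by (rule LeastI)
  have N0: "N \<ge> N0"
  proof (rule ccontr)
    assume "\<not> N \<ge> N0"
    then have "real ?p ^ Suc N \<le> real ?p ^ N0" using p1 by (intro power_increasing) auto
    then show False using N1 r by linarith
  qed
  have N2: "real ?p ^ N \<le> r"
  proof (cases "N = N0")
    case False
    then obtain N' where N': "N = Suc N'" using N0 by (cases N) auto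
    then have "\<not> r < real ?p ^ Suc N'" unfolding N_def by (intro not_less_Least) simp
    then show ?thesis using N' by simp
  qed (use r in simp)
  have "padic_abs z \<le> r \<longleftrightarrow> padic_abs z \<le> real ?p ^ N" for z :: "'p padic"
  proof
    assume z: "padic_abs z \<le> r"
    show "padic_abs z \<le> real ?p ^ N"
    proof (cases "z = 0")
      case False
      then obtain k where k: "padic_abs z = real ?p powi k" by (rule padic_abs_value)
      then have lt: "real ?p powi k < real ?p powi int (Suc N)" using z N1 by (simp add: power_int_of_nat del: of_nat_Suc)
      have "k < int (Suc N)"
      proof (rule ccontr)
        assume "\<not> k < int (Suc N)"
        then have "real ?p powi int (Suc N) \<le> real ?p powi k" using p1 by (intro power_int_increasing) auto
        then show False using lt by linarith
      qed
      then have "real ?p powi k \<le> real ?p powi int N" using p1 by (intro power_int_increasing) auto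
      then show ?thesis by (simp add: k)
    qed (use p1 in simp)
  qed (use N2 in linarith)
  then have "{x :: 'p padic ^ 'm. padic_sup_norm x \<le> r} = padic_ball N"
    by (simp add: padic_sup_norm_le_iff padic_ball_def)
  then show ?thesis using N0 that by blast
qed

lemma eventually_padic_sup_norm_ball:
  "eventually (\<lambda>r. \<exists>N\<ge>N0. {x :: 'p::prime_card padic ^ 'm::finite. padic_sup_norm x \<le> r} = padic_ball N) at_top"
  using eventually_ge_at_top[of "real CARD('p) ^ N0"]
proof eventually_elim
  case (elim r)
  from padic_sup_norm_ball[OF elim, where 'm='m] obtain N where
    "N \<ge> N0" "{x :: 'p padic ^ 'm. padic_sup_norm x \<le> r} = padic_ball N" .
  then show ?case by (intro exI[of _ N] conjI)
qed

lemma poly_curve_in_padic_ball: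
  fixes f :: "'m::finite \<Rightarrow> 'p::prime_card padic poly"
  obtains N0 where "\<And>N s. N \<ge> N0 \<Longrightarrow> padic_abs s \<le> R \<Longrightarrow> poly_curve f s \<in> padic_ball N"
proof -
  note p1 = CARD_padic_gt_1[where 'p='p]
  let ?A = "{s :: 'p padic. 0 \<le> padic_abs s \<and> padic_abs s \<le> R}"
  have "\<exists>B. \<forall>s\<in>?A. padic_abs (poly (f i) s) \<le> B" for i
  proof -
    have "continuous_on ?A (\<lambda>s. padic_abs (poly (f i) s))"
      by (rule continuous_on_compose2[OF continuous_on_padic_abs continuous_on_poly_padic]) auto
    then have "compact ((\<lambda>s. padic_abs (poly (f i) s)) ` ?A)" by (rule compact_continuous_image[OF _ compact_padic_annulus])
    then have "bounded ((\<lambda>s. padic_abs (poly (f i) s)) ` ?A)" by (rule compact_imp_bounded)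
    then obtain B where "\<And>y. y \<in> (\<lambda>s. padic_abs (poly (f i) s)) ` ?A \<Longrightarrow> norm y \<le> B" unfolding bounded_iff by blast
    then show ?thesis by (intro exI[of _ B]) (fastforce simp: abs_le_iff)
  qed
  then obtain B where B: "\<And>i s. s \<in> ?A \<Longrightarrow> padic_abs (poly (f i) s) \<le> B i" by metis
  obtain N0 where N0: "Max (range B) < real CARD('p) ^ N0" using real_arch_pow[OF p1] by blast
  show ?thesis
  proof (rule that[of N0])
    fix N and s :: "'p padic" assume N: "N \<ge> N0" and s: "padic_abs s \<le> R"
    have "padic_abs (poly (f i) s) \<le> real CARD('p) ^ N" for i
    proof -
      have "padic_abs (poly (f i) s) \<le> B i" by (rule B) (simp add: s padic_abs_nonneg)
      also have "B i \<le> Max (range B)" by (rule Max_ge) auto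
      also note N0
      also have "real CARD('p) ^ N0 \<le> real CARD('p) ^ N" using p1 N by (intro power_increasing) auto
      finally show ?thesis by simp
    qed
    then show "poly_curve f s \<in> padic_ball N" by (simp add: padic_ball_def poly_curve_def)
  qed
qed

text \<open>The colour of \<open>x\<close> is the polydisc containing \<open>x - rep x\<close>,
  where \<open>rep\<close> chooses a point in each coset of the subgroup
  \<open>padic_ball N\<close>. Two points of one colour that differ by an element of
  \<open>S\<close> lie in the same coset, so their difference lies in the polydisc around 0, which
  \<open>S\<close> avoids.\<close>

lemma padic_independence_ratio_pos:
  fixes S :: "('p::prime_card padic ^ 'm::finite) set"
  assumes S: "\<And>v. v \<in> S \<Longrightarrow> v \<in> padic_ball N" "\<And>v. v \<in> S \<Longrightarrow> v \<notin> padic_polydisc 0 n"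
  shows "0 < padic_independence_ratio (cayley_graph S)"
proof -
  let ?p = "CARD('p)"
  note p1 = CARD_padic_gt_1[where 'p='p]
  define c :: "('m \<Rightarrow> nat) \<Rightarrow> 'p padic ^ 'm" where "c F = (\<chi> i. of_nat (F i) / of_nat ?p ^ N)" for F
  define rep :: "'p padic ^ 'm \<Rightarrow> 'p padic ^ 'm" where "rep x = (SOME y. x - y \<in> padic_ball N)" for x
  have zero: "0 \<in> (padic_ball N :: ('p padic ^ 'm) set)" by (simp add: padic_ball_def)
  have rep: "x - rep x \<in> padic_ball N" for x
    unfolding rep_def by (rule someI[of _ x]) (simp add: zero)
  have rep_eq: "rep x = rep y" if "x - y \<in> padic_ball N" for x y
  proof -
    have "x - z \<in> padic_ball N \<longleftrightarrow> y - z \<in> padic_ball N" for z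
      using padic_ball_add[OF that, of "y - z"] padic_ball_diff[of "x - z" N "x - y"] that by auto
    then show ?thesis by (simp add: rep_def)
  qed
  define A where "A F = {x. x - rep x \<in> padic_polydisc (c F) n}" for F
  have diff_disc: "x - y \<in> padic_polydisc 0 n" if "x \<in> padic_polydisc z n" "y \<in> padic_polydisc z n" for x y z :: "'p padic ^ 'm"
  proof -
    have "x \<in> padic_polydisc y n" using that padic_polydisc_eqI by blast
    then show ?thesis by (simp add: padic_polydisc_def)
  qed
  have disc_ball: "x \<in> padic_ball N" if "x \<in> padic_polydisc 0 n" for x :: "'p padic ^ 'm"
  proof -
    have "1 / real ?p ^ n \<le> 1" "1 \<le> real ?p ^ N" using p1 by (simp_all add: one_le_power)
    then have "1 / real ?p ^ n \<le> real ?p ^ N" by linarith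
    then show ?thesis using that unfolding padic_ball_def padic_polydisc_def by (auto intro: order_trans)
  qed
  \<comment> \<open>Although \<open>rep\<close> rests on arbitrary choices, it is constant on the
    cosets of an open subgroup; hence the colour classes are open and in particular Borel.\<close>
  have open_A: "open (A F)" for F
    unfolding open_subopen[of "A F"]
  proof
    fix x assume x: "x \<in> A F"
    have "padic_polydisc x n \<subseteq> A F"
    proof
      fix y assume y: "y \<in> padic_polydisc x n"
      then have yx: "y - x \<in> padic_polydisc 0 n" by (simp add: padic_polydisc_def)
      have r: "rep y = rep x" by (rule rep_eq[OF disc_ball[OF yx]])
      have "y - rep x \<in> padic_polydisc (x - rep x) n" using y by (simp add: padic_polydisc_def)
      moreover have "padic_polydisc (x - rep x) n = padic_polydisc (c F) n"
        using x by (intro padic_polydisc_eqI) (simp add: A_def)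
      ultimately show "y \<in> A F" by (simp add: A_def r)
    qed
    then show "\<exists>T. open T \<and> x \<in> T \<and> T \<subseteq> A F"
      by (intro exI[of _ "padic_polydisc x n"] conjI open_padic_polydisc centre_in_padic_polydisc)
  qed
  have indep: "borel_independent (cayley_graph S) (A F)" for F
    unfolding borel_independent_def
  proof (intro conjI ballI notI)
    show "A F \<in> sets borel" using open_A by (rule borel_open)
    fix x y assume x: "x \<in> A F" and y: "y \<in> A F" and "(x, y) \<in> cayley_graph S"
    then have xy: "x - y \<in> S" by (simp add: cayley_graph_def)
    have "rep x = rep y" by (rule rep_eq[OF S(1)[OF xy]])
    then have "x - y = (x - rep x) - (y - rep y)" by simp
    also have "\<dots> \<in> padic_polydisc 0 n" using x y unfolding A_def by (intro diff_disc[of _ "c F"]) auto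
    finally show False using S(2)[OF xy] by simp
  qed
  have cover: "(\<Union>F\<in>UNIV \<rightarrow>\<^sub>E {..<?p ^ (N + n)}. A F) = UNIV"
  proof (intro equalityI subsetI UNIV_I)
    fix x :: "'p padic ^ 'm"
    show "x \<in> (\<Union>F\<in>UNIV \<rightarrow>\<^sub>E {..<?p ^ (N + n)}. A F)"
    proof -
      obtain F where "F \<in> UNIV \<rightarrow>\<^sub>E {..<?p ^ (N + n)}" "x - rep x \<in> padic_polydisc (c F) n"
        using rep[of x] unfolding padic_ball_eq_polydiscs[of N n] c_def by (elim UN_E)
      then show ?thesis by (intro UN_I[of F]) (simp_all add: A_def)
    qed
  qed
  show ?thesis
    unfolding padic_independence_ratio_def
  proof (rule independence_ratio_pos[OF finite_residue_functions indep cover sets_padic_haar])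
    show "eventually (\<lambda>r. {x :: 'p padic ^ 'm. padic_sup_norm x \<le> r} \<in> sets borel \<and>
        emeasure padic_haar {x :: 'p padic ^ 'm. padic_sup_norm x \<le> r} < \<infinity> \<and>
        0 < measure padic_haar {x :: 'p padic ^ 'm. padic_sup_norm x \<le> r}) at_top"
      using eventually_padic_sup_norm_ball[of 0, where 'p='p and 'm='m]
    proof eventually_elim
      case (elim r)
      then obtain M where "{x :: 'p padic ^ 'm. padic_sup_norm x \<le> r} = padic_ball M" by blast
      then show ?case
        by (simp only: borel_padic_ball emeasure_padic_ball_finite measure_padic_ball_pos simp_thms)
    qed
  qed
qed

lemma padic_curve_independence_ratio:
  fixes f :: "'m::finite \<Rightarrow> 'p::prime_card padic poly"
  assumes indep: "lin_indep_family (case_option 1 f)"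
  shows "\<exists>C>0. \<exists>a\<^sub>0\<ge>0. \<forall>a T :: int. a\<^sub>0 < real_of_int a \<and> a < T \<longrightarrow>
     0 < padic_independence_ratio (cayley_graph (curve_set padic_abs f (real CARD('p) powi a) (real CARD('p) powi T))) \<and>
     padic_independence_ratio (cayley_graph (curve_set padic_abs f (real CARD('p) powi a) (real CARD('p) powi T)))
       \<le> ereal (C / real_of_int (T - a))"
proof -
  let ?p = "CARD('p)"
  note p1 = CARD_padic_gt_1[where 'p='p]
  define d where "d = Max (insert 1 (range (\<lambda>i. Polynomial.degree (f i))))"
  have d: "d \<ge> 1" "\<And>i. Polynomial.degree (f i) \<le> d" unfolding d_def by (intro Max_ge; auto)+
  obtain g where g: "\<And>\<theta>. Polynomial.coeff (dot_poly f \<theta>) 0 = (\<Sum>j=1..d. g j * Polynomial.coeff (dot_poly f \<theta>) j)"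
    using coeff_0_combination[OF indep d(2)] by blast
  define q where "q = ln (real ?p)"
  define C where "C = d * (ln ((real ?p)\<^sup>2 * (real d)\<^sup>2) / q + 1) + d * (d * (ln (2 * real d) / q + 1))"
  fix i0 :: 'm
  have fin: "finite {s. poly (f i0) s = 0}"
    by (intro poly_roots_finite lin_indep_with_const_nonzero[OF indep])
  \<comment> \<open>Beyond \<open>R\<close> the coordinate \<open>i0\<close> has no roots, so the
    curve avoids 0, and the condition that controls the constant terms of the phases holds.\<close>
  define R where "R = Max (insert (2 * (\<Sum>j=1..d. padic_abs (g j)) * (real d)\<^sup>2) (padic_abs ` {s. poly (f i0) s = 0}))"
  have R: "2 * (\<Sum>j=1..d. padic_abs (g j)) * (real d)\<^sup>2 \<le> R" "\<And>s. poly (f i0) s = 0 \<Longrightarrow> padic_abs s \<le> R"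
    unfolding R_def using fin by (intro Max_ge; auto)+
  obtain a0 where a0: "R < real ?p ^ a0" using real_arch_pow[OF p1] by blast
  show ?thesis
  proof (intro exI conjI allI impI)
    show "0 < 2 * \<bar>C\<bar> + 1" "0 \<le> real a0" by simp_all
    fix a T :: int assume aT: "real a0 < real_of_int a \<and> a < T"
    then have a: "int a0 \<le> a" "a \<ge> 0" by linarith+
    have "real ?p powi int a0 \<le> real ?p powi a" using a p1 by (intro power_int_increasing) auto
    then have Ra: "R < real ?p powi a" using a0 by simp
    have nz: "poly_curve f s \<noteq> 0" if "real ?p powi a \<le> padic_abs s" for s
    proof
      assume "poly_curve f s = 0"
      then have "poly (f i0) s = 0" by (simp add: poly_curve_def vec_eq_iff)
      then show False using R(2) Ra that by force
    qed
    obtain N0 where N0: "\<And>N s. N \<ge> N0 \<Longrightarrow> padic_abs s \<le> real ?p powi T \<Longrightarrow> poly_curve f s \<in> padic_ball N"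
      using poly_curve_in_padic_ball by blast
    let ?D = "poly_curve f ` {s. real ?p powi a \<le> padic_abs s \<and> padic_abs s \<le> real ?p powi T}"
    let ?S = "curve_set padic_abs f (real ?p powi a) (real ?p powi T)"
    have cD: "compact ?D"
    proof (intro compact_continuous_image compact_padic_annulus)
      show "continuous_on {s. real ?p powi a \<le> padic_abs s \<and> padic_abs s \<le> real ?p powi T} (poly_curve f)"
        unfolding poly_curve_def[abs_def] by (intro continuous_on_vec_lambda continuous_on_poly_padic)
    qed
    \<comment> \<open>With \<open>{0}\<close> as the compact set, the separation lemma keeps the
      curve itself out of a polydisc around 0.\<close>
    have av: "x - y + v \<noteq> 0" if "x \<in> {0}" "y \<in> {0}" "v \<in> ?D" for x y v using that nz by auto
    obtain n where n: "\<And>x y v. x \<in> {0} \<Longrightarrow> y \<in> {0} \<Longrightarrow> v \<in> ?D \<Longrightarrow> x - y + v \<notin> padic_polydisc 0 n"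
      by (rule compact_differences_avoid_polydisc[OF compact_sing cD av]) blast+
    have S: "v \<in> ?D \<or> - v \<in> ?D" if "v \<in> ?S" for v using that by (auto simp: curve_set_def)
    show "0 < padic_independence_ratio (cayley_graph ?S)"
    proof (rule padic_independence_ratio_pos[of _ N0 n])
      have D: "v \<in> padic_ball N0" "v \<notin> padic_polydisc 0 n" if "v \<in> ?D" for v
        using n[of 0 0 v] that N0[OF order.refl] by auto
      fix v assume "v \<in> ?S"
      from S[OF this] show "v \<in> padic_ball N0" "v \<notin> padic_polydisc 0 n"
        using D[of v] D[of "- v"] by (auto simp: padic_ball_def padic_polydisc_def padic_abs_minus)
    qed
    show "padic_independence_ratio (cayley_graph ?S) \<le> ereal ((2 * \<bar>C\<bar> + 1) / real_of_int (T - a))"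
      unfolding padic_independence_ratio_def
    proof (intro independence_ratio_le upper_density_le)
      fix I assume I: "borel_independent (cayley_graph ?S) I"
      show "eventually (\<lambda>r. 0 < measure padic_haar {x :: 'p padic ^ 'm. padic_sup_norm x \<le> r} \<and>
          measure padic_haar (I \<inter> {x. padic_sup_norm x \<le> r}) \<le>
            (2 * \<bar>C\<bar> + 1) / real_of_int (T - a) * measure padic_haar {x :: 'p padic ^ 'm. padic_sup_norm x \<le> r}) at_top"
        using eventually_padic_sup_norm_ball[of N0, where 'p='p and 'm='m]
      proof eventually_elim
        case (elim r)
        then obtain N where N: "N \<ge> N0" "{x :: 'p padic ^ 'm. padic_sup_norm x \<le> r} = padic_ball N" by blast
        have "2 * (\<Sum>j=1..d. padic_abs (g j)) * (real d)\<^sup>2 \<le> real ?p powi a" using R(1) Ra by linarith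
        from padic_independent_bound[OF d g a(2) this _ nz I N0[OF N(1)]]
        have "measure padic_haar (I \<inter> padic_ball N) \<le> 2 * C / real_of_int (T - a) * measure padic_haar (padic_ball N :: ('p padic ^ 'm) set)"
          using aT by (simp add: C_def q_def)
        also have "\<dots> \<le> (2 * \<bar>C\<bar> + 1) / real_of_int (T - a) * measure padic_haar (padic_ball N :: ('p padic ^ 'm) set)"
          using aT by (intro mult_right_mono divide_right_mono) auto
        finally show ?case unfolding N(2) using measure_padic_ball_pos by blast
      qed
    qed
  qed
qed

theorem theorem1p2:
  assumes m: "CARD('m::finite) \<ge> 2"
  shows
    "(\<forall>f :: 'm \<Rightarrow> real poly. lin_indep_family (case_option 1 f) \<longrightarrow>
        (\<exists>C>0. \<exists>a\<^sub>0\<ge>0. \<forall>a T :: real. a\<^sub>0 < a \<and> a < T \<longrightarrow>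
           0 < real_independence_ratio (cayley_graph (curve_set abs f (exp a) (exp T))) \<and>
           real_independence_ratio (cayley_graph (curve_set abs f (exp a) (exp T))) \<le> ereal (C / (T - a)))) \<and>
     (\<forall>f :: 'm \<Rightarrow> 'p::prime_card padic poly. lin_indep_family (case_option 1 f) \<longrightarrow>
        (\<exists>C>0. \<exists>a\<^sub>0\<ge>0. \<forall>a T :: int. a\<^sub>0 < real_of_int a \<and> a < T \<longrightarrow>
           0 < padic_independence_ratio
                 (cayley_graph (curve_set padic_abs f (real CARD('p) powi a) (real CARD('p) powi T))) \<and>
           padic_independence_ratio
                 (cayley_graph (curve_set padic_abs f (real CARD('p) powi a) (real CARD('p) powi T)))
             \<le> ereal (C / real_of_int (T - a))))"
  by (intro conjI allI impI real_curve_independence_ratio padic_curve_independence_ratio)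

end
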